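(* Consider the MAC model with independent sources and correlated receiver side information, i.e. $p(s_1,s_2,w_1)=p(s_1)p(s_2)p(w_1|s_1,s_2)$. Then source-channel rate $b$ is achievable if there exist a distribution $p(q,x_1,x_2,y_1)=p(q)p(x_1|q)p(x_2|q)p(y_1|x_1,x_2)$ with $|\mathcal{Q}|\le4$ such that $$H(S_1|S_2,W_1)<b\,I(X_1;Y_1|X_2,Q),\quad H(S_2|S_1,W_1)<b\,I(X_2;Y_1|X_1,Q),\quad H(S_1,S_2|W_1)<b\,I(X_1,X_2;Y_1|Q).$$ Conversely, if $b$ is achievable, then these inequalities hold with $<$ replaced by $\le$ for some distribution of the same form.
   Context: MAC model: source/side-information sequences $\{(S_{1,k},S_{2,k},W_{1,k})\}_{k\ge1}$ are i.i.d. $\sim p(s_1,s_2,w_1)$ on finite alphabets. Transmitter $i\in\{1,2\}$ observes $S_i^m$ and sends $X_i^n=f_i^{(m,n)}(S_i^m)$; the channel $p(y_1|x_1,x_2)$ is discrete memoryless with finite alphabets. The receiver outputs $(\hat S_1^m,\hat S_2^m)=g^{(m,n)}(Y_1^n,W_1^m)$. Error probability $P_e^{(m,n)}=\Pr\{(S_1^m,S_2^m)\neq(\hat S_1^m,\hat S_2^m)\}$. A source-channel rate $b$ is achievable if for every $\epsilon>0$ there exist positive integers $m,n$ with $n/m=b$ and encoders/decoder with $P_e^{(m,n)}<\epsilon$.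
   Formalization: The rate b is assumed rational: since achievability requires n/m = b exactly, an irrational b is never achievable, so the direct part fails for irrational b (e.g. constant sources, noiseless channel, b = √2), and the converse is vacuous there. *)

theory Defs
  imports Complex_Main
begin

text \<open>A joint pmf is a function p on a finite set A of outcomes; random variables are
  functions on A.  marg A p g v is the probability that g takes the value v.\<close>

definition marg :: "'a set \<Rightarrow> ('a \<Rightarrow> real) \<Rightarrow> ('a \<Rightarrow> 'b) \<Rightarrow> 'b \<Rightarrow> real" where
  "marg A p g v = (\<Sum>a\<in>A. if g a = v then p a else 0)"

definition cond_entropy :: "'a set \<Rightarrow> ('a \<Rightarrow> real) \<Rightarrow> ('a \<Rightarrow> 'b) \<Rightarrow> ('a \<Rightarrow> 'c) \<Rightarrow> real" where
  "cond_entropy A p f g =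
     - (\<Sum>a\<in>A. if p a = 0 then 0 else
          p a * log 2 (marg A p (\<lambda>x. (f x, g x)) (f a, g a) / marg A p g (g a)))"

definition cond_mutual_info ::
  "'a set \<Rightarrow> ('a \<Rightarrow> real) \<Rightarrow> ('a \<Rightarrow> 'b) \<Rightarrow> ('a \<Rightarrow> 'c) \<Rightarrow> ('a \<Rightarrow> 'd) \<Rightarrow> real" where
  "cond_mutual_info A p f g h = cond_entropy A p f h - cond_entropy A p f (\<lambda>x. (g x, h x))"

definition is_pmf :: "('a::finite \<Rightarrow> real) \<Rightarrow> bool" where
  "is_pmf p \<longleftrightarrow> (\<forall>x. 0 \<le> p x) \<and> (\<Sum>x\<in>UNIV. p x) = 1"

definition is_channel :: "('x1 \<Rightarrow> 'x2 \<Rightarrow> 'y::finite \<Rightarrow> real) \<Rightarrow> bool" where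
  "is_channel W \<longleftrightarrow> (\<forall>x1 x2. is_pmf (W x1 x2))"

definition err_prob ::
  "('s1::finite \<Rightarrow> 's2::finite \<Rightarrow> 'w::finite \<Rightarrow> real) \<Rightarrow> ('x1 \<Rightarrow> 'x2 \<Rightarrow> 'y::finite \<Rightarrow> real)
   \<Rightarrow> nat \<Rightarrow> nat \<Rightarrow> ('s1 list \<Rightarrow> 'x1 list) \<Rightarrow> ('s2 list \<Rightarrow> 'x2 list)
   \<Rightarrow> ('y list \<Rightarrow> 'w list \<Rightarrow> 's1 list \<times> 's2 list) \<Rightarrow> real" where
  "err_prob P W m n f1 f2 g =
     (\<Sum>s1\<in>{xs. length xs = m}. \<Sum>s2\<in>{xs. length xs = m}. \<Sum>w\<in>{xs. length xs = m}.
        \<Sum>y\<in>{ys. length ys = n}.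
          (\<Prod>i<m. P (s1 ! i) (s2 ! i) (w ! i)) *
          (\<Prod>j<n. W (f1 s1 ! j) (f2 s2 ! j) (y ! j)) *
          (if g y w \<noteq> (s1, s2) then 1 else 0))"

definition achievable ::
  "('s1::finite \<Rightarrow> 's2::finite \<Rightarrow> 'w::finite \<Rightarrow> real) \<Rightarrow> ('x1 \<Rightarrow> 'x2 \<Rightarrow> 'y::finite \<Rightarrow> real)
   \<Rightarrow> real \<Rightarrow> bool" where
  "achievable P W b \<longleftrightarrow>
     (\<forall>\<epsilon>>0. \<exists>m n. 0 < m \<and> 0 < n \<and> real n / real m = b \<and>
        (\<exists>(f1 :: 's1 list \<Rightarrow> 'x1 list) (f2 :: 's2 list \<Rightarrow> 'x2 list)
           (g :: 'y list \<Rightarrow> 'w list \<Rightarrow> 's1 list \<times> 's2 list).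
           (\<forall>s. length s = m \<longrightarrow> length (f1 s) = n) \<and>
           (\<forall>s. length s = m \<longrightarrow> length (f2 s) = n) \<and>
           err_prob P W m n f1 f2 g < \<epsilon>))"

text \<open>Joint distribution p(q)p(x1|q)p(x2|q)p(y|x1,x2) on Q x X1 x X2 x Y, with
  Q = {0..<4} (covers every time-sharing alphabet of size at most 4).\<close>
definition joint_qxy ::
  "(nat \<Rightarrow> real) \<Rightarrow> (nat \<Rightarrow> 'x1 \<Rightarrow> real) \<Rightarrow> (nat \<Rightarrow> 'x2 \<Rightarrow> real) \<Rightarrow> ('x1 \<Rightarrow> 'x2 \<Rightarrow> 'y \<Rightarrow> real)
   \<Rightarrow> nat \<times> 'x1 \<times> 'x2 \<times> 'y \<Rightarrow> real" where
  "joint_qxy pq px1 px2 W = (\<lambda>(q, x1, x2, y). pq q * px1 q x1 * px2 q x2 * W x1 x2 y)"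

definition Qspace :: "(nat \<times> 'x1::finite \<times> 'x2::finite \<times> 'y::finite) set" where
  "Qspace = {0..<4} \<times> UNIV"

definition valid_input_dist ::
  "(nat \<Rightarrow> real) \<Rightarrow> (nat \<Rightarrow> 'x1::finite \<Rightarrow> real) \<Rightarrow> (nat \<Rightarrow> 'x2::finite \<Rightarrow> real) \<Rightarrow> bool" where
  "valid_input_dist pq px1 px2 \<longleftrightarrow>
     (\<forall>q. 0 \<le> pq q) \<and> (\<Sum>q<4. pq q) = 1 \<and> (\<forall>q. is_pmf (px1 q)) \<and> (\<forall>q. is_pmf (px2 q))"

definition rate_conditions ::
  "(real \<Rightarrow> real \<Rightarrow> bool) \<Rightarrow> ('s1::finite \<Rightarrow> 's2::finite \<Rightarrow> 'w::finite \<Rightarrow> real)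
   \<Rightarrow> ('x1::finite \<Rightarrow> 'x2::finite \<Rightarrow> 'y::finite \<Rightarrow> real) \<Rightarrow> real
   \<Rightarrow> (nat \<Rightarrow> real) \<Rightarrow> (nat \<Rightarrow> 'x1 \<Rightarrow> real) \<Rightarrow> (nat \<Rightarrow> 'x2 \<Rightarrow> real) \<Rightarrow> bool" where
  "rate_conditions R P W b pq px1 px2 \<longleftrightarrow>
    (let PS = (\<lambda>(s1, s2, w). P s1 s2 w);
         J = joint_qxy pq px1 px2 W;
         Q = (\<lambda>(q, x1, x2, y). q); X1 = (\<lambda>(q, x1, x2, y). x1);
         X2 = (\<lambda>(q, x1, x2, y). x2); Y = (\<lambda>(q, x1, x2, y). y)
     in R (cond_entropy UNIV PS (\<lambda>(s1, s2, w). s1) (\<lambda>(s1, s2, w). (s2, w)))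
          (b * cond_mutual_info Qspace J X1 Y (\<lambda>t. (X2 t, Q t)))
      \<and> R (cond_entropy UNIV PS (\<lambda>(s1, s2, w). s2) (\<lambda>(s1, s2, w). (s1, w)))
          (b * cond_mutual_info Qspace J X2 Y (\<lambda>t. (X1 t, Q t)))
      \<and> R (cond_entropy UNIV PS (\<lambda>(s1, s2, w). (s1, s2)) (\<lambda>(s1, s2, w). w))
          (b * cond_mutual_info Qspace J (\<lambda>t. (X1 t, X2 t)) Y Q))"

end

theory Submission
  imports Defs "HOL-Analysis.Analysis" "HOL-Real_Asymp.Real_Asymp"
begin

text \<open>
  Achievability. For every source sequence an independent random codeword is drawn, given a fixed
  time-sharing sequence. With M1 and D1 the conditional laws of the side information and of the
  output when the first source is averaged out, the decoder accepts a pair of source sequences if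
  the likelihood PS * V exceeds t * M1 * D1, and similarly for the second user and for both users.
  A change of measure bounds the expected number of false acceptances of each of the three kinds
  by 1 / t, without any typical sets. The correct pair is rejected with small probability by
  Chebyshev's inequality, if log t is half the gap in the rate conditions.

  Converse. Let T be the joint law of sources, side information and output. Gibbs' inequality
  between T and the product of the marginal of the conditioning variables, of the single-letter
  output laws, and of a guess r of the sources (the decoder's output mixed with the uniform law)
  contains Fano's inequality, the data processing inequality and the single-letterization at once.
  The single-letter points average to a point of the convex hull of a compact region in dimension
  three, so a limit point exists, and by Caratheodory's theorem four time-sharing letters suffice.
\<close>

subsection \<open>Product weights on sequences\<close>

text \<open>Typical sets are avoidable because a wrong codeword is independent of the output: the
  weight of a false acceptance is a product M * D, and acceptance itself says M * D < PS * V / t,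
  which sums to at most 1 / t. Of the gap m * c accumulated over a block, m * c / 2 pays for log t;
  the rest is left to fluctuations and split evenly between source and channel, whence the c / 4 in
  \<open>threshold_prob\<close>. In the converse, Gibbs' inequality needs a reference law that is
  positive wherever T is. The decoder's output alone is not; the uniform part of weight \<epsilon>
  repairs this and costs a term of order m on the error event only. As \<epsilon> shrinks, nothing
  is known about m, so the slack has to be bounded uniformly in m and n. Independence of the sources
  is what makes the two letters of each channel use a product law. Sequences carry an alphabet set
  because the time-sharing letters form a finite part of \<open>nat\<close>.\<close>

definition seqs :: "'a set \<Rightarrow> nat \<Rightarrow> 'a list set" where
  "seqs A n = {xs. set xs \<subseteq> A \<and> length xs = n}"

lemma finite_seqs: "finite A \<Longrightarrow> finite (seqs A n)"
  unfolding seqs_def by (rule finite_lists_length_eq)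

lemma seqs_UNIV: "seqs UNIV n = {xs. length xs = n}"
  by (simp add: seqs_def)

lemma seqs_nth: "xs \<in> seqs A n \<Longrightarrow> i < n \<Longrightarrow> xs ! i \<in> A"
  by (auto simp: seqs_def)

lemma seqs_Suc: "seqs A (Suc n) = (\<lambda>(x, xs). x # xs) ` (A \<times> seqs A n)"
  by (auto simp: seqs_def length_Suc_conv image_iff)

text \<open>Distributivity, by induction on the length. The weight may depend on the position, so
  the same formula covers codeword laws given a time-sharing sequence and sums over one sequence
  with the others held fixed.\<close>

lemma sum_seqs_prod:
  fixes v :: "nat \<Rightarrow> 'a \<Rightarrow> real"
  shows "(\<Sum>xs\<in>seqs A n. \<Prod>i<n. v i (xs ! i)) = (\<Prod>i<n. \<Sum>x\<in>A. v i x)"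
proof (induction n arbitrary: v)
  case 0
  have "seqs A 0 = {[]}" by (auto simp: seqs_def)
  then show ?case by simp
next
  case (Suc n)
  have "(\<Sum>xs\<in>seqs A (Suc n). \<Prod>i<Suc n. v i (xs ! i))
      = (\<Sum>(x, xs)\<in>A \<times> seqs A n. \<Prod>i<Suc n. v i ((x # xs) ! i))"
    unfolding seqs_Suc by (subst sum.reindex) (auto simp: inj_on_def case_prod_unfold)
  also have "\<dots> = (\<Sum>x\<in>A. \<Sum>xs\<in>seqs A n. v 0 x * (\<Prod>i<n. v (Suc i) (xs ! i)))"
    unfolding sum.cartesian_product[symmetric] by (simp add: prod.lessThan_Suc_shift del: prod.lessThan_Suc)
  also have "\<dots> = (\<Sum>x\<in>A. v 0 x) * (\<Prod>i<n. \<Sum>x\<in>A. v (Suc i) x)"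
    by (simp add: sum_distrib_left[symmetric] Suc[of "\<lambda>i. v (Suc i)"] sum_distrib_right)
  finally show ?case by (simp add: prod.lessThan_Suc_shift del: prod.lessThan_Suc)
qed

text \<open>Independence of the coordinates: those outside \<open>I\<close> contribute the factor 1.
  Padding the product over \<open>I\<close> by ones reduces the claim to
  \<open>sum_seqs_prod\<close>.\<close>

lemma seqs_expect_prod:
  fixes v \<phi> :: "nat \<Rightarrow> 'a \<Rightarrow> real"
  assumes I: "I \<subseteq> {..<n}" and v: "\<And>i. i < n \<Longrightarrow> (\<Sum>x\<in>A. v i x) = 1"
  shows "(\<Sum>xs\<in>seqs A n. (\<Prod>i<n. v i (xs ! i)) * (\<Prod>i\<in>I. \<phi> i (xs ! i)))
         = (\<Prod>i\<in>I. \<Sum>x\<in>A. v i x * \<phi> i x)"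
proof -
  have r: "(\<Prod>i\<in>I. f i) = (\<Prod>i<n. if i \<in> I then f i else 1)" for f :: "nat \<Rightarrow> real"
    using I by (simp add: prod.inter_restrict[symmetric] Int_absorb1)
  have "(\<Sum>xs\<in>seqs A n. (\<Prod>i<n. v i (xs ! i)) * (\<Prod>i\<in>I. \<phi> i (xs ! i)))
      = (\<Sum>xs\<in>seqs A n. \<Prod>i<n. v i (xs ! i) * (if i \<in> I then \<phi> i (xs ! i) else 1))"
    by (simp add: r prod.distrib)
  also have "\<dots> = (\<Prod>i<n. \<Sum>x\<in>A. v i x * (if i \<in> I then \<phi> i x else 1))"
    by (rule sum_seqs_prod)
  also have "\<dots> = (\<Prod>i<n. if i \<in> I then \<Sum>x\<in>A. v i x * \<phi> i x else 1)"
    by (rule prod.cong) (auto simp: v)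
  finally show ?thesis by (simp add: r)
qed

lemma seqs_expect_nth:
  fixes v :: "nat \<Rightarrow> 'a \<Rightarrow> real"
  assumes "j < n" and "\<And>i. i < n \<Longrightarrow> (\<Sum>x\<in>A. v i x) = 1"
  shows "(\<Sum>xs\<in>seqs A n. (\<Prod>i<n. v i (xs ! i)) * \<phi> (xs ! j)) = (\<Sum>x\<in>A. v j x * \<phi> x)"
  using seqs_expect_prod[of "{j}" n v A "\<lambda>_. \<phi>"] assms by simp

text \<open>After the square is expanded, the off-diagonal products vanish by independence and
  centring; the n diagonal ones give the variance.\<close>

lemma seqs_second_moment:
  fixes p \<phi> :: "'a \<Rightarrow> real"
  assumes p: "(\<Sum>x\<in>A. p x) = 1" and zero: "(\<Sum>x\<in>A. p x * \<phi> x) = 0"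
  shows "(\<Sum>xs\<in>seqs A n. (\<Prod>i<n. p (xs ! i)) * (\<Sum>i<n. \<phi> (xs ! i))\<^sup>2)
         = real n * (\<Sum>x\<in>A. p x * (\<phi> x)\<^sup>2)"
proof -
  let ?w = "\<lambda>xs. \<Prod>i<n. p (xs ! i)"
  have pair: "(\<Sum>xs\<in>seqs A n. ?w xs * (\<phi> (xs ! i) * \<phi> (xs ! j)))
      = (if i = j then \<Sum>x\<in>A. p x * (\<phi> x)\<^sup>2 else 0)" if "i < n" "j < n" for i j
  proof (cases "i = j")
    case True
    then show ?thesis
      using seqs_expect_nth[of j n "\<lambda>_. p" A "\<lambda>x. \<phi> x * \<phi> x"] that p
      by (simp add: power2_eq_square)
  next
    case False
    then show ?thesis
      using seqs_expect_prod[of "{i, j}" n "\<lambda>_. p" A "\<lambda>_. \<phi>"] that p zero by simp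
  qed
  have "(\<Sum>xs\<in>seqs A n. ?w xs * (\<Sum>i<n. \<phi> (xs ! i))\<^sup>2)
      = (\<Sum>xs\<in>seqs A n. \<Sum>i<n. \<Sum>j<n. ?w xs * (\<phi> (xs ! i) * \<phi> (xs ! j)))"
    by (simp only: power2_eq_square sum_product) (simp only: sum_distrib_left)
  also have "\<dots> = (\<Sum>i<n. \<Sum>xs\<in>seqs A n. \<Sum>j<n. ?w xs * (\<phi> (xs ! i) * \<phi> (xs ! j)))"
    by (rule sum.swap)
  also have "\<dots> = (\<Sum>i<n. \<Sum>j<n. \<Sum>xs\<in>seqs A n. ?w xs * (\<phi> (xs ! i) * \<phi> (xs ! j)))"
    by (intro sum.cong refl sum.swap)
  also have "\<dots> = (\<Sum>i<n. \<Sum>j<n. if i = j then \<Sum>x\<in>A. p x * (\<phi> x)\<^sup>2 else 0)"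
    by (intro sum.cong refl pair) auto
  also have "\<dots> = real n * (\<Sum>x\<in>A. p x * (\<phi> x)\<^sup>2)"
    by (simp add: sum.delta)
  finally show ?thesis .
qed

lemma seqs_chebyshev:
  fixes p \<phi> :: "'a \<Rightarrow> real"
  assumes "finite A" and p0: "\<And>x. x \<in> A \<Longrightarrow> 0 \<le> p x"
    and p: "(\<Sum>x\<in>A. p x) = 1" and zero: "(\<Sum>x\<in>A. p x * \<phi> x) = 0" and a: "0 < a"
  shows "(\<Sum>xs\<in>seqs A n. (\<Prod>i<n. p (xs ! i)) * of_bool ((\<Sum>i<n. \<phi> (xs ! i)) \<le> - a))
         \<le> real n * (\<Sum>x\<in>A. p x * (\<phi> x)\<^sup>2) / a\<^sup>2"
proof -
  \<comment> \<open>Pointwise Chebyshev: the normalized square dominates the indicator of the lower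
    tail.\<close>
  have ind: "of_bool (z \<le> - a) \<le> z\<^sup>2 / a\<^sup>2" for z :: real
  proof (cases "z \<le> - a")
    case True
    then have "a\<^sup>2 \<le> (- z)\<^sup>2" using a by (intro power_mono) auto
    then show ?thesis using a True by simp
  qed simp
  have "(\<Sum>xs\<in>seqs A n. (\<Prod>i<n. p (xs ! i)) * of_bool ((\<Sum>i<n. \<phi> (xs ! i)) \<le> - a))
      \<le> (\<Sum>xs\<in>seqs A n. (\<Prod>i<n. p (xs ! i)) * ((\<Sum>i<n. \<phi> (xs ! i))\<^sup>2 / a\<^sup>2))"
    by (intro sum_mono mult_left_mono ind prod_nonneg) (auto intro: p0 seqs_nth)
  also have "\<dots> = (\<Sum>xs\<in>seqs A n. (\<Prod>i<n. p (xs ! i)) * (\<Sum>i<n. \<phi> (xs ! i))\<^sup>2) / a\<^sup>2"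
    by (simp add: sum_divide_distrib)
  finally show ?thesis by (simp add: seqs_second_moment[OF p zero])
qed

text \<open>Parallel sequences become one sequence over the product alphabet, in which jointly
  distributed letters are again i.i.d.\<close>

lemma sum_seqs_zip:
  "(\<Sum>xs\<in>seqs A n. \<Sum>ys\<in>seqs B n. F xs ys) = (\<Sum>zs\<in>seqs (A \<times> B) n. F (map fst zs) (map snd zs))"
  unfolding sum.cartesian_product
  by (rule sum.reindex_bij_witness[where i = "\<lambda>zs. (map fst zs, map snd zs)" and j = "\<lambda>(xs, ys). zip xs ys"])
     (auto simp: seqs_def zip_map_fst_snd dest: set_zip_leftD set_zip_rightD)

subsection \<open>Random codebooks\<close>

text \<open>A random codebook is a function on the messages with independent values of law
  \<open>p\<close>; the codewords of all messages other than \<open>s\<close> sum out to 1.\<close>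

lemma codebook_expect:
  fixes p :: "'x \<Rightarrow> real"
  assumes "finite A" "finite X" and p: "(\<Sum>x\<in>X. p x) = 1" and s: "s \<in> A"
  shows "(\<Sum>c\<in>PiE A (\<lambda>_. X). (\<Prod>a\<in>A. p (c a)) * F (c s)) = (\<Sum>x\<in>X. p x * F x)"
proof -
  have r: "(\<Prod>a\<in>A. p (c a)) * F (c s) = (\<Prod>a\<in>A. p (c a) * (if a = s then F (c a) else 1))" for c
    using assms by (simp add: prod.distrib)
  have "(\<Sum>c\<in>PiE A (\<lambda>_. X). (\<Prod>a\<in>A. p (c a)) * F (c s))
      = (\<Prod>a\<in>A. \<Sum>x\<in>X. p x * (if a = s then F x else 1))"
    unfolding r using assms by (subst prod_sum_PiE) auto
  also have "\<dots> = (\<Prod>a\<in>A. if a = s then \<Sum>x\<in>X. p x * F x else 1)"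
    by (rule prod.cong) (auto simp: p)
  finally show ?thesis using assms by simp
qed

text \<open>Codewords of distinct messages are independent. Since \<open>F\<close> need not be a
  product, it is expanded over the values u of \<open>c s\<close> into terms
  \<open>of_bool (c s = u) * F u (c s')\<close>, each of which factors over the messages.\<close>

lemma codebook_expect_pair:
  fixes p :: "'x \<Rightarrow> real"
  assumes "finite A" "finite X" and p: "(\<Sum>x\<in>X. p x) = 1" and s: "s \<in> A" "s' \<in> A" "s \<noteq> s'"
  shows "(\<Sum>c\<in>PiE A (\<lambda>_. X). (\<Prod>a\<in>A. p (c a)) * F (c s) (c s'))
       = (\<Sum>x\<in>X. \<Sum>x'\<in>X. p x * p x' * F x x')"
proof -
  let ?C = "PiE A (\<lambda>_. X)"
  have r: "(\<Prod>a\<in>A. p (c a)) * (of_bool (c s = u) * F u (c s'))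
      = (\<Prod>a\<in>A. p (c a) * (if a = s then of_bool (c a = u) else 1) * (if a = s' then F u (c a) else 1))" for c u
    using assms by (simp add: prod.distrib)
  have one: "(\<Sum>c\<in>?C. (\<Prod>a\<in>A. p (c a)) * (of_bool (c s = u) * F u (c s')))
      = p u * (\<Sum>x'\<in>X. p x' * F u x')" if "u \<in> X" for u
  proof -
    have "(\<Sum>c\<in>?C. (\<Prod>a\<in>A. p (c a)) * (of_bool (c s = u) * F u (c s')))
        = (\<Prod>a\<in>A. \<Sum>x\<in>X. p x * (if a = s then of_bool (x = u) else 1) * (if a = s' then F u x else 1))"
      unfolding r using assms by (subst prod_sum_PiE) auto
    also have "\<dots> = (\<Prod>a\<in>A. (if a = s then p u else 1) * (if a = s' then \<Sum>x\<in>X. p x * F u x else 1))"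
    proof (rule prod.cong)
      fix a assume "a \<in> A"
      have "(\<Sum>x\<in>X. p x * of_bool (x = u)) = p u"
        using that assms(2) by (simp add: of_bool_def if_distrib[of "\<lambda>z. _ * z"] cong: if_cong)
      then show "(\<Sum>x\<in>X. p x * (if a = s then of_bool (x = u) else 1) * (if a = s' then F u x else 1))
        = (if a = s then p u else 1) * (if a = s' then \<Sum>x\<in>X. p x * F u x else 1)"
        using s p by auto
    qed simp
    finally show ?thesis using assms by (simp add: prod.distrib)
  qed
  have split: "F (c s) (c s') = (\<Sum>u\<in>X. of_bool (c s = u) * F u (c s'))" if "c \<in> ?C" for c
  proof -
    have "c s \<in> X" using that s by auto
    then show ?thesis using assms(2) by (simp add: of_bool_def if_distrib[of "\<lambda>z. z * _"] cong: if_cong)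
  qed
  have "(\<Sum>c\<in>?C. (\<Prod>a\<in>A. p (c a)) * F (c s) (c s'))
      = (\<Sum>c\<in>?C. \<Sum>u\<in>X. (\<Prod>a\<in>A. p (c a)) * (of_bool (c s = u) * F u (c s')))"
    by (intro sum.cong refl) (subst split, auto simp: sum_distrib_left)
  also have "\<dots> = (\<Sum>u\<in>X. p u * (\<Sum>x'\<in>X. p x' * F u x'))"
    by (subst sum.swap) (simp add: one)
  finally show ?thesis by (simp add: sum_distrib_left mult.assoc)
qed

text \<open>The probabilistic method: it turns bounds on averages into one time-sharing sequence and
  one codebook per user. If every value exceeded the bound, all weights would have to
  vanish.\<close>

lemma exists_le_average:
  fixes p f :: "'k \<Rightarrow> real"
  assumes "finite K" and p0: "\<And>k. k \<in> K \<Longrightarrow> 0 \<le> p k" and p: "(\<Sum>k\<in>K. p k) = 1"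
    and le: "(\<Sum>k\<in>K. p k * f k) \<le> B"
  shows "\<exists>k\<in>K. f k \<le> B"
proof (rule ccontr)
  assume "\<not> ?thesis"
  then have gt: "\<And>k. k \<in> K \<Longrightarrow> B < f k" by force
  have "(\<Sum>k\<in>K. p k * (f k - B)) \<le> 0"
    using le p by (simp add: algebra_simps sum_subtractf flip: sum_distrib_left)
  moreover have nn: "0 \<le> p k * (f k - B)" if "k \<in> K" for k
    using gt[OF that] p0[OF that] by simp
  ultimately have "(\<Sum>k\<in>K. p k * (f k - B)) = 0"
    by (meson antisym sum_nonneg)
  then have "\<forall>k\<in>K. p k * (f k - B) = 0"
    using nn by (subst (asm) sum_nonneg_eq_0_iff[OF assms(1)]) auto
  then have "\<forall>k\<in>K. p k = 0" using gt by fastforce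
  then show False using p by simp
qed

text \<open>\<open>block_code\<close> puts whole blocks for the letters, so the alphabets are
  arbitrary finite sets and no product structure enters. The three lines of \<open>good\<close>
  guard against a wrong first message, a wrong second message and two wrong messages, which is the 3
  in 3 / t; the other summand is the probability that the right pair fails its test.\<close>

lemma one_shot_coding:
  fixes PS :: "'a \<Rightarrow> 'b \<Rightarrow> 'c \<Rightarrow> real" and V :: "'x \<Rightarrow> 'z \<Rightarrow> 'y \<Rightarrow> real"
    and p1 :: "'x \<Rightarrow> real" and p2 :: "'z \<Rightarrow> real" and t :: real
  assumes fin: "finite A" "finite B" "finite C" "finite X" "finite Z" "finite Y"
    and PS0: "\<And>a b c. 0 \<le> PS a b c" and PS1: "(\<Sum>a\<in>A. \<Sum>b\<in>B. \<Sum>c\<in>C. PS a b c) = 1"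
    and V0: "\<And>x z y. 0 \<le> V x z y" and V1: "\<And>x z. x \<in> X \<Longrightarrow> z \<in> Z \<Longrightarrow> (\<Sum>y\<in>Y. V x z y) = 1"
    and p10: "\<And>x. 0 \<le> p1 x" and p11: "(\<Sum>x\<in>X. p1 x) = 1"
    and p20: "\<And>z. 0 \<le> p2 z" and p21: "(\<Sum>z\<in>Z. p2 z) = 1"
    and t: "0 < t"
  defines "good \<equiv> \<lambda>a b c x z y.
      t * ((\<Sum>a'\<in>A. PS a' b c) * (\<Sum>x'\<in>X. p1 x' * V x' z y)) < PS a b c * V x z y
    \<and> t * ((\<Sum>b'\<in>B. PS a b' c) * (\<Sum>z'\<in>Z. p2 z' * V x z' y)) < PS a b c * V x z y
    \<and> t * ((\<Sum>a'\<in>A. \<Sum>b'\<in>B. PS a' b' c) * (\<Sum>x'\<in>X. \<Sum>z'\<in>Z. p1 x' * (p2 z' * V x' z' y)))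
        < PS a b c * V x z y"
  shows "\<exists>c1\<in>PiE A (\<lambda>_. X). \<exists>c2\<in>PiE B (\<lambda>_. Z). \<exists>g.
      (\<Sum>a\<in>A. \<Sum>b\<in>B. \<Sum>c\<in>C. \<Sum>y\<in>Y. PS a b c * (V (c1 a) (c2 b) y * of_bool (g y c \<noteq> (a, b))))
    \<le> (\<Sum>a\<in>A. \<Sum>b\<in>B. \<Sum>c\<in>C. PS a b c *
          (\<Sum>y\<in>Y. \<Sum>x\<in>X. \<Sum>z\<in>Z. p1 x * (p2 z * (V x z y * of_bool (\<not> good a b c x z y))))) + 3 / t"
proof -
  define M1 where "M1 b c = (\<Sum>a\<in>A. PS a b c)" for b c
  define M2 where "M2 a c = (\<Sum>b\<in>B. PS a b c)" for a c
  define M3 where "M3 c = (\<Sum>a\<in>A. \<Sum>b\<in>B. PS a b c)" for c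
  define D1 where "D1 z y = (\<Sum>x\<in>X. p1 x * V x z y)" for z y
  define D2 where "D2 x y = (\<Sum>z\<in>Z. p2 z * V x z y)" for x y
  define D3 where "D3 y = (\<Sum>x\<in>X. \<Sum>z\<in>Z. p1 x * (p2 z * V x z y))" for y
  have D0: "0 \<le> D1 z y" "0 \<le> D2 x y" "0 \<le> D3 y" for x y z
    by (auto simp: D1_def D2_def D3_def intro!: sum_nonneg mult_nonneg_nonneg V0 p10 p20)
  \<comment> \<open>The change of measure: where the test succeeds it reads t * M1 * D1 < PS * V,
    and elsewhere the left side is 0.\<close>
  have good1: "M1 b c * D1 z y * of_bool (good a b c x z y) \<le> PS a b c / t * V x z y" for a b c x z y
    using t PS0 V0 by (auto simp: good_def M1_def D1_def field_simps)
  have good2: "M2 a c * D2 x y * of_bool (good a b c x z y) \<le> PS a b c / t * V x z y" for a b c x z y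
    using t PS0 V0 by (auto simp: good_def M2_def D2_def field_simps)
  have good3: "M3 c * D3 y * of_bool (good a b c x z y) \<le> PS a b c / t * V x z y" for a b c x z y
    using t PS0 V0 by (auto simp: good_def M3_def D3_def field_simps)

  define C1 where "C1 = PiE A (\<lambda>_. X)"
  define C2 where "C2 = PiE B (\<lambda>_. Z)"
  define w1 where "w1 c1 = (\<Prod>a\<in>A. p1 (c1 a))" for c1 :: "'a \<Rightarrow> 'x"
  define w2 where "w2 c2 = (\<Prod>b\<in>B. p2 (c2 b))" for c2 :: "'b \<Rightarrow> 'z"
  define E where "E F = (\<Sum>c1\<in>C1. w1 c1 * (\<Sum>c2\<in>C2. w2 c2 * F c1 c2))" for F
  have w0: "0 \<le> w1 c1" "0 \<le> w2 c2" for c1 c2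
    by (auto simp: w1_def w2_def intro!: prod_nonneg p10 p20)
  have finC: "finite C1" "finite C2" using fin by (auto simp: C1_def C2_def intro!: finite_PiE)
  have w11: "(\<Sum>c1\<in>C1. w1 c1) = 1"
    using prod_sum_PiE[of A "\<lambda>_. X" "\<lambda>_. p1"] fin p11 by (simp add: C1_def w1_def)
  have w21: "(\<Sum>c2\<in>C2. w2 c2) = 1"
    using prod_sum_PiE[of B "\<lambda>_. Z" "\<lambda>_. p2"] fin p21 by (simp add: C2_def w2_def)
  have E_mono: "E F \<le> E G" if "\<And>c1 c2. c1 \<in> C1 \<Longrightarrow> c2 \<in> C2 \<Longrightarrow> F c1 c2 \<le> G c1 c2" for F G
    unfolding E_def by (intro sum_mono mult_left_mono w0 that)
  have E_add: "E (\<lambda>c1 c2. F c1 c2 + G c1 c2) = E F + E G" for F G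
    unfolding E_def by (simp add: algebra_simps sum.distrib)
  have E_cmul: "E (\<lambda>c1 c2. r * F c1 c2) = r * E F" for F r
    unfolding E_def by (simp add: sum_distrib_left mult_ac)
  have E_sum: "E (\<lambda>c1 c2. \<Sum>i\<in>I. F i c1 c2) = (\<Sum>i\<in>I. E (F i))" for F and I :: "'k set"
  proof -
    have "E (\<lambda>c1 c2. \<Sum>i\<in>I. F i c1 c2) = (\<Sum>c1\<in>C1. \<Sum>c2\<in>C2. \<Sum>i\<in>I. w1 c1 * (w2 c2 * F i c1 c2))"
      unfolding E_def by (simp add: sum_distrib_left)
    also have "\<dots> = (\<Sum>c1\<in>C1. \<Sum>i\<in>I. \<Sum>c2\<in>C2. w1 c1 * (w2 c2 * F i c1 c2))"
      by (intro sum.cong refl sum.swap)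
    also have "\<dots> = (\<Sum>i\<in>I. \<Sum>c1\<in>C1. \<Sum>c2\<in>C2. w1 c1 * (w2 c2 * F i c1 c2))"
      by (rule sum.swap)
    finally show ?thesis unfolding E_def by (simp add: sum_distrib_left)
  qed
  note cb = codebook_expect[OF fin(1) fin(4) p11, folded C1_def w1_def]
    codebook_expect_pair[OF fin(1) fin(4) p11, folded C1_def w1_def]
    codebook_expect[OF fin(2) fin(5) p21, folded C2_def w2_def]
    codebook_expect_pair[OF fin(2) fin(5) p21, folded C2_def w2_def]
  \<comment> \<open>The digits in \<open>E00\<close>, \<open>E10\<close>, \<open>E01\<close>,
    \<open>E11\<close> tell for which user a second, wrong codeword occurs. The transmitted codeword
    of such a user is summed innermost, where it will form \<open>D1\<close>, \<open>D2\<close> or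
    \<open>D3\<close>.\<close>
  have E00: "E (\<lambda>c1 c2. F (c1 a) (c2 b)) = (\<Sum>x\<in>X. \<Sum>z\<in>Z. p1 x * (p2 z * F x z))"
    if "a \<in> A" "b \<in> B" for a b F
    unfolding E_def cb(3)[OF that(2)] cb(1)[OF that(1), of "\<lambda>x. \<Sum>z\<in>Z. p2 z * F x z"]
    by (simp add: sum_distrib_left)
  have E10: "E (\<lambda>c1 c2. F (c1 a) (c1 a') (c2 b))
      = (\<Sum>x'\<in>X. \<Sum>z\<in>Z. p1 x' * (p2 z * (\<Sum>x\<in>X. p1 x * F x x' z)))"
    if "a \<in> A" "a' \<in> A" "a \<noteq> a'" "b \<in> B" for a a' b F
  proof -
    have "E (\<lambda>c1 c2. F (c1 a) (c1 a') (c2 b))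
        = (\<Sum>x\<in>X. \<Sum>x'\<in>X. p1 x * p1 x' * (\<Sum>z\<in>Z. p2 z * F x x' z))"
      unfolding E_def cb(3)[OF that(4)]
      by (rule cb(2)[OF that(1-3), of "\<lambda>x x'. \<Sum>z\<in>Z. p2 z * F x x' z"])
    also have "\<dots> = (\<Sum>x'\<in>X. \<Sum>x\<in>X. \<Sum>z\<in>Z. p1 x' * (p2 z * (p1 x * F x x' z)))"
      by (subst sum.swap) (simp add: sum_distrib_left mult_ac)
    also have "\<dots> = (\<Sum>x'\<in>X. \<Sum>z\<in>Z. \<Sum>x\<in>X. p1 x' * (p2 z * (p1 x * F x x' z)))"
      by (intro sum.cong refl sum.swap)
    finally show ?thesis by (simp add: sum_distrib_left)
  qed
  have E01: "E (\<lambda>c1 c2. F (c1 a) (c2 b) (c2 b'))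
      = (\<Sum>x\<in>X. \<Sum>z'\<in>Z. p1 x * (p2 z' * (\<Sum>z\<in>Z. p2 z * F x z z')))"
    if "a \<in> A" "b \<in> B" "b' \<in> B" "b \<noteq> b'" for a b b' F
  proof -
    have "E (\<lambda>c1 c2. F (c1 a) (c2 b) (c2 b'))
        = (\<Sum>x\<in>X. p1 x * (\<Sum>z\<in>Z. \<Sum>z'\<in>Z. p2 z * p2 z' * F x z z'))"
      unfolding E_def cb(4)[OF that(2-4)]
      by (rule cb(1)[OF that(1), of "\<lambda>x. \<Sum>z\<in>Z. \<Sum>z'\<in>Z. p2 z * p2 z' * F x z z'"])
    also have "\<dots> = (\<Sum>x\<in>X. p1 x * (\<Sum>z'\<in>Z. \<Sum>z\<in>Z. p2 z * p2 z' * F x z z'))"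
      by (intro sum.cong refl arg_cong2[of _ _ _ _ "(*)"] sum.swap)
    finally show ?thesis by (simp add: sum_distrib_left mult_ac)
  qed
  have E11: "E (\<lambda>c1 c2. F (c1 a) (c2 b) * G (c1 a') (c2 b'))
      = (\<Sum>x'\<in>X. \<Sum>z'\<in>Z. p1 x' * (p2 z' * ((\<Sum>x\<in>X. \<Sum>z\<in>Z. p1 x * (p2 z * F x z)) * G x' z')))"
    if "a \<in> A" "a' \<in> A" "a \<noteq> a'" "b \<in> B" "b' \<in> B" "b \<noteq> b'" for a a' b b' F G
  proof -
    have "E (\<lambda>c1 c2. F (c1 a) (c2 b) * G (c1 a') (c2 b'))
        = (\<Sum>x\<in>X. \<Sum>x'\<in>X. p1 x * p1 x' * (\<Sum>z\<in>Z. \<Sum>z'\<in>Z. p2 z * p2 z' * (F x z * G x' z')))"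
      unfolding E_def cb(4)[OF that(4-6), of "\<lambda>z z'. F (_ a) z * G (_ a') z'"]
      by (rule cb(2)[OF that(1-3), of "\<lambda>x x'. \<Sum>z\<in>Z. \<Sum>z'\<in>Z. p2 z * p2 z' * (F x z * G x' z')"])
    also have "\<dots> = (\<Sum>x'\<in>X. \<Sum>x\<in>X. p1 x * p1 x' * (\<Sum>z'\<in>Z. \<Sum>z\<in>Z. p2 z * p2 z' * (F x z * G x' z')))"
      by (subst sum.swap) (intro sum.cong refl arg_cong2[of _ _ _ _ "(*)"] sum.swap)
    also have "\<dots> = (\<Sum>x'\<in>X. \<Sum>x\<in>X. \<Sum>z'\<in>Z. p1 x' * (p2 z' * (p1 x * (\<Sum>z\<in>Z. p2 z * F x z) * G x' z')))"
      by (simp add: sum_distrib_left sum_distrib_right mult_ac)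
    also have "\<dots> = (\<Sum>x'\<in>X. \<Sum>z'\<in>Z. \<Sum>x\<in>X. p1 x' * (p2 z' * (p1 x * (\<Sum>z\<in>Z. p2 z * F x z) * G x' z')))"
      by (intro sum.cong refl sum.swap)
    also have "\<dots> = (\<Sum>x'\<in>X. \<Sum>z'\<in>Z. p1 x' * (p2 z' * ((\<Sum>x\<in>X. p1 x * (\<Sum>z\<in>Z. p2 z * F x z)) * G x' z')))"
      by (simp add: sum_distrib_left[symmetric] sum_distrib_right[symmetric])
    finally show ?thesis by (simp add: sum_distrib_left)
  qed

  define ok where "ok c1 c2 y c = (\<lambda>ab. fst ab \<in> A \<and> snd ab \<in> B
      \<and> good (fst ab) (snd ab) c (c1 (fst ab)) (c2 (snd ab)) y)" for c1 c2 y c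
  \<comment> \<open>The choice is arbitrary if no pair or several pairs are accepted; these cases count as errors.\<close>
  define dec where "dec c1 c2 y c = (SOME ab. ok c1 c2 y c ab)" for c1 c2 y c
  \<comment> \<open>A union bound by contraposition: if the right side is below 1, the right pair is
    accepted and no other pair is, so the choice made by \<open>dec\<close> must hit it.\<close>
  have err: "of_bool (dec c1 c2 y c \<noteq> (a, b)) \<le> (of_bool (\<not> good a b c (c1 a) (c2 b) y) :: real)
      + (\<Sum>a'\<in>A - {a}. of_bool (good a' b c (c1 a') (c2 b) y))
      + (\<Sum>b'\<in>B - {b}. of_bool (good a b' c (c1 a) (c2 b') y))
      + (\<Sum>a'\<in>A - {a}. \<Sum>b'\<in>B - {b}. of_bool (good a' b' c (c1 a') (c2 b') y))"
    (is "_ \<le> ?T0 + ?T1 + ?T2 + ?T3")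
    if ab: "a \<in> A" "b \<in> B" for a b c y c1 c2
  proof -
    have nn: "0 \<le> ?T0" "0 \<le> ?T1" "0 \<le> ?T2" "0 \<le> ?T3"
      by (auto intro!: sum_nonneg)
    have ge1: "1 \<le> sum f I" if "finite I" "i \<in> I" "f i = 1" "\<And>i. i \<in> I \<Longrightarrow> 0 \<le> f i"
      for f :: "'k \<Rightarrow> real" and I i
      using member_le_sum[of i I f] that by auto
    have dec: "dec c1 c2 y c = (a, b)" if lt: "?T0 + ?T1 + ?T2 + ?T3 < 1"
    proof -
      have g: "good a b c (c1 a) (c2 b) y" using lt nn by (auto simp: of_bool_def split: if_splits)
      then have ex: "ok c1 c2 y c (a, b)" using ab by (simp add: ok_def)
      have uniq: "v = (a, b)" if v: "ok c1 c2 y c v" for v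
      proof (rule ccontr)
        assume ne: "v \<noteq> (a, b)"
        obtain a' b' where v': "v = (a', b')" by fastforce
        have ok: "a' \<in> A" "b' \<in> B" "good a' b' c (c1 a') (c2 b') y"
          using v by (auto simp: ok_def v')
        consider "a' \<noteq> a" "b' = b" | "a' = a" "b' \<noteq> b" | "a' \<noteq> a" "b' \<noteq> b"
          using ne v' by auto
        then have "1 \<le> ?T1 \<or> 1 \<le> ?T2 \<or> 1 \<le> ?T3"
        proof cases
          case 1
          then have "1 \<le> ?T1" using ok fin by (intro ge1[of _ a']) auto
          then show ?thesis by simp
        next
          case 2
          then have "1 \<le> ?T2" using ok fin by (intro ge1[of _ b']) auto
          then show ?thesis by simp
        next
          case 3
          have "1 \<le> (\<Sum>b'\<in>B - {b}. of_bool (good a' b' c (c1 a') (c2 b') y) :: real)"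
            using ok fin 3 by (intro ge1[of _ b']) auto
          also have "\<dots> \<le> ?T3"
            using ok fin 3 by (intro member_le_sum) (auto intro!: sum_nonneg)
          finally show ?thesis by simp
        qed
        then show False using lt nn by auto
      qed
      show ?thesis unfolding dec_def by (rule some_equality[of "ok c1 c2 y c"]) (fact ex, erule uniq)
    qed
    show ?thesis
    proof (cases "dec c1 c2 y c = (a, b)")
      case True
      then have "of_bool (dec c1 c2 y c \<noteq> (a, b)) = (0::real)" by simp
      with nn show ?thesis by linarith
    next
      case False
      then have "1 \<le> ?T0 + ?T1 + ?T2 + ?T3" using dec by fastforce
      moreover have "of_bool (dec c1 c2 y c \<noteq> (a, b)) = (1::real)" using False by simp
      ultimately show ?thesis by linarith
    qed
  qed

  define G0 where "G0 a b c y = (\<Sum>x\<in>X. \<Sum>z\<in>Z. p1 x * (p2 z * (V x z y * of_bool (\<not> good a b c x z y))))" for a b c y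
  \<comment> \<open>Ki is the expected weight of accepting a wrong pair; the transmitted codeword of the wrong user has been averaged into Di.\<close>
  define K1 where "K1 a b c y = (\<Sum>x\<in>X. \<Sum>z\<in>Z. p1 x * (p2 z * (D1 z y * of_bool (good a b c x z y))))" for a b c y
  define K2 where "K2 a b c y = (\<Sum>x\<in>X. \<Sum>z\<in>Z. p1 x * (p2 z * (D2 x y * of_bool (good a b c x z y))))" for a b c y
  define K3 where "K3 a b c y = (\<Sum>x\<in>X. \<Sum>z\<in>Z. p1 x * (p2 z * (D3 y * of_bool (good a b c x z y))))" for a b c y
  have K0: "0 \<le> K1 a b c y" "0 \<le> K2 a b c y" "0 \<le> K3 a b c y" for a b c y
    by (auto simp: K1_def K2_def K3_def intro!: sum_nonneg mult_nonneg_nonneg p10 p20 D0)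
  have Ebound: "E (\<lambda>c1 c2. V (c1 a) (c2 b) y * of_bool (dec c1 c2 y c \<noteq> (a, b)))
      \<le> G0 a b c y + (\<Sum>a'\<in>A. K1 a' b c y) + (\<Sum>b'\<in>B. K2 a b' c y) + (\<Sum>a'\<in>A. \<Sum>b'\<in>B. K3 a' b' c y)"
    if ab: "a \<in> A" "b \<in> B" for a b c y
  proof -
    have "E (\<lambda>c1 c2. V (c1 a) (c2 b) y * of_bool (dec c1 c2 y c \<noteq> (a, b)))
      \<le> E (\<lambda>c1 c2. V (c1 a) (c2 b) y * of_bool (\<not> good a b c (c1 a) (c2 b) y)
        + (\<Sum>a'\<in>A - {a}. V (c1 a) (c2 b) y * of_bool (good a' b c (c1 a') (c2 b) y))
        + (\<Sum>b'\<in>B - {b}. V (c1 a) (c2 b) y * of_bool (good a b' c (c1 a) (c2 b') y))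
        + (\<Sum>a'\<in>A - {a}. \<Sum>b'\<in>B - {b}. V (c1 a) (c2 b) y * of_bool (good a' b' c (c1 a') (c2 b') y)))"
    proof (rule E_mono)
      fix c1 c2
      show "V (c1 a) (c2 b) y * of_bool (dec c1 c2 y c \<noteq> (a, b))
        \<le> V (c1 a) (c2 b) y * of_bool (\<not> good a b c (c1 a) (c2 b) y)
        + (\<Sum>a'\<in>A - {a}. V (c1 a) (c2 b) y * of_bool (good a' b c (c1 a') (c2 b) y))
        + (\<Sum>b'\<in>B - {b}. V (c1 a) (c2 b) y * of_bool (good a b' c (c1 a) (c2 b') y))
        + (\<Sum>a'\<in>A - {a}. \<Sum>b'\<in>B - {b}. V (c1 a) (c2 b) y * of_bool (good a' b' c (c1 a') (c2 b') y))"
        unfolding sum_distrib_left[symmetric] distrib_left[symmetric]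
        by (rule mult_left_mono[OF err[OF ab] V0])
    qed
    also have "\<dots> = E (\<lambda>c1 c2. V (c1 a) (c2 b) y * of_bool (\<not> good a b c (c1 a) (c2 b) y))
        + (\<Sum>a'\<in>A - {a}. E (\<lambda>c1 c2. V (c1 a) (c2 b) y * of_bool (good a' b c (c1 a') (c2 b) y)))
        + (\<Sum>b'\<in>B - {b}. E (\<lambda>c1 c2. V (c1 a) (c2 b) y * of_bool (good a b' c (c1 a) (c2 b') y)))
        + (\<Sum>a'\<in>A - {a}. \<Sum>b'\<in>B - {b}. E (\<lambda>c1 c2. V (c1 a) (c2 b) y * of_bool (good a' b' c (c1 a') (c2 b') y)))"
      by (simp only: E_add E_sum)
    also have "E (\<lambda>c1 c2. V (c1 a) (c2 b) y * of_bool (\<not> good a b c (c1 a) (c2 b) y)) = G0 a b c y"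
      unfolding G0_def by (rule E00[OF ab])
    also have "(\<Sum>a'\<in>A - {a}. E (\<lambda>c1 c2. V (c1 a) (c2 b) y * of_bool (good a' b c (c1 a') (c2 b) y)))
        = (\<Sum>a'\<in>A - {a}. K1 a' b c y)"
    proof (rule sum.cong)
      fix a' assume "a' \<in> A - {a}"
      then show "E (\<lambda>c1 c2. V (c1 a) (c2 b) y * of_bool (good a' b c (c1 a') (c2 b) y)) = K1 a' b c y"
        using E10[of a a' b "\<lambda>x x' z. V x z y * of_bool (good a' b c x' z y)"] ab
        by (auto simp: K1_def D1_def sum_distrib_right mult.assoc)
    qed simp
    also have "(\<Sum>b'\<in>B - {b}. E (\<lambda>c1 c2. V (c1 a) (c2 b) y * of_bool (good a b' c (c1 a) (c2 b') y)))
        = (\<Sum>b'\<in>B - {b}. K2 a b' c y)"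
    proof (rule sum.cong)
      fix b' assume "b' \<in> B - {b}"
      then show "E (\<lambda>c1 c2. V (c1 a) (c2 b) y * of_bool (good a b' c (c1 a) (c2 b') y)) = K2 a b' c y"
        using E01[of a b b' "\<lambda>x z z'. V x z y * of_bool (good a b' c x z' y)"] ab
        by (auto simp: K2_def D2_def sum_distrib_right mult.assoc)
    qed simp
    also have "(\<Sum>a'\<in>A - {a}. \<Sum>b'\<in>B - {b}. E (\<lambda>c1 c2. V (c1 a) (c2 b) y * of_bool (good a' b' c (c1 a') (c2 b') y)))
        = (\<Sum>a'\<in>A - {a}. \<Sum>b'\<in>B - {b}. K3 a' b' c y)"
    proof (intro sum.cong refl)
      fix a' b' assume "a' \<in> A - {a}" "b' \<in> B - {b}"
      then show "E (\<lambda>c1 c2. V (c1 a) (c2 b) y * of_bool (good a' b' c (c1 a') (c2 b') y)) = K3 a' b' c y"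
        using E11[of a a' b b' "\<lambda>x z. V x z y" "\<lambda>x' z'. of_bool (good a' b' c x' z' y)"] ab
        by (auto simp: K3_def D3_def)
    qed
    \<comment> \<open>Admitting the right message among the competitors only adds nonnegative terms,
      and it makes the bound on the false acceptances independent of the message that was replaced.
      The source law can then be summed over that message.\<close>
    also have "G0 a b c y + (\<Sum>a'\<in>A - {a}. K1 a' b c y) + (\<Sum>b'\<in>B - {b}. K2 a b' c y)
          + (\<Sum>a'\<in>A - {a}. \<Sum>b'\<in>B - {b}. K3 a' b' c y)
        \<le> G0 a b c y + (\<Sum>a'\<in>A. K1 a' b c y) + (\<Sum>b'\<in>B. K2 a b' c y) + (\<Sum>a'\<in>A. \<Sum>b'\<in>B. K3 a' b' c y)"
    proof (intro add_mono order_refl)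
      show "(\<Sum>a'\<in>A - {a}. K1 a' b c y) \<le> (\<Sum>a'\<in>A. K1 a' b c y)"
        using fin K0 by (intro sum_mono2) auto
      show "(\<Sum>b'\<in>B - {b}. K2 a b' c y) \<le> (\<Sum>b'\<in>B. K2 a b' c y)"
        using fin K0 by (intro sum_mono2) auto
      have "(\<Sum>a'\<in>A - {a}. \<Sum>b'\<in>B - {b}. K3 a' b' c y) \<le> (\<Sum>a'\<in>A - {a}. \<Sum>b'\<in>B. K3 a' b' c y)"
        using fin K0 by (intro sum_mono sum_mono2) auto
      also have "\<dots> \<le> (\<Sum>a'\<in>A. \<Sum>b'\<in>B. K3 a' b' c y)"
        using fin K0 by (intro sum_mono2) (auto intro!: sum_nonneg)
      finally show "(\<Sum>a'\<in>A - {a}. \<Sum>b'\<in>B - {b}. K3 a' b' c y) \<le> (\<Sum>a'\<in>A. \<Sum>b'\<in>B. K3 a' b' c y)" .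
    qed
    finally show ?thesis .
  qed

  have mass: "(\<Sum>y\<in>Y. \<Sum>x\<in>X. \<Sum>z\<in>Z. p1 x * (p2 z * V x z y)) = 1"
  proof -
    have "(\<Sum>y\<in>Y. \<Sum>x\<in>X. \<Sum>z\<in>Z. p1 x * (p2 z * V x z y))
        = (\<Sum>x\<in>X. \<Sum>z\<in>Z. \<Sum>y\<in>Y. p1 x * (p2 z * V x z y))"
      by (subst sum.swap) (intro sum.cong refl sum.swap)
    also have "\<dots> = (\<Sum>x\<in>X. \<Sum>z\<in>Z. p1 x * p2 z)"
      by (simp add: sum_distrib_left[symmetric] V1)
    finally show ?thesis by (simp add: sum_distrib_left[symmetric] p11 p21)
  qed
  \<comment> \<open>A pointwise comparison with \<open>r * V\<close> integrates to \<open>r\<close>,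
    because codewords and output together have total mass 1.\<close>
  have Kbound: "M * (\<Sum>y\<in>Y. \<Sum>x\<in>X. \<Sum>z\<in>Z. p1 x * (p2 z * \<kappa> x z y)) \<le> r"
    if "\<And>x z y. M * \<kappa> x z y \<le> r * V x z y" for M r \<kappa>
  proof -
    have "M * (\<Sum>y\<in>Y. \<Sum>x\<in>X. \<Sum>z\<in>Z. p1 x * (p2 z * \<kappa> x z y))
        = (\<Sum>y\<in>Y. \<Sum>x\<in>X. \<Sum>z\<in>Z. p1 x * (p2 z * (M * \<kappa> x z y)))"
      by (simp add: sum_distrib_left mult_ac)
    also have "\<dots> \<le> (\<Sum>y\<in>Y. \<Sum>x\<in>X. \<Sum>z\<in>Z. p1 x * (p2 z * (r * V x z y)))"
      by (intro sum_mono mult_left_mono that p10 p20)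
    also have "\<dots> = r * (\<Sum>y\<in>Y. \<Sum>x\<in>X. \<Sum>z\<in>Z. p1 x * (p2 z * V x z y))"
      by (simp add: sum_distrib_left mult_ac)
    finally show ?thesis by (simp add: mass)
  qed
  have k1: "M1 b c * (\<Sum>y\<in>Y. K1 a b c y) \<le> PS a b c / t" for a b c
    unfolding K1_def using good1 by (intro Kbound) (simp add: mult.assoc)
  have k2: "M2 a c * (\<Sum>y\<in>Y. K2 a b c y) \<le> PS a b c / t" for a b c
    unfolding K2_def using good2 by (intro Kbound) (simp add: mult.assoc)
  have k3: "M3 c * (\<Sum>y\<in>Y. K3 a b c y) \<le> PS a b c / t" for a b c
    unfolding K3_def using good3 by (intro Kbound) (simp add: mult.assoc)

  \<comment> \<open>Summing out the true first message turns its weight into \<open>M1\<close>;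
    \<open>k1\<close> then trades \<open>M1\<close> for the probability of the wrong message divided
    by t, and these probabilities add up to 1.\<close>
  have s1: "(\<Sum>a\<in>A. \<Sum>b\<in>B. \<Sum>c\<in>C. PS a b c * (\<Sum>y\<in>Y. \<Sum>a'\<in>A. K1 a' b c y)) \<le> 1 / t"
  proof -
    have K: "(\<Sum>y\<in>Y. \<Sum>a'\<in>A. K1 a' b c y) = (\<Sum>a'\<in>A. \<Sum>y\<in>Y. K1 a' b c y)" for b c
      by (rule sum.swap)
    have "(\<Sum>a\<in>A. \<Sum>b\<in>B. \<Sum>c\<in>C. PS a b c * (\<Sum>y\<in>Y. \<Sum>a'\<in>A. K1 a' b c y))
        = (\<Sum>b\<in>B. \<Sum>c\<in>C. \<Sum>a\<in>A. PS a b c * (\<Sum>a'\<in>A. \<Sum>y\<in>Y. K1 a' b c y))"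
      unfolding K by (rule trans[OF sum.swap]) (intro sum.cong refl sum.swap)
    also have "\<dots> = (\<Sum>b\<in>B. \<Sum>c\<in>C. \<Sum>a'\<in>A. M1 b c * (\<Sum>y\<in>Y. K1 a' b c y))"
      by (simp add: M1_def sum_distrib_left[symmetric] sum_distrib_right[symmetric])
    also have "\<dots> \<le> (\<Sum>b\<in>B. \<Sum>c\<in>C. \<Sum>a'\<in>A. PS a' b c / t)"
      by (intro sum_mono k1)
    also have "\<dots> = (\<Sum>a'\<in>A. \<Sum>b\<in>B. \<Sum>c\<in>C. PS a' b c / t)"
      by (rule sym, rule trans[OF sum.swap]) (intro sum.cong refl sum.swap)
    also have "\<dots> = 1 / t"
      by (simp add: sum_divide_distrib[symmetric] PS1)
    finally show ?thesis .
  qed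
  have s2: "(\<Sum>a\<in>A. \<Sum>b\<in>B. \<Sum>c\<in>C. PS a b c * (\<Sum>y\<in>Y. \<Sum>b'\<in>B. K2 a b' c y)) \<le> 1 / t"
  proof -
    have K: "(\<Sum>y\<in>Y. \<Sum>b'\<in>B. K2 a b' c y) = (\<Sum>b'\<in>B. \<Sum>y\<in>Y. K2 a b' c y)" for a c
      by (rule sum.swap)
    have "(\<Sum>a\<in>A. \<Sum>b\<in>B. \<Sum>c\<in>C. PS a b c * (\<Sum>y\<in>Y. \<Sum>b'\<in>B. K2 a b' c y))
        = (\<Sum>a\<in>A. \<Sum>c\<in>C. \<Sum>b\<in>B. PS a b c * (\<Sum>b'\<in>B. \<Sum>y\<in>Y. K2 a b' c y))"
      unfolding K by (intro sum.cong refl sum.swap)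
    also have "\<dots> = (\<Sum>a\<in>A. \<Sum>c\<in>C. \<Sum>b'\<in>B. M2 a c * (\<Sum>y\<in>Y. K2 a b' c y))"
      by (simp add: M2_def sum_distrib_left[symmetric] sum_distrib_right[symmetric])
    also have "\<dots> \<le> (\<Sum>a\<in>A. \<Sum>c\<in>C. \<Sum>b'\<in>B. PS a b' c / t)"
      by (intro sum_mono k2)
    also have "\<dots> = (\<Sum>a\<in>A. \<Sum>b\<in>B. \<Sum>c\<in>C. PS a b c / t)"
      by (intro sum.cong refl sum.swap)
    also have "\<dots> = 1 / t"
      by (simp add: sum_divide_distrib[symmetric] PS1)
    finally show ?thesis .
  qed
  have s3: "(\<Sum>a\<in>A. \<Sum>b\<in>B. \<Sum>c\<in>C. PS a b c * (\<Sum>y\<in>Y. \<Sum>a'\<in>A. \<Sum>b'\<in>B. K3 a' b' c y)) \<le> 1 / t"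
  proof -
    have K: "(\<Sum>y\<in>Y. \<Sum>a'\<in>A. \<Sum>b'\<in>B. K3 a' b' c y) = (\<Sum>a'\<in>A. \<Sum>b'\<in>B. \<Sum>y\<in>Y. K3 a' b' c y)" for c
      by (subst sum.swap) (intro sum.cong refl sum.swap)
    have "(\<Sum>a\<in>A. \<Sum>b\<in>B. \<Sum>c\<in>C. PS a b c * (\<Sum>y\<in>Y. \<Sum>a'\<in>A. \<Sum>b'\<in>B. K3 a' b' c y))
        = (\<Sum>a\<in>A. \<Sum>c\<in>C. \<Sum>b\<in>B. PS a b c * (\<Sum>a'\<in>A. \<Sum>b'\<in>B. \<Sum>y\<in>Y. K3 a' b' c y))"
      unfolding K by (intro sum.cong refl sum.swap)
    also have "\<dots> = (\<Sum>c\<in>C. \<Sum>a\<in>A. \<Sum>b\<in>B. PS a b c * (\<Sum>a'\<in>A. \<Sum>b'\<in>B. \<Sum>y\<in>Y. K3 a' b' c y))"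
      by (rule sum.swap)
    also have "\<dots> = (\<Sum>c\<in>C. \<Sum>a'\<in>A. \<Sum>b'\<in>B. M3 c * (\<Sum>y\<in>Y. K3 a' b' c y))"
      by (simp add: M3_def sum_distrib_left[symmetric] sum_distrib_right[symmetric])
    also have "\<dots> \<le> (\<Sum>c\<in>C. \<Sum>a'\<in>A. \<Sum>b'\<in>B. PS a' b' c / t)"
      by (intro sum_mono k3)
    also have "\<dots> = (\<Sum>a\<in>A. \<Sum>c\<in>C. \<Sum>b\<in>B. PS a b c / t)"
      by (rule sum.swap)
    also have "\<dots> = (\<Sum>a\<in>A. \<Sum>b\<in>B. \<Sum>c\<in>C. PS a b c / t)"
      by (intro sum.cong refl sum.swap)
    also have "\<dots> = 1 / t"
      by (simp add: sum_divide_distrib[symmetric] PS1)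
    finally show ?thesis .
  qed

  define Err where "Err c1 c2 = (\<Sum>a\<in>A. \<Sum>b\<in>B. \<Sum>c\<in>C. \<Sum>y\<in>Y.
      PS a b c * (V (c1 a) (c2 b) y * of_bool (dec c1 c2 y c \<noteq> (a, b))))" for c1 c2
  define R where "R = (\<Sum>a\<in>A. \<Sum>b\<in>B. \<Sum>c\<in>C. PS a b c * (\<Sum>y\<in>Y. G0 a b c y)) + 3 / t"
  have "E Err = (\<Sum>a\<in>A. \<Sum>b\<in>B. \<Sum>c\<in>C. \<Sum>y\<in>Y.
      PS a b c * E (\<lambda>c1 c2. V (c1 a) (c2 b) y * of_bool (dec c1 c2 y c \<noteq> (a, b))))"
    unfolding Err_def by (simp only: E_sum E_cmul)
  also have "\<dots> \<le> (\<Sum>a\<in>A. \<Sum>b\<in>B. \<Sum>c\<in>C. \<Sum>y\<in>Y. PS a b c * (G0 a b c y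
      + (\<Sum>a'\<in>A. K1 a' b c y) + (\<Sum>b'\<in>B. K2 a b' c y) + (\<Sum>a'\<in>A. \<Sum>b'\<in>B. K3 a' b' c y)))"
    by (intro sum_mono mult_left_mono Ebound PS0)
  also have "\<dots> = (\<Sum>a\<in>A. \<Sum>b\<in>B. \<Sum>c\<in>C. PS a b c * (\<Sum>y\<in>Y. G0 a b c y))
      + (\<Sum>a\<in>A. \<Sum>b\<in>B. \<Sum>c\<in>C. PS a b c * (\<Sum>y\<in>Y. \<Sum>a'\<in>A. K1 a' b c y))
      + (\<Sum>a\<in>A. \<Sum>b\<in>B. \<Sum>c\<in>C. PS a b c * (\<Sum>y\<in>Y. \<Sum>b'\<in>B. K2 a b' c y))
      + (\<Sum>a\<in>A. \<Sum>b\<in>B. \<Sum>c\<in>C. PS a b c * (\<Sum>y\<in>Y. \<Sum>a'\<in>A. \<Sum>b'\<in>B. K3 a' b' c y))"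
    by (simp only: sum_distrib_left[symmetric] sum.distrib distrib_left)
  also have "\<dots> \<le> R"
    using s1 s2 s3 by (simp add: R_def)
  finally have E_le: "E Err \<le> R" .
  \<comment> \<open>The codebooks are fixed one after the other, the first one against the average
    over the second.\<close>
  have "\<exists>c1\<in>C1. (\<Sum>c2\<in>C2. w2 c2 * Err c1 c2) \<le> R"
    using exists_le_average[OF finC(1) _ w11, of "\<lambda>c1. \<Sum>c2\<in>C2. w2 c2 * Err c1 c2" R] w0 E_le
    by (simp add: E_def)
  then obtain c1 where c1: "c1 \<in> C1" "(\<Sum>c2\<in>C2. w2 c2 * Err c1 c2) \<le> R" by blast
  have "\<exists>c2\<in>C2. Err c1 c2 \<le> R"
    using exists_le_average[OF finC(2) _ w21 c1(2)] w0 by simp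
  then obtain c2 where c2: "c2 \<in> C2" "Err c1 c2 \<le> R" by blast
  show ?thesis
    using c1(1) c2 unfolding C1_def C2_def Err_def R_def G0_def by blast
qed

subsection \<open>Single-letter quantities\<close>

text \<open>
  H1, H2 and H3 are H(S1|S2,W1), H(S2|S1,W1) and H(S1,S2|W1); I1, I2 and I3 are I(X1;Y1|X2),
  I(X2;Y1|X1) and I(X1,X2;Y1) for independent inputs. Terms with a vanishing denominator
  carry the weight 0.
\<close>

definition H1 :: "('s1::finite \<Rightarrow> 's2::finite \<Rightarrow> 'w::finite \<Rightarrow> real) \<Rightarrow> real" where
  "H1 P = (\<Sum>a\<in>UNIV. \<Sum>b\<in>UNIV. \<Sum>c\<in>UNIV. P a b c * log 2 ((\<Sum>a'\<in>UNIV. P a' b c) / P a b c))"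

definition H2 :: "('s1::finite \<Rightarrow> 's2::finite \<Rightarrow> 'w::finite \<Rightarrow> real) \<Rightarrow> real" where
  "H2 P = (\<Sum>a\<in>UNIV. \<Sum>b\<in>UNIV. \<Sum>c\<in>UNIV. P a b c * log 2 ((\<Sum>b'\<in>UNIV. P a b' c) / P a b c))"

definition H3 :: "('s1::finite \<Rightarrow> 's2::finite \<Rightarrow> 'w::finite \<Rightarrow> real) \<Rightarrow> real" where
  "H3 P = (\<Sum>a\<in>UNIV. \<Sum>b\<in>UNIV. \<Sum>c\<in>UNIV. P a b c * log 2 ((\<Sum>a'\<in>UNIV. \<Sum>b'\<in>UNIV. P a' b' c) / P a b c))"

definition out1 :: "('x1::finite \<Rightarrow> 'x2 \<Rightarrow> 'y \<Rightarrow> real) \<Rightarrow> ('x1 \<Rightarrow> real) \<Rightarrow> 'x2 \<Rightarrow> 'y \<Rightarrow> real" where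
  "out1 W p1 x2 y = (\<Sum>x1\<in>UNIV. p1 x1 * W x1 x2 y)"

definition out2 :: "('x1 \<Rightarrow> 'x2::finite \<Rightarrow> 'y \<Rightarrow> real) \<Rightarrow> ('x2 \<Rightarrow> real) \<Rightarrow> 'x1 \<Rightarrow> 'y \<Rightarrow> real" where
  "out2 W p2 x1 y = (\<Sum>x2\<in>UNIV. p2 x2 * W x1 x2 y)"

definition out3 :: "('x1::finite \<Rightarrow> 'x2::finite \<Rightarrow> 'y \<Rightarrow> real) \<Rightarrow> ('x1 \<Rightarrow> real) \<Rightarrow> ('x2 \<Rightarrow> real) \<Rightarrow> 'y \<Rightarrow> real" where
  "out3 W p1 p2 y = (\<Sum>x1\<in>UNIV. \<Sum>x2\<in>UNIV. p1 x1 * (p2 x2 * W x1 x2 y))"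

text \<open>The three informations differ only in the reference law \<open>D\<close>. Leaving it
  free lets the Chebyshev bound, nonnegativity and the converse be proved once for all
  three.\<close>

definition info_sum ::
  "('x1::finite \<Rightarrow> 'x2::finite \<Rightarrow> 'y::finite \<Rightarrow> real) \<Rightarrow> ('x1 \<Rightarrow> real) \<Rightarrow> ('x2 \<Rightarrow> real)
   \<Rightarrow> ('x1 \<Rightarrow> 'x2 \<Rightarrow> 'y \<Rightarrow> real) \<Rightarrow> real" where
  "info_sum W p1 p2 D = (\<Sum>x1\<in>UNIV. \<Sum>x2\<in>UNIV. \<Sum>y\<in>UNIV.
     p1 x1 * (p2 x2 * (W x1 x2 y * log 2 (W x1 x2 y / D x1 x2 y))))"

definition I1 :: "('x1::finite \<Rightarrow> 'x2::finite \<Rightarrow> 'y::finite \<Rightarrow> real) \<Rightarrow> ('x1 \<Rightarrow> real) \<Rightarrow> ('x2 \<Rightarrow> real) \<Rightarrow> real" where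
  "I1 W p1 p2 = info_sum W p1 p2 (\<lambda>x1 x2 y. out1 W p1 x2 y)"

definition I2 :: "('x1::finite \<Rightarrow> 'x2::finite \<Rightarrow> 'y::finite \<Rightarrow> real) \<Rightarrow> ('x1 \<Rightarrow> real) \<Rightarrow> ('x2 \<Rightarrow> real) \<Rightarrow> real" where
  "I2 W p1 p2 = info_sum W p1 p2 (\<lambda>x1 x2 y. out2 W p2 x1 y)"

definition I3 :: "('x1::finite \<Rightarrow> 'x2::finite \<Rightarrow> 'y::finite \<Rightarrow> real) \<Rightarrow> ('x1 \<Rightarrow> real) \<Rightarrow> ('x2 \<Rightarrow> real) \<Rightarrow> real" where
  "I3 W p1 p2 = info_sum W p1 p2 (\<lambda>x1 x2 y. out3 W p1 p2 y)"

section \<open>Conditional entropies and mutual informations as expected log ratios\<close>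

lemma marg_reindex:
  assumes "finite A" "inj_on e I" "{a \<in> A. g a = v} = e ` I"
  shows "marg A p g v = (\<Sum>i\<in>I. p (e i))"
proof -
  have "marg A p g v = (\<Sum>a\<in>{a \<in> A. g a = v}. p a)"
    unfolding marg_def using assms(1) by (simp add: sum.inter_filter)
  then show ?thesis using assms(2) by (simp add: assms(3) sum.reindex)
qed

lemma marg_pos:
  assumes "finite A" "\<And>a. a \<in> A \<Longrightarrow> 0 \<le> p a" "a \<in> A" "0 < p a"
  shows "0 < marg A p g (g a)"
proof -
  have "0 < (\<Sum>x\<in>{x \<in> A. g x = g a}. p x)"
    using assms by (intro sum_pos2[of _ a]) auto
  then show ?thesis unfolding marg_def using assms(1) by (simp add: sum.inter_filter)
qed

text \<open>For sources, the target and the conditioning variable together determine the outcome, so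
  the joint marginal is \<open>p\<close> itself. All requirements concern the support only, as
  outcomes of weight 0 drop out of both sums.\<close>

lemma cond_entropy_log_ratio:
  assumes "\<And>a. a \<in> A \<Longrightarrow> 0 \<le> p a"
    and "\<And>a. a \<in> A \<Longrightarrow> 0 < p a \<Longrightarrow> marg A p (\<lambda>x. (f x, g x)) (f a, g a) = p a"
    and "\<And>a. a \<in> A \<Longrightarrow> 0 < p a \<Longrightarrow> marg A p g (g a) = M a" "\<And>a. a \<in> A \<Longrightarrow> 0 < p a \<Longrightarrow> 0 < M a"
  shows "cond_entropy A p f g = (\<Sum>a\<in>A. p a * log 2 (M a / p a))"
  unfolding cond_entropy_def sum_negf[symmetric]
proof (rule sum.cong)
  fix a assume a: "a \<in> A"
  show "- (if p a = 0 then 0 else p a * log 2 (marg A p (\<lambda>x. (f x, g x)) (f a, g a) / marg A p g (g a)))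
      = p a * log 2 (M a / p a)"
  proof (cases "p a = 0")
    case False
    then have "0 < p a" using assms(1)[OF a] by simp
    then show ?thesis using assms(2-4)[OF a] by (simp add: log_divide algebra_simps)
  qed simp
qed simp

text \<open>\<open>r\<close> is the information density p(f,g,h) p(h) / (p(g,h) p(f,h)). It is
  prescribed by a cross-multiplied identity, so that a user of the lemma handles products of
  marginals and no quotients.\<close>

lemma cond_mutual_info_log_ratio:
  assumes "finite A" and p0: "\<And>a. a \<in> A \<Longrightarrow> 0 \<le> p a"
    and ratio: "\<And>a. a \<in> A \<Longrightarrow> 0 < p a \<Longrightarrow>
      marg A p (\<lambda>x. (f x, g x, h x)) (f a, g a, h a) * marg A p h (h a)
        = r a * marg A p (\<lambda>x. (g x, h x)) (g a, h a) * marg A p (\<lambda>x. (f x, h x)) (f a, h a)"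
  shows "cond_mutual_info A (p :: 'a \<Rightarrow> real) f g h = (\<Sum>a\<in>A. p a * log 2 (r a))"
  unfolding cond_mutual_info_def cond_entropy_def diff_conv_add_uminus minus_minus
    sum_negf[symmetric] sum.distrib[symmetric]
proof (rule sum.cong)
  fix a assume a: "a \<in> A"
  let ?fgh = "marg A p (\<lambda>x. (f x, g x, h x)) (f a, g a, h a)"
  let ?gh = "marg A p (\<lambda>x. (g x, h x)) (g a, h a)"
  let ?fh = "marg A p (\<lambda>x. (f x, h x)) (f a, h a)"
  let ?h = "marg A p h (h a)"
  show "- (if p a = 0 then 0 else p a * log 2 (?fh / ?h)) + (if p a = 0 then 0 else p a * log 2 (?fgh / ?gh))
      = p a * log 2 (r a)"
  proof (cases "p a = 0")
    case False
    then have pa: "0 < p a" using p0[OF a] by simp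
    have mp: "0 < marg A p k (k a)" for k :: "'a \<Rightarrow> 'k"
      using marg_pos[of A p a k] assms(1) p0 a pa by blast
    have pos: "0 < ?fgh" "0 < ?gh" "0 < ?fh" "0 < ?h"
      using mp[of "\<lambda>x. (f x, g x, h x)"] mp[of "\<lambda>x. (g x, h x)"] mp[of "\<lambda>x. (f x, h x)"] mp[of h] by auto
    have "r a = (?fgh / ?gh) / (?fh / ?h)"
      using ratio[OF a pa] pos by (simp add: field_simps)
    then have lr: "log 2 (r a) = log 2 (?fgh / ?gh) - log 2 (?fh / ?h)"
      using pos by (simp only:) (subst log_divide, auto)
    show ?thesis using False by (simp add: lr right_diff_distrib)
  qed simp
qed simp

lemma is_pmf_nonneg: "is_pmf p \<Longrightarrow> 0 \<le> p x"
  by (simp add: is_pmf_def)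

lemma is_pmf_sum: "is_pmf p \<Longrightarrow> (\<Sum>x\<in>UNIV. p x) = 1"
  by (simp add: is_pmf_def)

lemma sum_UNIV_Times: "(\<Sum>z\<in>(UNIV :: ('a::finite \<times> 'b::finite) set). f z) = (\<Sum>a\<in>UNIV. \<Sum>b\<in>UNIV. f (a, b))"
  by (simp add: sum.cartesian_product UNIV_Times_UNIV)

context
  fixes P :: "'s1::finite \<Rightarrow> 's2::finite \<Rightarrow> 'w::finite \<Rightarrow> real"
  assumes P_pmf: "is_pmf (\<lambda>(s1, s2, w). P s1 s2 w)"
begin

lemma source_nonneg: "0 \<le> P a b c"
  using is_pmf_nonneg[OF P_pmf, of "(a, b, c)"] by simp

lemma source_sum: "(\<Sum>a\<in>UNIV. \<Sum>b\<in>UNIV. \<Sum>c\<in>UNIV. P a b c) = 1"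
  using is_pmf_sum[OF P_pmf] by (simp add: sum_UNIV_Times)

lemma source_marg_pos:
  assumes "0 < P a b c"
  shows "0 < (\<Sum>a'\<in>UNIV. P a' b c)" "0 < (\<Sum>b'\<in>UNIV. P a b' c)"
    "0 < (\<Sum>a'\<in>UNIV. \<Sum>b'\<in>UNIV. P a' b' c)"
proof -
  show "0 < (\<Sum>a'\<in>UNIV. P a' b c)"
    using assms source_nonneg by (intro sum_pos2[of _ a]) auto
  show *: "0 < (\<Sum>b'\<in>UNIV. P a b' c)"
    using assms source_nonneg by (intro sum_pos2[of _ b]) auto
  show "0 < (\<Sum>a'\<in>UNIV. \<Sum>b'\<in>UNIV. P a' b' c)"
    using * source_nonneg by (intro sum_pos2[of _ a]) (auto intro!: sum_nonneg)
qed

lemma cond_entropy_H1: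
  "cond_entropy UNIV (\<lambda>(s1, s2, w). P s1 s2 w) (\<lambda>(s1, s2, w). s1) (\<lambda>(s1, s2, w). (s2, w)) = H1 P"
proof -
  have "cond_entropy UNIV (\<lambda>(s1, s2, w). P s1 s2 w) (\<lambda>(s1, s2, w). s1) (\<lambda>(s1, s2, w). (s2, w))
      = (\<Sum>z\<in>UNIV. (case z of (a, b, c) \<Rightarrow> P a b c) *
          log 2 ((case z of (a, b, c) \<Rightarrow> \<Sum>a'\<in>UNIV. P a' b c) / (case z of (a, b, c) \<Rightarrow> P a b c)))"
  proof (rule cond_entropy_log_ratio)
    fix z :: "'s1 \<times> 's2 \<times> 'w"
    obtain a b c where z: "z = (a, b, c)" by (cases z)
    show "marg UNIV (\<lambda>(s1, s2, w). P s1 s2 w) (\<lambda>x. (case x of (s1, s2, w) \<Rightarrow> s1, case x of (s1, s2, w) \<Rightarrow> (s2, w)))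
        (case z of (s1, s2, w) \<Rightarrow> s1, case z of (s1, s2, w) \<Rightarrow> (s2, w)) = (case z of (a, b, c) \<Rightarrow> P a b c)"
      by (subst marg_reindex[where e = "\<lambda>_. z" and I = "{()}"]) (auto simp: z)
    show "marg UNIV (\<lambda>(s1, s2, w). P s1 s2 w) (\<lambda>(s1, s2, w). (s2, w)) (case z of (s1, s2, w) \<Rightarrow> (s2, w))
        = (case z of (a, b, c) \<Rightarrow> \<Sum>a'\<in>UNIV. P a' b c)"
      by (subst marg_reindex[where e = "\<lambda>a'. (a', b, c)" and I = UNIV]) (auto simp: z inj_on_def)
    show "0 < (case z of (a, b, c) \<Rightarrow> \<Sum>a'\<in>UNIV. P a' b c)" if "0 < (case z of (a, b, c) \<Rightarrow> P a b c)"
      using that source_marg_pos by (simp add: z)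
  qed (auto simp: source_nonneg)
  then show ?thesis by (simp add: H1_def sum_UNIV_Times)
qed

lemma cond_entropy_H2:
  "cond_entropy UNIV (\<lambda>(s1, s2, w). P s1 s2 w) (\<lambda>(s1, s2, w). s2) (\<lambda>(s1, s2, w). (s1, w)) = H2 P"
proof -
  have "cond_entropy UNIV (\<lambda>(s1, s2, w). P s1 s2 w) (\<lambda>(s1, s2, w). s2) (\<lambda>(s1, s2, w). (s1, w))
      = (\<Sum>z\<in>UNIV. (case z of (a, b, c) \<Rightarrow> P a b c) *
          log 2 ((case z of (a, b, c) \<Rightarrow> \<Sum>b'\<in>UNIV. P a b' c) / (case z of (a, b, c) \<Rightarrow> P a b c)))"
  proof (rule cond_entropy_log_ratio)
    fix z :: "'s1 \<times> 's2 \<times> 'w"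
    obtain a b c where z: "z = (a, b, c)" by (cases z)
    show "marg UNIV (\<lambda>(s1, s2, w). P s1 s2 w) (\<lambda>x. (case x of (s1, s2, w) \<Rightarrow> s2, case x of (s1, s2, w) \<Rightarrow> (s1, w)))
        (case z of (s1, s2, w) \<Rightarrow> s2, case z of (s1, s2, w) \<Rightarrow> (s1, w)) = (case z of (a, b, c) \<Rightarrow> P a b c)"
      by (subst marg_reindex[where e = "\<lambda>_. z" and I = "{()}"]) (auto simp: z)
    show "marg UNIV (\<lambda>(s1, s2, w). P s1 s2 w) (\<lambda>(s1, s2, w). (s1, w)) (case z of (s1, s2, w) \<Rightarrow> (s1, w))
        = (case z of (a, b, c) \<Rightarrow> \<Sum>b'\<in>UNIV. P a b' c)"
      by (subst marg_reindex[where e = "\<lambda>b'. (a, b', c)" and I = UNIV]) (auto simp: z inj_on_def)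
    show "0 < (case z of (a, b, c) \<Rightarrow> \<Sum>b'\<in>UNIV. P a b' c)" if "0 < (case z of (a, b, c) \<Rightarrow> P a b c)"
      using that source_marg_pos by (simp add: z)
  qed (auto simp: source_nonneg)
  then show ?thesis by (simp add: H2_def sum_UNIV_Times)
qed

lemma cond_entropy_H3:
  "cond_entropy UNIV (\<lambda>(s1, s2, w). P s1 s2 w) (\<lambda>(s1, s2, w). (s1, s2)) (\<lambda>(s1, s2, w). w) = H3 P"
proof -
  have "cond_entropy UNIV (\<lambda>(s1, s2, w). P s1 s2 w) (\<lambda>(s1, s2, w). (s1, s2)) (\<lambda>(s1, s2, w). w)
      = (\<Sum>z\<in>UNIV. (case z of (a, b, c) \<Rightarrow> P a b c) *
          log 2 ((case z of (a, b, c) \<Rightarrow> \<Sum>a'\<in>UNIV. \<Sum>b'\<in>UNIV. P a' b' c) / (case z of (a, b, c) \<Rightarrow> P a b c)))"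
  proof (rule cond_entropy_log_ratio)
    fix z :: "'s1 \<times> 's2 \<times> 'w"
    obtain a b c where z: "z = (a, b, c)" by (cases z)
    show "marg UNIV (\<lambda>(s1, s2, w). P s1 s2 w) (\<lambda>x. (case x of (s1, s2, w) \<Rightarrow> (s1, s2), case x of (s1, s2, w) \<Rightarrow> w))
        (case z of (s1, s2, w) \<Rightarrow> (s1, s2), case z of (s1, s2, w) \<Rightarrow> w) = (case z of (a, b, c) \<Rightarrow> P a b c)"
      by (subst marg_reindex[where e = "\<lambda>_. z" and I = "{()}"]) (auto simp: z)
    show "marg UNIV (\<lambda>(s1, s2, w). P s1 s2 w) (\<lambda>(s1, s2, w). w) (case z of (s1, s2, w) \<Rightarrow> w)
        = (case z of (a, b, c) \<Rightarrow> \<Sum>a'\<in>UNIV. \<Sum>b'\<in>UNIV. P a' b' c)"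
      by (subst marg_reindex[where e = "\<lambda>(a', b'). (a', b', c)" and I = UNIV])
         (auto simp: z inj_on_def sum_UNIV_Times)
    show "0 < (case z of (a, b, c) \<Rightarrow> \<Sum>a'\<in>UNIV. \<Sum>b'\<in>UNIV. P a' b' c)"
      if "0 < (case z of (a, b, c) \<Rightarrow> P a b c)"
      using that source_marg_pos by (simp add: z)
  qed (auto simp: source_nonneg)
  then show ?thesis by (simp add: H3_def sum_UNIV_Times)
qed

end

section \<open>Output laws and the joint law with a time-sharing letter\<close>

lemma channel_nonneg: "is_channel W \<Longrightarrow> 0 \<le> W x1 x2 y"
  by (simp add: is_channel_def is_pmf_def)

lemma channel_sum: "is_channel W \<Longrightarrow> (\<Sum>y\<in>UNIV. W x1 x2 y) = 1"
  by (simp add: is_channel_def is_pmf_def)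

lemma out_pos:
  assumes W: "is_channel W" and p0: "\<And>x. 0 \<le> p1 x" "\<And>x. 0 \<le> p2 x"
    and pos: "0 < p1 x1" "0 < p2 x2" "0 < W x1 x2 y"
  shows "0 < out1 W p1 x2 y" "0 < out2 W p2 x1 y" "0 < out3 W p1 p2 y"
proof -
  note nn = channel_nonneg[OF W] p0
  show "0 < out1 W p1 x2 y" unfolding out1_def
    using pos nn by (intro sum_pos2[of _ x1]) auto
  show "0 < out2 W p2 x1 y" unfolding out2_def
    using pos nn by (intro sum_pos2[of _ x2]) auto
  have "0 < (\<Sum>x2\<in>UNIV. p1 x1 * (p2 x2 * W x1 x2 y))"
    using pos nn by (intro sum_pos2[of _ x2]) auto
  then show "0 < out3 W p1 p2 y" unfolding out3_def
    using nn by (intro sum_pos2[of _ x1]) (auto intro!: sum_nonneg)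
qed

lemma finite_Qspace: "finite (Qspace :: (nat \<times> 'x1::finite \<times> 'x2::finite \<times> 'y::finite) set)"
  by (simp add: Qspace_def)

context
  fixes W :: "'x1::finite \<Rightarrow> 'x2::finite \<Rightarrow> 'y::finite \<Rightarrow> real"
    and pq :: "nat \<Rightarrow> real" and px1 :: "nat \<Rightarrow> 'x1 \<Rightarrow> real" and px2 :: "nat \<Rightarrow> 'x2 \<Rightarrow> real"
  assumes W: "is_channel W" and valid: "valid_input_dist pq px1 px2"
begin

lemma input_nonneg: "0 \<le> pq q" "0 \<le> px1 q x1" "0 \<le> px2 q x2"
  using valid by (auto simp: valid_input_dist_def is_pmf_def)

lemma input_sum: "(\<Sum>x\<in>UNIV. px1 q x) = 1" "(\<Sum>x\<in>UNIV. px2 q x) = 1" "(\<Sum>q<4. pq q) = 1"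
  using valid by (auto simp: valid_input_dist_def is_pmf_def)

lemma joint_nonneg: "0 \<le> joint_qxy pq px1 px2 W z"
  by (cases z) (simp add: joint_qxy_def input_nonneg channel_nonneg[OF W])

lemma joint_sums:
  fixes q x1 x2 y
  defines "J \<equiv> joint_qxy pq px1 px2 W"
  shows "(\<Sum>y\<in>UNIV. J (q, x1, x2, y)) = pq q * px1 q x1 * px2 q x2"
    and "(\<Sum>x1\<in>UNIV. \<Sum>y\<in>UNIV. J (q, x1, x2, y)) = pq q * px2 q x2"
    and "(\<Sum>x2\<in>UNIV. \<Sum>y\<in>UNIV. J (q, x1, x2, y)) = pq q * px1 q x1"
    and "(\<Sum>x1\<in>UNIV. \<Sum>x2\<in>UNIV. \<Sum>y\<in>UNIV. J (q, x1, x2, y)) = pq q"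
    and "(\<Sum>x1\<in>UNIV. J (q, x1, x2, y)) = pq q * px2 q x2 * out1 W (px1 q) x2 y"
    and "(\<Sum>x2\<in>UNIV. J (q, x1, x2, y)) = pq q * px1 q x1 * out2 W (px2 q) x1 y"
    and "(\<Sum>x1\<in>UNIV. \<Sum>x2\<in>UNIV. J (q, x1, x2, y)) = pq q * out3 W (px1 q) (px2 q) y"
proof -
  show y: "(\<Sum>y\<in>UNIV. J (q, x1, x2, y)) = pq q * px1 q x1 * px2 q x2" for x1 x2
    by (simp add: J_def joint_qxy_def sum_distrib_left[symmetric] channel_sum[OF W])
  show "(\<Sum>x1\<in>UNIV. \<Sum>y\<in>UNIV. J (q, x1, x2, y)) = pq q * px2 q x2"
    unfolding y by (simp add: sum_distrib_left[symmetric] sum_distrib_right[symmetric] input_sum)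
  show x2: "(\<Sum>x2\<in>UNIV. \<Sum>y\<in>UNIV. J (q, x1, x2, y)) = pq q * px1 q x1" for x1
    unfolding y by (simp add: sum_distrib_left[symmetric] input_sum)
  show "(\<Sum>x1\<in>UNIV. \<Sum>x2\<in>UNIV. \<Sum>y\<in>UNIV. J (q, x1, x2, y)) = pq q"
    unfolding x2 by (simp add: sum_distrib_left[symmetric] input_sum)
  show "(\<Sum>x1\<in>UNIV. J (q, x1, x2, y)) = pq q * px2 q x2 * out1 W (px1 q) x2 y"
    by (simp add: J_def joint_qxy_def out1_def sum_distrib_left mult_ac)
  show "(\<Sum>x2\<in>UNIV. J (q, x1, x2, y)) = pq q * px1 q x1 * out2 W (px2 q) x1 y"
    by (simp add: J_def joint_qxy_def out2_def sum_distrib_left mult_ac)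
  show "(\<Sum>x1\<in>UNIV. \<Sum>x2\<in>UNIV. J (q, x1, x2, y)) = pq q * out3 W (px1 q) (px2 q) y"
    by (simp add: J_def joint_qxy_def out3_def sum_distrib_left mult_ac)
qed

lemma sum_joint_log:
  "(\<Sum>z\<in>Qspace. joint_qxy pq px1 px2 W z *
      log 2 (case z of (q, x1, x2, y) \<Rightarrow> W x1 x2 y / D q x1 x2 y))
   = (\<Sum>q<4. pq q * info_sum W (px1 q) (px2 q) (D q))"
  by (simp add: Qspace_def sum.cartesian_product' sum_UNIV_Times joint_qxy_def info_sum_def
      sum_distrib_left mult_ac atLeast0LessThan)

text \<open>The common part of the three informations: \<open>out\<close> is the output law given
  the conditioning variables, and the density is \<open>W / out\<close>. Dividing is legitimate
  because \<open>out\<close> is positive wherever the joint law is.\<close>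

lemma joint_log_ratio:
  fixes f :: "nat \<times> 'x1 \<times> 'x2 \<times> 'y \<Rightarrow> 'f" and g :: "_ \<Rightarrow> 'g" and h :: "_ \<Rightarrow> 'h"
  assumes "\<And>q x1 x2 y. q < 4 \<Longrightarrow> 0 < out q x1 x2 y \<Longrightarrow>
      marg Qspace (joint_qxy pq px1 px2 W) (\<lambda>x. (f x, g x, h x)) (f (q, x1, x2, y), g (q, x1, x2, y), h (q, x1, x2, y))
        * marg Qspace (joint_qxy pq px1 px2 W) h (h (q, x1, x2, y)) * out q x1 x2 y
      = W x1 x2 y * marg Qspace (joint_qxy pq px1 px2 W) (\<lambda>x. (g x, h x)) (g (q, x1, x2, y), h (q, x1, x2, y))
        * marg Qspace (joint_qxy pq px1 px2 W) (\<lambda>x. (f x, h x)) (f (q, x1, x2, y), h (q, x1, x2, y))"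
    and pos: "\<And>q x1 x2 y. 0 < px1 q x1 \<Longrightarrow> 0 < px2 q x2 \<Longrightarrow> 0 < W x1 x2 y \<Longrightarrow> 0 < out q x1 x2 y"
  shows "cond_mutual_info Qspace (joint_qxy pq px1 px2 W) f g h
      = (\<Sum>q<4. pq q * info_sum W (px1 q) (px2 q) (out q))"
  unfolding sum_joint_log[symmetric]
proof (rule cond_mutual_info_log_ratio)
  fix z :: "nat \<times> 'x1 \<times> 'x2 \<times> 'y"
  assume z: "z \<in> Qspace" "0 < joint_qxy pq px1 px2 W z"
  obtain q x1 x2 y where zz: "z = (q, x1, x2, y)" by (cases z)
  have "q < 4" using z by (simp add: zz Qspace_def)
  moreover have "px1 q x1 \<noteq> 0" "px2 q x2 \<noteq> 0" "W x1 x2 y \<noteq> 0"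
    using z(2) by (auto simp: zz joint_qxy_def)
  then have "0 < out q x1 x2 y"
    using input_nonneg channel_nonneg[OF W] by (intro pos) (simp_all add: order.not_eq_order_implies_strict less_le)
  ultimately show "marg Qspace (joint_qxy pq px1 px2 W) (\<lambda>x. (f x, g x, h x)) (f z, g z, h z)
        * marg Qspace (joint_qxy pq px1 px2 W) h (h z)
      = (case z of (q, x1, x2, y) \<Rightarrow> W x1 x2 y / out q x1 x2 y)
        * marg Qspace (joint_qxy pq px1 px2 W) (\<lambda>x. (g x, h x)) (g z, h z)
        * marg Qspace (joint_qxy pq px1 px2 W) (\<lambda>x. (f x, h x)) (f z, h z)"
    using assms(1)[of q x1 x2 y] by (simp add: zz field_simps)
qed (auto simp: finite_Qspace joint_nonneg)

lemma cond_mutual_info_I1: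
  "cond_mutual_info Qspace (joint_qxy pq px1 px2 W) (\<lambda>(q, x1, x2, y). x1) (\<lambda>(q, x1, x2, y). y)
      (\<lambda>t. (case t of (q, x1, x2, y) \<Rightarrow> x2, case t of (q, x1, x2, y) \<Rightarrow> q))
   = (\<Sum>q<4. pq q * I1 W (px1 q) (px2 q))"
  unfolding I1_def
proof (rule joint_log_ratio, goal_cases)
  case (1 q x1 x2 y)
  then show ?case
    apply simp
    \<comment> \<open>The four marginals of the identity are computed by their free coordinates:
      none for (X1, Y, X2, Q), the pair (x1, y) for (X2, Q), x1 for (Y, X2, Q), and y for (X1, X2,
      Q). The next two lemmas follow the same pattern.\<close>
    apply (subst marg_reindex[where e = "\<lambda>_. (q, x1, x2, y)" and I = "{()}"])
       apply (auto simp: finite_Qspace Qspace_def)[3]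
    apply (subst marg_reindex[where e = "\<lambda>(x1, y). (q, x1, x2, y)" and I = UNIV])
       apply (auto simp: finite_Qspace Qspace_def inj_on_def)[3]
    apply (subst marg_reindex[where e = "\<lambda>x1. (q, x1, x2, y)" and I = UNIV])
       apply (auto simp: finite_Qspace Qspace_def inj_on_def)[3]
    apply (subst marg_reindex[where e = "\<lambda>y. (q, x1, x2, y)" and I = UNIV])
       apply (auto simp: finite_Qspace Qspace_def inj_on_def)[3]
    apply (simp add: sum_UNIV_Times joint_sums(1) joint_sums(5))
    apply (simp add: joint_qxy_def sum_distrib_left[symmetric] sum_distrib_right[symmetric] input_sum)
    done
next
  case (2 q x1 x2 y)
  then show ?case using out_pos(1)[OF W, of "px1 q" "px2 q" x1 x2 y] input_nonneg by simp
qed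

lemma cond_mutual_info_I2:
  "cond_mutual_info Qspace (joint_qxy pq px1 px2 W) (\<lambda>(q, x1, x2, y). x2) (\<lambda>(q, x1, x2, y). y)
      (\<lambda>t. (case t of (q, x1, x2, y) \<Rightarrow> x1, case t of (q, x1, x2, y) \<Rightarrow> q))
   = (\<Sum>q<4. pq q * I2 W (px1 q) (px2 q))"
  unfolding I2_def
proof (rule joint_log_ratio, goal_cases)
  case (1 q x1 x2 y)
  then show ?case
    apply simp
    apply (subst marg_reindex[where e = "\<lambda>_. (q, x1, x2, y)" and I = "{()}"])
       apply (auto simp: finite_Qspace Qspace_def)[3]
    apply (subst marg_reindex[where e = "\<lambda>(x2, y). (q, x1, x2, y)" and I = UNIV])
       apply (auto simp: finite_Qspace Qspace_def inj_on_def)[3]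
    apply (subst marg_reindex[where e = "\<lambda>x2. (q, x1, x2, y)" and I = UNIV])
       apply (auto simp: finite_Qspace Qspace_def inj_on_def)[3]
    apply (subst marg_reindex[where e = "\<lambda>y. (q, x1, x2, y)" and I = UNIV])
       apply (auto simp: finite_Qspace Qspace_def inj_on_def)[3]
    apply (simp add: sum_UNIV_Times joint_sums(1) joint_sums(6))
    apply (simp add: joint_qxy_def sum_distrib_left[symmetric] sum_distrib_right[symmetric] input_sum)
    done
next
  case (2 q x1 x2 y)
  then show ?case using out_pos(2)[OF W, of "px1 q" "px2 q" x1 x2 y] input_nonneg by simp
qed

lemma cond_mutual_info_I3:
  "cond_mutual_info Qspace (joint_qxy pq px1 px2 W)
      (\<lambda>t. (case t of (q, x1, x2, y) \<Rightarrow> x1, case t of (q, x1, x2, y) \<Rightarrow> x2))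
      (\<lambda>(q, x1, x2, y). y) (\<lambda>(q, x1, x2, y). q)
   = (\<Sum>q<4. pq q * I3 W (px1 q) (px2 q))"
  unfolding I3_def
proof (rule joint_log_ratio, goal_cases)
  case (1 q x1 x2 y)
  then show ?case
    apply simp
    apply (subst marg_reindex[where e = "\<lambda>_. (q, x1, x2, y)" and I = "{()}"])
       apply (auto simp: finite_Qspace Qspace_def)[3]
    apply (subst marg_reindex[where e = "\<lambda>(x1, x2, y). (q, x1, x2, y)" and I = UNIV])
       apply (auto simp: finite_Qspace Qspace_def inj_on_def)[3]
    apply (subst marg_reindex[where e = "\<lambda>(x1, x2). (q, x1, x2, y)" and I = UNIV])
       apply (auto simp: finite_Qspace Qspace_def inj_on_def)[3]
    apply (subst marg_reindex[where e = "\<lambda>y. (q, x1, x2, y)" and I = UNIV])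
       apply (auto simp: finite_Qspace Qspace_def inj_on_def)[3]
    apply (simp add: sum_UNIV_Times joint_sums(1) joint_sums(7))
    apply (simp add: joint_qxy_def sum_distrib_left[symmetric] sum_distrib_right[symmetric] input_sum)
    done
next
  case (2 q x1 x2 y)
  then show ?case using out_pos(3)[OF W, of "px1 q" "px2 q" x1 x2 y] input_nonneg by simp
qed

text \<open>The bridge between the statement and the proof: achievability uses it with
  \<open>(<)\<close> for \<open>R\<close>, the converse with \<open>(\<le>)\<close>.\<close>

lemma rate_conditions_iff:
  assumes "is_pmf (\<lambda>(s1, s2, w). P s1 s2 w)"
  shows "rate_conditions R P W b pq px1 px2 \<longleftrightarrow>
      R (H1 P) (b * (\<Sum>q<4. pq q * I1 W (px1 q) (px2 q)))
    \<and> R (H2 P) (b * (\<Sum>q<4. pq q * I2 W (px1 q) (px2 q)))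
    \<and> R (H3 P) (b * (\<Sum>q<4. pq q * I3 W (px1 q) (px2 q)))"
  unfolding rate_conditions_def Let_def cond_mutual_info_I1[symmetric] cond_mutual_info_I2[symmetric]
    cond_mutual_info_I3[symmetric] cond_entropy_H1[OF assms, symmetric] cond_entropy_H2[OF assms, symmetric]
    cond_entropy_H3[OF assms, symmetric]
  by (rule refl)

end

subsection \<open>Achievability\<close>

lemma sum_log_eq_log_prod:
  fixes f :: "nat \<Rightarrow> real"
  assumes "\<And>i. i < n \<Longrightarrow> 0 < f i"
  shows "(\<Sum>i<n. log 2 (f i)) = log 2 (\<Prod>i<n. f i)"
  using assms
proof (induction n)
  case (Suc n)
  have "0 < (\<Prod>i<n. f i)" using Suc.prems by (intro prod_pos) auto
  then show ?case using Suc by (simp add: log_mult_pos)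
qed simp

text \<open>The rejection of the right pair in additive form: taking logarithms of the failed
  product test leaves sums of single-letter terms, to which Chebyshev applies.\<close>

lemma log_threshold:
  fixes p M w D :: "nat \<Rightarrow> real"
  assumes pos: "\<And>i. i < m \<Longrightarrow> 0 < p i" "\<And>i. i < m \<Longrightarrow> 0 < M i"
      "\<And>j. j < n \<Longrightarrow> 0 < w j" "\<And>j. j < n \<Longrightarrow> 0 < D j"
    and t: "0 < t"
    and le: "(\<Prod>i<m. p i) * (\<Prod>j<n. w j) \<le> t * ((\<Prod>i<m. M i) * (\<Prod>j<n. D j))"
  shows "(\<Sum>j<n. log 2 (w j / D j)) - (\<Sum>i<m. log 2 (M i / p i)) \<le> log 2 t"
proof -
  have P: "0 < (\<Prod>i<m. p i)" "0 < (\<Prod>i<m. M i)" "0 < (\<Prod>j<n. w j)" "0 < (\<Prod>j<n. D j)"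
    using pos by (auto intro!: prod_pos)
  have "(\<Sum>j<n. log 2 (w j / D j)) - (\<Sum>i<m. log 2 (M i / p i))
      = log 2 ((\<Prod>j<n. w j) / (\<Prod>j<n. D j)) - log 2 ((\<Prod>i<m. M i) / (\<Prod>i<m. p i))"
    using pos by (simp add: sum_log_eq_log_prod prod_dividef)
  also have "\<dots> = log 2 (((\<Prod>j<n. w j) / (\<Prod>j<n. D j)) / ((\<Prod>i<m. M i) / (\<Prod>i<m. p i)))"
    using P by (intro log_divide_pos[symmetric] divide_pos_pos)
  also have "\<dots> \<le> log 2 t"
    using P t le by (subst log_le_cancel_iff) (auto simp: field_simps)
  finally show ?thesis .
qed

lemma sum_seqs_weight:
  fixes p :: "'a \<Rightarrow> real"
  assumes "(\<Sum>x\<in>A. p x) = 1"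
  shows "(\<Sum>xs\<in>seqs A n. \<Prod>i<n. p (xs ! i)) = 1"
  using sum_seqs_prod[of "\<lambda>_. p" n A] assms by simp

text \<open>If two sums together fall below -2a, one of them falls below -a. Each event is bounded
  separately, the weights of the other sample summing to 1.\<close>

lemma two_sample_chebyshev:
  fixes p \<phi> :: "'a \<Rightarrow> real" and r \<psi> :: "'b \<Rightarrow> real"
  assumes fin: "finite A" "finite B"
    and p0: "\<And>x. x \<in> A \<Longrightarrow> 0 \<le> p x" and p: "(\<Sum>x\<in>A. p x) = 1" "(\<Sum>x\<in>A. p x * \<phi> x) = 0"
    and r0: "\<And>x. x \<in> B \<Longrightarrow> 0 \<le> r x" and r: "(\<Sum>x\<in>B. r x) = 1" "(\<Sum>x\<in>B. r x * \<psi> x) = 0"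
    and a: "0 < a"
  shows "(\<Sum>u\<in>seqs A m. \<Sum>v\<in>seqs B n. (\<Prod>i<m. p (u ! i)) * ((\<Prod>j<n. r (v ! j)) *
            of_bool ((\<Sum>i<m. \<phi> (u ! i)) + (\<Sum>j<n. \<psi> (v ! j)) \<le> - (2 * a))))
        \<le> (real m * (\<Sum>x\<in>A. p x * (\<phi> x)\<^sup>2) + real n * (\<Sum>x\<in>B. r x * (\<psi> x)\<^sup>2)) / a\<^sup>2"
proof -
  let ?p = "\<lambda>u. \<Prod>i<m. p (u ! i)" and ?r = "\<lambda>v. \<Prod>j<n. r (v ! j)"
  let ?f = "\<lambda>u. of_bool ((\<Sum>i<m. \<phi> (u ! i)) \<le> - a) :: real"
  let ?g = "\<lambda>v. of_bool ((\<Sum>j<n. \<psi> (v ! j)) \<le> - a) :: real"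
  have "(\<Sum>u\<in>seqs A m. \<Sum>v\<in>seqs B n. ?p u * (?r v *
            of_bool ((\<Sum>i<m. \<phi> (u ! i)) + (\<Sum>j<n. \<psi> (v ! j)) \<le> - (2 * a))))
      \<le> (\<Sum>u\<in>seqs A m. \<Sum>v\<in>seqs B n. ?p u * (?r v * (?f u + ?g v)))"
    by (intro sum_mono mult_left_mono prod_nonneg) (auto intro: p0 r0 seqs_nth)
  also have "\<dots> = (\<Sum>u\<in>seqs A m. ?p u * ?f u) * (\<Sum>v\<in>seqs B n. ?r v)
      + (\<Sum>u\<in>seqs A m. ?p u) * (\<Sum>v\<in>seqs B n. ?r v * ?g v)"
    unfolding sum_product sum.distrib[symmetric] by (simp only: distrib_left mult_ac)
  also have "\<dots> = (\<Sum>u\<in>seqs A m. ?p u * ?f u) + (\<Sum>v\<in>seqs B n. ?r v * ?g v)"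
    by (simp add: sum_seqs_weight p r)
  also have "\<dots> \<le> real m * (\<Sum>x\<in>A. p x * (\<phi> x)\<^sup>2) / a\<^sup>2 + real n * (\<Sum>x\<in>B. r x * (\<psi> x)\<^sup>2) / a\<^sup>2"
    by (intro add_mono seqs_chebyshev fin p0 p r0 r a)
  finally show ?thesis by (simp add: add_divide_distrib)
qed

text \<open>Confines an implication between events to the support, where all logarithms have
  positive arguments.\<close>

lemma weighted_of_bool_mono:
  fixes x y :: real
  assumes "0 \<le> x" "0 \<le> y" "A \<Longrightarrow> x \<noteq> 0 \<Longrightarrow> y \<noteq> 0 \<Longrightarrow> B"
  shows "x * (y * of_bool A) \<le> x * (y * of_bool B)"
  using assms by (cases "x = 0 \<or> y = 0") auto

lemma threshold_prob:
  fixes p M :: "'a \<Rightarrow> real" and r w D :: "'b \<Rightarrow> real"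
  assumes fin: "finite A" "finite B"
    and p0: "\<And>x. x \<in> A \<Longrightarrow> 0 \<le> p x" and p: "(\<Sum>x\<in>A. p x) = 1"
    and r0: "\<And>x. x \<in> B \<Longrightarrow> 0 \<le> r x" and r: "(\<Sum>x\<in>B. r x) = 1"
    and M: "\<And>x. x \<in> A \<Longrightarrow> 0 < p x \<Longrightarrow> 0 < M x"
    and D: "\<And>x. x \<in> B \<Longrightarrow> 0 < r x \<Longrightarrow> 0 < w x \<and> 0 < D x"
    and gap: "(\<Sum>x\<in>A. p x * log 2 (M x / p x)) + c \<le> b * (\<Sum>x\<in>B. r x * log 2 (w x / D x))"
    and c: "0 < c"
  shows "\<exists>K. \<forall>m n t. 0 < m \<longrightarrow> real n = b * real m \<longrightarrow> t = 2 powr (real m * c / 2) \<longrightarrow>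
      (\<Sum>u\<in>seqs A m. \<Sum>v\<in>seqs B n. (\<Prod>i<m. p (u ! i)) * ((\<Prod>j<n. r (v ! j)) *
         of_bool ((\<Prod>i<m. p (u ! i)) * (\<Prod>j<n. w (v ! j)) \<le> t * ((\<Prod>i<m. M (u ! i)) * (\<Prod>j<n. D (v ! j))))))
      \<le> K / real m"
proof -
  define H where "H = (\<Sum>x\<in>A. p x * log 2 (M x / p x))"
  define I where "I = (\<Sum>x\<in>B. r x * log 2 (w x / D x))"
  define \<phi> where "\<phi> x = H - log 2 (M x / p x)" for x
  define \<psi> where "\<psi> x = log 2 (w x / D x) - I" for x
  have \<phi>: "(\<Sum>x\<in>A. p x * \<phi> x) = 0"
    by (simp add: \<phi>_def right_diff_distrib sum_subtractf sum_distrib_right[symmetric] p H_def)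
  have \<psi>: "(\<Sum>x\<in>B. r x * \<psi> x) = 0"
    by (simp add: \<psi>_def right_diff_distrib sum_subtractf sum_distrib_right[symmetric] r I_def)
  \<comment> \<open>The variance per source symbol, with b channel uses for each, over the square of
    the deviation c / 4; neither m nor n nor t enters.\<close>
  define K where "K = ((\<Sum>x\<in>A. p x * (\<phi> x)\<^sup>2) + b * (\<Sum>x\<in>B. r x * (\<psi> x)\<^sup>2)) / (c / 4)\<^sup>2"
  have "(\<Sum>u\<in>seqs A m. \<Sum>v\<in>seqs B n. (\<Prod>i<m. p (u ! i)) * ((\<Prod>j<n. r (v ! j)) *
         of_bool ((\<Prod>i<m. p (u ! i)) * (\<Prod>j<n. w (v ! j)) \<le> t * ((\<Prod>i<m. M (u ! i)) * (\<Prod>j<n. D (v ! j))))))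
      \<le> K / real m" (is "?L \<le> _")
    if m: "0 < m" and n: "real n = b * real m" and t: "t = 2 powr (real m * c / 2)" for m n t
  proof -
    \<comment> \<open>The total log ratio has mean at least m * c, while log t is m * c / 2, so a
      failed test lies at least m * c / 2 below the mean. Written as twice m * c / 4, this fits
      \<open>two_sample_chebyshev\<close>.\<close>
    have "?L \<le> (\<Sum>u\<in>seqs A m. \<Sum>v\<in>seqs B n. (\<Prod>i<m. p (u ! i)) * ((\<Prod>j<n. r (v ! j)) *
            of_bool ((\<Sum>i<m. \<phi> (u ! i)) + (\<Sum>j<n. \<psi> (v ! j)) \<le> - (2 * (real m * (c / 4))))))"
    proof (intro sum_mono)
      fix u v assume uv: "u \<in> seqs A m" "v \<in> seqs B n"
      let ?p = "\<Prod>i<m. p (u ! i)" and ?r = "\<Prod>j<n. r (v ! j)"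
      let ?le = "?p * (\<Prod>j<n. w (v ! j)) \<le> t * ((\<Prod>i<m. M (u ! i)) * (\<Prod>j<n. D (v ! j)))"
      let ?dev = "(\<Sum>i<m. \<phi> (u ! i)) + (\<Sum>j<n. \<psi> (v ! j)) \<le> - (2 * (real m * (c / 4)))"
      have nnp: "0 \<le> ?p" using p0 uv by (auto intro!: prod_nonneg dest: seqs_nth)
      have nnr: "0 \<le> ?r" using r0 uv by (auto intro!: prod_nonneg dest: seqs_nth)
      have ?dev if le: ?le and nz: "?p \<noteq> 0" "?r \<noteq> 0"
      proof -
        have pp: "0 < p (u ! i)" if "i < m" for i
          using nz(1) that p0[OF seqs_nth[OF uv(1) that]] by (simp add: less_le)
        have rp: "0 < r (v ! j)" if "j < n" for j
          using nz(2) that r0[OF seqs_nth[OF uv(2) that]] by (simp add: less_le)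
        have "(\<Sum>j<n. log 2 (w (v ! j) / D (v ! j))) - (\<Sum>i<m. log 2 (M (u ! i) / p (u ! i))) \<le> log 2 t"
        proof (rule log_threshold[OF _ _ _ _ _ le])
          show "0 < t" by (simp add: t)
        qed (use pp rp M D seqs_nth uv in blast)+
        then have *: "(\<Sum>j<n. log 2 (w (v ! j) / D (v ! j))) - (\<Sum>i<m. log 2 (M (u ! i) / p (u ! i)))
            \<le> real m * c / 2" by (simp add: t)
        have "real m * (H + c) \<le> real m * (b * I)"
          using gap by (intro mult_left_mono) (auto simp: H_def I_def)
        then have "real m * H - real n * I \<le> - (real m * c)"
          by (simp add: n algebra_simps)
        with * show ?dev unfolding \<phi>_def \<psi>_def sum_subtractf by simp argo
      qed
      then show "?p * (?r * of_bool ?le) \<le> ?p * (?r * of_bool ?dev)"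
        by (intro weighted_of_bool_mono nnp nnr)
    qed
    also have "\<dots> \<le> (real m * (\<Sum>x\<in>A. p x * (\<phi> x)\<^sup>2) + real n * (\<Sum>x\<in>B. r x * (\<psi> x)\<^sup>2)) / (real m * (c / 4))\<^sup>2"
      using m c by (intro two_sample_chebyshev fin p0 p r0 r \<phi> \<psi>) auto
    also have "\<dots> = (real m * ((\<Sum>x\<in>A. p x * (\<phi> x)\<^sup>2) + b * (\<Sum>x\<in>B. r x * (\<psi> x)\<^sup>2))) / (real m * (real m * (c / 4)\<^sup>2))"
      unfolding n by (simp add: algebra_simps power2_eq_square)
    also have "\<dots> = K / real m"
      using m by (simp add: K_def)
    finally show ?thesis .
  qed
  then show ?thesis by blast
qed

lemma sum_source_seqs:
  "(\<Sum>a\<in>seqs UNIV m. \<Sum>b\<in>seqs UNIV m. \<Sum>c\<in>seqs UNIV m. F a b c)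
   = (\<Sum>u\<in>seqs (UNIV :: ('a \<times> 'b \<times> 'c) set) m. F (map fst u) (map (fst \<circ> snd) u) (map (snd \<circ> snd) u))"
proof -
  have "(\<Sum>a\<in>seqs UNIV m. \<Sum>b\<in>seqs UNIV m. \<Sum>c\<in>seqs UNIV m. F a b c)
      = (\<Sum>a\<in>seqs UNIV m. \<Sum>z\<in>seqs (UNIV \<times> UNIV) m. F a (map fst z) (map snd z))"
    by (intro sum.cong refl sum_seqs_zip)
  also have "\<dots> = (\<Sum>u\<in>seqs (UNIV \<times> (UNIV \<times> UNIV)) m. F (map fst u) (map fst (map snd u)) (map snd (map snd u)))"
    by (rule sum_seqs_zip)
  finally show ?thesis by (simp add: comp_def)
qed

lemma sum_joint_seqs:
  "(\<Sum>q\<in>seqs A n. \<Sum>a\<in>seqs UNIV n. \<Sum>b\<in>seqs UNIV n. \<Sum>c\<in>seqs UNIV n. F q a b c)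
   = (\<Sum>v\<in>seqs (A \<times> (UNIV :: ('a \<times> 'b \<times> 'c) set)) n.
       F (map fst v) (map (fst \<circ> snd) v) (map (fst \<circ> snd \<circ> snd) v) (map (snd \<circ> snd \<circ> snd) v))"
  unfolding sum_source_seqs by (subst sum_seqs_zip) (simp add: comp_def)


text \<open>This is ln u \<le> u - 1 at u = y / x, multiplied by x. Summing it gives Gibbs'
  inequality and the nonnegativity of information.\<close>

lemma log_ratio_ge:
  fixes x y :: real
  assumes "0 \<le> x" "0 \<le> y" and pos: "0 < x \<Longrightarrow> 0 < y"
  shows "(x - y) / ln 2 \<le> x * log 2 (x / y)"
proof (cases "x = 0")
  case True
  then show ?thesis using assms by simp
next
  case False
  then have x: "0 < x" and y: "0 < y" using assms by auto
  then have "ln (y / x) \<le> y / x - 1" by (intro ln_le_minus_one) simp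
  moreover have "ln (y / x) = - ln (x / y)" using x y by (simp add: ln_div)
  ultimately have "x * (1 - y / x) \<le> x * ln (x / y)"
    using x by (intro mult_left_mono) auto
  then have "x - y \<le> x * ln (x / y)" using x by (simp add: right_diff_distrib)
  then show ?thesis by (simp add: log_def divide_right_mono)
qed

text \<open>Together with \<open>I1_nonneg\<close> this excludes a nonpositive rate in
  \<open>achievable_if_strict\<close>, since the first strict inequality would fail there.\<close>

lemma H1_nonneg:
  assumes P_pmf: "is_pmf (\<lambda>(s1, s2, w). P s1 s2 w)"
  shows "0 \<le> H1 P"
  unfolding H1_def
proof (intro sum_nonneg)
  fix a b c
  note nn = source_nonneg[OF P_pmf]
  show "0 \<le> P a b c * log 2 ((\<Sum>a'\<in>UNIV. P a' b c) / P a b c)"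
  proof (cases "P a b c = 0")
    case False
    then have p: "0 < P a b c" using nn[of a b c] by simp
    have "P a b c \<le> (\<Sum>a'\<in>UNIV. P a' b c)" by (intro member_le_sum) (auto simp: nn)
    then show ?thesis using p by (intro mult_nonneg_nonneg) (auto simp: nn)
  qed simp
qed

lemma info_sum_nonneg:
  assumes W: "is_channel W" and p: "is_pmf p1" "is_pmf p2"
    and D: "\<And>x1 x2 y. 0 \<le> D x1 x2 y" "\<And>x1 x2. (\<Sum>y\<in>UNIV. D x1 x2 y) = 1"
    and pos: "\<And>x1 x2 y. 0 < p1 x1 \<Longrightarrow> 0 < p2 x2 \<Longrightarrow> 0 < W x1 x2 y \<Longrightarrow> 0 < D x1 x2 y"
  shows "0 \<le> info_sum W p1 p2 D"
proof -
  note nn = channel_nonneg[OF W] is_pmf_nonneg[OF p(1)] is_pmf_nonneg[OF p(2)]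
  have tm: "p1 x1 * (p2 x2 * ((W x1 x2 y - D x1 x2 y) / ln 2))
      \<le> p1 x1 * (p2 x2 * (W x1 x2 y * log 2 (W x1 x2 y / D x1 x2 y)))" for x1 x2 y
  proof (cases "p1 x1 = 0 \<or> p2 x2 = 0")
    case False
    have "(W x1 x2 y - D x1 x2 y) / ln 2 \<le> W x1 x2 y * log 2 (W x1 x2 y / D x1 x2 y)"
      using False nn D pos by (intro log_ratio_ge) (simp_all add: less_le)
    then show ?thesis using nn by (intro mult_left_mono) auto
  qed auto
  have "0 = (\<Sum>x1\<in>UNIV. \<Sum>x2\<in>UNIV. \<Sum>y\<in>UNIV. p1 x1 * (p2 x2 * ((W x1 x2 y - D x1 x2 y) / ln 2)))"
    by (simp add: sum_distrib_left[symmetric] sum_divide_distrib[symmetric] sum_subtractf D channel_sum[OF W])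
  also have "\<dots> \<le> info_sum W p1 p2 D"
    unfolding info_sum_def by (intro sum_mono tm)
  finally show ?thesis .
qed

lemma out_nonneg:
  assumes "is_channel W" "is_pmf p1" "is_pmf p2"
  shows "0 \<le> out1 W p1 x2 y" "0 \<le> out2 W p2 x1 y" "0 \<le> out3 W p1 p2 y"
  using assms by (auto simp: out1_def out2_def out3_def channel_nonneg is_pmf_nonneg intro!: sum_nonneg)

lemma out_sum:
  assumes W: "is_channel W" and p: "is_pmf p1" "is_pmf p2"
  shows "(\<Sum>y\<in>UNIV. out1 W p1 x2 y) = 1" "(\<Sum>y\<in>UNIV. out2 W p2 x1 y) = 1" "(\<Sum>y\<in>UNIV. out3 W p1 p2 y) = 1"
proof -
  show "(\<Sum>y\<in>UNIV. out1 W p1 x2 y) = 1"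
    unfolding out1_def by (subst sum.swap) (simp add: sum_distrib_left[symmetric] channel_sum[OF W] is_pmf_sum[OF p(1)])
  show *: "(\<Sum>y\<in>UNIV. out2 W p2 x1 y) = 1" for x1
    unfolding out2_def by (subst sum.swap) (simp add: sum_distrib_left[symmetric] channel_sum[OF W] is_pmf_sum[OF p(2)])
  have "out3 W p1 p2 y = (\<Sum>x1\<in>UNIV. p1 x1 * out2 W p2 x1 y)" for y
    by (simp add: out3_def out2_def sum_distrib_left)
  then show "(\<Sum>y\<in>UNIV. out3 W p1 p2 y) = 1"
    by simp (subst sum.swap, simp add: sum_distrib_left[symmetric] * is_pmf_sum[OF p(1)])
qed

lemma I1_nonneg:
  assumes W: "is_channel W" and p: "is_pmf p1" "is_pmf p2"
  shows "0 \<le> I1 W p1 p2"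
  unfolding I1_def
  by (intro info_sum_nonneg W p out_nonneg(1)[OF W p] out_sum(1)[OF W p])
    (auto intro: out_pos(1)[OF W, of p1 p2] is_pmf_nonneg p)

section \<open>The threshold test on blocks and the resulting codes\<close>

context
  fixes P :: "'s1::finite \<Rightarrow> 's2::finite \<Rightarrow> 'w::finite \<Rightarrow> real"
    and W :: "'x1::finite \<Rightarrow> 'x2::finite \<Rightarrow> 'y::finite \<Rightarrow> real"
    and pq :: "nat \<Rightarrow> real" and px1 :: "nat \<Rightarrow> 'x1 \<Rightarrow> real" and px2 :: "nat \<Rightarrow> 'x2 \<Rightarrow> real"
  assumes P_pmf: "is_pmf (\<lambda>(s1, s2, w). P s1 s2 w)"
    and W: "is_channel W" and valid: "valid_input_dist pq px1 px2"
begin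

text \<open>\<open>threshold_prob\<close> for source triples and for the letters of
  \<open>Qspace\<close>. Keeping the time-sharing letter as a random coordinate makes the channel
  part i.i.d.; one sequence of such letters is selected later, in \<open>block_code\<close>.\<close>

lemma source_channel_threshold:
  fixes M :: "'s1 \<Rightarrow> 's2 \<Rightarrow> 'w \<Rightarrow> real" and D :: "nat \<Rightarrow> 'x1 \<Rightarrow> 'x2 \<Rightarrow> 'y \<Rightarrow> real"
  assumes M: "\<And>a b c. 0 < P a b c \<Longrightarrow> 0 < M a b c"
    and D: "\<And>q x1 x2 y. 0 < px1 q x1 \<Longrightarrow> 0 < px2 q x2 \<Longrightarrow> 0 < W x1 x2 y \<Longrightarrow> 0 < D q x1 x2 y"
    and gap: "(\<Sum>a\<in>UNIV. \<Sum>b\<in>UNIV. \<Sum>c\<in>UNIV. P a b c * log 2 (M a b c / P a b c)) + c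
        \<le> \<beta> * (\<Sum>q<4. pq q * info_sum W (px1 q) (px2 q) (D q))"
    and c: "0 < c"
  shows "\<exists>K. \<forall>m n t. 0 < m \<longrightarrow> real n = \<beta> * real m \<longrightarrow> t = 2 powr (real m * c / 2) \<longrightarrow>
      (\<Sum>a\<in>seqs UNIV m. \<Sum>b\<in>seqs UNIV m. \<Sum>c\<in>seqs UNIV m.
        \<Sum>q\<in>seqs {..<4} n. \<Sum>x\<in>seqs UNIV n. \<Sum>z\<in>seqs UNIV n. \<Sum>y\<in>seqs UNIV n.
          (\<Prod>i<m. P (a ! i) (b ! i) (c ! i)) *
          ((\<Prod>j<n. pq (q ! j) * px1 (q ! j) (x ! j) * px2 (q ! j) (z ! j) * W (x ! j) (z ! j) (y ! j)) *
          of_bool ((\<Prod>i<m. P (a ! i) (b ! i) (c ! i)) * (\<Prod>j<n. W (x ! j) (z ! j) (y ! j))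
            \<le> t * ((\<Prod>i<m. M (a ! i) (b ! i) (c ! i)) * (\<Prod>j<n. D (q ! j) (x ! j) (z ! j) (y ! j))))))
      \<le> K / real m"
proof -
  let ?P = "\<lambda>(a, b, c). P a b c" and ?M = "\<lambda>(a, b, c). M a b c"
  let ?W = "\<lambda>(q, x1, x2, y). W x1 x2 y" and ?D = "\<lambda>(q, x1, x2, y). D q x1 x2 y"
  let ?J = "joint_qxy pq px1 px2 W"
  have "\<exists>K. \<forall>m n t. 0 < m \<longrightarrow> real n = \<beta> * real m \<longrightarrow> t = 2 powr (real m * c / 2) \<longrightarrow>
      (\<Sum>u\<in>seqs UNIV m. \<Sum>v\<in>seqs Qspace n. (\<Prod>i<m. ?P (u ! i)) * ((\<Prod>j<n. ?J (v ! j)) *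
         of_bool ((\<Prod>i<m. ?P (u ! i)) * (\<Prod>j<n. ?W (v ! j)) \<le> t * ((\<Prod>i<m. ?M (u ! i)) * (\<Prod>j<n. ?D (v ! j))))))
      \<le> K / real m"
  proof (rule threshold_prob)
    show "finite (UNIV :: ('s1 \<times> 's2 \<times> 'w) set)" "finite (Qspace :: (nat \<times> 'x1 \<times> 'x2 \<times> 'y) set)"
      by (simp_all add: Qspace_def)
    show "(\<Sum>x\<in>UNIV. ?P x) = 1" using is_pmf_sum[OF P_pmf] .
    show "(\<Sum>x\<in>Qspace. ?J x) = 1"
      by (simp add: Qspace_def sum.cartesian_product' sum_UNIV_Times joint_sums[OF W valid]
          input_sum[OF W valid] atLeast0LessThan sum_distrib_left[symmetric] sum_distrib_right[symmetric])
    show "0 < ?M x" if "0 < ?P x" for x using that M by (cases x) simp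
    show "0 < ?W x \<and> 0 < ?D x" if "0 < ?J x" for x
    proof -
      obtain q x1 x2 y where x: "x = (q, x1, x2, y)" by (cases x)
      have "px1 q x1 \<noteq> 0" "px2 q x2 \<noteq> 0" "W x1 x2 y \<noteq> 0"
        using that by (auto simp: x joint_qxy_def)
      then have "0 < px1 q x1" "0 < px2 q x2" "0 < W x1 x2 y"
        using input_nonneg[OF W valid] channel_nonneg[OF W] by (simp_all add: less_le)
      then show ?thesis using D by (simp add: x)
    qed
    have "(\<Sum>x\<in>Qspace. ?J x * log 2 (?W x / ?D x)) = (\<Sum>q<4. pq q * info_sum W (px1 q) (px2 q) (D q))"
      unfolding sum_joint_log[OF W valid, symmetric] by (intro sum.cong refl) auto
    then show "(\<Sum>x\<in>UNIV. ?P x * log 2 (?M x / ?P x)) + c \<le> \<beta> * (\<Sum>x\<in>Qspace. ?J x * log 2 (?W x / ?D x))"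
      using gap by (simp add: sum_UNIV_Times)
  qed (use c source_nonneg[OF P_pmf] joint_nonneg[OF W valid] in auto)
  moreover have "(\<Sum>a\<in>seqs UNIV m. \<Sum>b\<in>seqs UNIV m. \<Sum>c\<in>seqs UNIV m.
        \<Sum>q\<in>seqs {..<4} n. \<Sum>x\<in>seqs UNIV n. \<Sum>z\<in>seqs UNIV n. \<Sum>y\<in>seqs UNIV n.
          (\<Prod>i<m. P (a ! i) (b ! i) (c ! i)) *
          ((\<Prod>j<n. pq (q ! j) * px1 (q ! j) (x ! j) * px2 (q ! j) (z ! j) * W (x ! j) (z ! j) (y ! j)) *
          of_bool ((\<Prod>i<m. P (a ! i) (b ! i) (c ! i)) * (\<Prod>j<n. W (x ! j) (z ! j) (y ! j))
            \<le> t * ((\<Prod>i<m. M (a ! i) (b ! i) (c ! i)) * (\<Prod>j<n. D (q ! j) (x ! j) (z ! j) (y ! j))))))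
    = (\<Sum>u\<in>seqs UNIV m. \<Sum>v\<in>seqs Qspace n. (\<Prod>i<m. ?P (u ! i)) * ((\<Prod>j<n. ?J (v ! j)) *
         of_bool ((\<Prod>i<m. ?P (u ! i)) * (\<Prod>j<n. ?W (v ! j)) \<le> t * ((\<Prod>i<m. ?M (u ! i)) * (\<Prod>j<n. ?D (v ! j))))))"
    for m n t
    unfolding sum_joint_seqs unfolding sum_source_seqs Qspace_def atLeast0LessThan
    by (intro sum.cong refl) (simp add: seqs_def joint_qxy_def case_prod_unfold)
  ultimately show ?thesis by simp
qed

text \<open>The constant is chosen before the block lengths, so the error vanishes along all lengths
  of the given ratio.\<close>

lemma block_code:
  fixes \<beta> c :: real
  assumes c: "0 < c"
    and gap: "H1 P + c \<le> \<beta> * (\<Sum>q<4. pq q * I1 W (px1 q) (px2 q))"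
      "H2 P + c \<le> \<beta> * (\<Sum>q<4. pq q * I2 W (px1 q) (px2 q))"
      "H3 P + c \<le> \<beta> * (\<Sum>q<4. pq q * I3 W (px1 q) (px2 q))"
  shows "\<exists>C. \<forall>m n. 0 < m \<longrightarrow> real n = \<beta> * real m \<longrightarrow>
     (\<exists>f1 f2 g. (\<forall>s. length s = m \<longrightarrow> length (f1 s) = n) \<and> (\<forall>s. length s = m \<longrightarrow> length (f2 s) = n) \<and>
        err_prob P W m n f1 f2 g \<le> C / real m)"
proof -
  define Pm where "Pm m a b c = (\<Prod>i<m. P (a ! i) (b ! i) (c ! i))" for m a b c
  define Wn where "Wn n x z y = (\<Prod>j<n. W (x ! j) (z ! j) (y ! j))" for n x z y
  define Jn where "Jn n q x z y = (\<Prod>j<n. pq (q ! j) * px1 (q ! j) (x ! j) * px2 (q ! j) (z ! j) * W (x ! j) (z ! j) (y ! j))"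
    for n q x z y
  define bad where "bad m n t M D a b c q x z y \<longleftrightarrow> (Pm m a b c * Wn n x z y
      \<le> t * ((\<Prod>i<m. M (a ! i) (b ! i) (c ! i)) * (\<Prod>j<n. D (q ! j) (x ! j) (z ! j) (y ! j))))"
    for m n t and a b c q x z y and M :: "'s1 \<Rightarrow> 's2 \<Rightarrow> 'w \<Rightarrow> real" and D :: "nat \<Rightarrow> 'x1 \<Rightarrow> 'x2 \<Rightarrow> 'y \<Rightarrow> real"
  define S where "S m n B = (\<Sum>a\<in>seqs UNIV m. \<Sum>b\<in>seqs UNIV m. \<Sum>c\<in>seqs UNIV m.
      \<Sum>q\<in>seqs {..<4} n. \<Sum>x\<in>seqs UNIV n. \<Sum>z\<in>seqs UNIV n. \<Sum>y\<in>seqs UNIV n.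
        Pm m a b c * (Jn n q x z y * of_bool (B a b c q x z y)))" for m n B
  \<comment> \<open>The dummy arguments of these six functions give the three tests the common shape
    that \<open>source_channel_threshold\<close> expects.\<close>
  define M1 where "M1 = (\<lambda>(a::'s1) b c. \<Sum>a'\<in>UNIV. P a' b c)"
  define M2 where "M2 = (\<lambda>a (b::'s2) c. \<Sum>b'\<in>UNIV. P a b' c)"
  define M3 where "M3 = (\<lambda>(a::'s1) (b::'s2) c. \<Sum>a'\<in>UNIV. \<Sum>b'\<in>UNIV. P a' b' c)"
  define D1 where "D1 = (\<lambda>q (x::'x1) z y. out1 W (px1 q) z y)"
  define D2 where "D2 = (\<lambda>q x (z::'x2) y. out2 W (px2 q) x y)"
  define D3 where "D3 = (\<lambda>q (x::'x1) (z::'x2) y. out3 W (px1 q) (px2 q) y)"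
  note nn = source_nonneg[OF P_pmf] channel_nonneg[OF W] input_nonneg[OF W valid]
  note thr = source_channel_threshold[where \<beta> = \<beta> and c = c, folded Pm_def Wn_def Jn_def, folded bad_def, folded S_def]
  have "\<exists>K. \<forall>m n t. 0 < m \<longrightarrow> real n = \<beta> * real m \<longrightarrow> t = 2 powr (real m * c / 2) \<longrightarrow>
      S m n (bad m n t M1 D1) \<le> K / real m"
    by (rule thr)
       (use c gap(1) source_marg_pos[OF P_pmf] out_pos[OF W, of "px1 _" "px2 _"] nn
        in \<open>auto simp: M1_def D1_def H1_def I1_def\<close>)
  then obtain K1 where K1: "\<And>m n t. 0 < m \<Longrightarrow> real n = \<beta> * real m \<Longrightarrow> t = 2 powr (real m * c / 2) \<Longrightarrow>
      S m n (bad m n t M1 D1) \<le> K1 / real m" by blast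
  have "\<exists>K. \<forall>m n t. 0 < m \<longrightarrow> real n = \<beta> * real m \<longrightarrow> t = 2 powr (real m * c / 2) \<longrightarrow>
      S m n (bad m n t M2 D2) \<le> K / real m"
    by (rule thr)
       (use c gap(2) source_marg_pos[OF P_pmf] out_pos[OF W, of "px1 _" "px2 _"] nn
        in \<open>auto simp: M2_def D2_def H2_def I2_def\<close>)
  then obtain K2 where K2: "\<And>m n t. 0 < m \<Longrightarrow> real n = \<beta> * real m \<Longrightarrow> t = 2 powr (real m * c / 2) \<Longrightarrow>
      S m n (bad m n t M2 D2) \<le> K2 / real m" by blast
  have "\<exists>K. \<forall>m n t. 0 < m \<longrightarrow> real n = \<beta> * real m \<longrightarrow> t = 2 powr (real m * c / 2) \<longrightarrow>
      S m n (bad m n t M3 D3) \<le> K / real m"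
    by (rule thr)
       (use c gap(3) source_marg_pos[OF P_pmf] out_pos[OF W, of "px1 _" "px2 _"] nn
        in \<open>auto simp: M3_def D3_def H3_def I3_def\<close>)
  then obtain K3 where K3: "\<And>m n t. 0 < m \<Longrightarrow> real n = \<beta> * real m \<Longrightarrow> t = 2 powr (real m * c / 2) \<Longrightarrow>
      S m n (bad m n t M3 D3) \<le> K3 / real m" by blast

  have "\<exists>f1 f2 g. (\<forall>s. length s = m \<longrightarrow> length (f1 s) = n) \<and> (\<forall>s. length s = m \<longrightarrow> length (f2 s) = n) \<and>
        err_prob P W m n f1 f2 g \<le> (K1 + K2 + K3 + 6 / (c * ln 2)) / real m"
    if m: "0 < m" and n: "real n = \<beta> * real m" for m n
  proof -
    define t where "t = 2 powr (real m * c / 2)"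
    have t0: "0 < t" by (simp add: t_def)
    define p1 where "p1 q x = (\<Prod>j<n. px1 (q ! j) (x ! j))" for q x
    define p2 where "p2 q z = (\<Prod>j<n. px2 (q ! j) (z ! j))" for q z
    define B where "B a b c q x z y \<longleftrightarrow> bad m n t M1 D1 a b c q x z y \<or> bad m n t M2 D2 a b c q x z y
        \<or> bad m n t M3 D3 a b c q x z y" for a b c q x z y
    have nnp: "0 \<le> Pm m a b c" "0 \<le> Wn n x z y" "0 \<le> p1 q x" "0 \<le> p2 q z" "0 \<le> Jn n q x z y"
      "0 \<le> (\<Prod>j<n. pq (q ! j))" for a b c q x z y
      by (auto simp: Pm_def Wn_def Jn_def p1_def p2_def nn intro!: prod_nonneg)
    \<comment> \<open>Marginals of product laws are products of marginals. This identifies rejection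
      in \<open>one_shot_coding\<close>, where block marginals occur, with the letterwise event
      \<open>B\<close>.\<close>
    have M: "(\<Sum>a'\<in>seqs UNIV m. Pm m a' b c) = (\<Prod>i<m. M1 (a ! i) (b ! i) (c ! i))"
      "(\<Sum>b'\<in>seqs UNIV m. Pm m a b' c) = (\<Prod>i<m. M2 (a ! i) (b ! i) (c ! i))"
      "(\<Sum>a'\<in>seqs UNIV m. \<Sum>b'\<in>seqs UNIV m. Pm m a' b' c) = (\<Prod>i<m. M3 (a ! i) (b ! i) (c ! i))" for a b c
      unfolding Pm_def M1_def M2_def M3_def
      using sum_seqs_prod[of "\<lambda>i a. P a (b ! i) (c ! i)" m UNIV] sum_seqs_prod[of "\<lambda>i b. P (a ! i) b (c ! i)" m UNIV]
        sum_seqs_prod[of "\<lambda>i b. P (_ ! i) b (c ! i)" m UNIV] sum_seqs_prod[of "\<lambda>i a. \<Sum>b\<in>UNIV. P a b (c ! i)" m UNIV]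
      by simp_all
    have D: "(\<Sum>x'\<in>seqs UNIV n. p1 q x' * Wn n x' z y) = (\<Prod>j<n. D1 (q ! j) (x ! j) (z ! j) (y ! j))"
      "(\<Sum>z'\<in>seqs UNIV n. p2 q z' * Wn n x z' y) = (\<Prod>j<n. D2 (q ! j) (x ! j) (z ! j) (y ! j))"
      "(\<Sum>x'\<in>seqs UNIV n. \<Sum>z'\<in>seqs UNIV n. p1 q x' * (p2 q z' * Wn n x' z' y)) = (\<Prod>j<n. D3 (q ! j) (x ! j) (z ! j) (y ! j))"
      for q x z y
      unfolding p1_def p2_def Wn_def D1_def D2_def D3_def out1_def out2_def out3_def prod.distrib[symmetric]
      using sum_seqs_prod[of "\<lambda>j x. px1 (q ! j) x * W x (z ! j) (y ! j)" n UNIV]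
        sum_seqs_prod[of "\<lambda>j z. px2 (q ! j) z * W (x ! j) z (y ! j)" n UNIV]
        sum_seqs_prod[of "\<lambda>j z. px1 (q ! j) (_ ! j) * (px2 (q ! j) z * W (_ ! j) z (y ! j))" n UNIV]
        sum_seqs_prod[of "\<lambda>j x. \<Sum>z\<in>UNIV. px1 (q ! j) x * (px2 (q ! j) z * W x z (y ! j))" n UNIV]
      by simp_all
    define G where "G q = (\<Sum>a\<in>seqs UNIV m. \<Sum>b\<in>seqs UNIV m. \<Sum>c\<in>seqs UNIV m. Pm m a b c *
        (\<Sum>y\<in>seqs UNIV n. \<Sum>x\<in>seqs UNIV n. \<Sum>z\<in>seqs UNIV n.
          p1 q x * (p2 q z * (Wn n x z y * of_bool (B a b c q x z y)))))" for q
    have "(\<Sum>q\<in>seqs {..<4} n. (\<Prod>j<n. pq (q ! j)) * G q) = S m n B"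
    proof -
      have J: "(\<Prod>j<n. pq (q ! j)) * (r * (p1 q x * (p2 q z * (Wn n x z y * s)))) = r * (Jn n q x z y * s)"
        for q x z y r s by (simp add: p1_def p2_def Wn_def Jn_def prod.distrib mult_ac)
      have "(\<Sum>q\<in>seqs {..<4} n. (\<Prod>j<n. pq (q ! j)) * G q)
          = (\<Sum>q\<in>seqs {..<4} n. \<Sum>a\<in>seqs UNIV m. \<Sum>b\<in>seqs UNIV m. \<Sum>c\<in>seqs UNIV m.
              \<Sum>y\<in>seqs UNIV n. \<Sum>x\<in>seqs UNIV n. \<Sum>z\<in>seqs UNIV n. Pm m a b c * (Jn n q x z y * of_bool (B a b c q x z y)))"
        unfolding G_def sum_distrib_left J ..
      also have "\<dots> = (\<Sum>a\<in>seqs UNIV m. \<Sum>b\<in>seqs UNIV m. \<Sum>c\<in>seqs UNIV m. \<Sum>q\<in>seqs {..<4} n.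
              \<Sum>y\<in>seqs UNIV n. \<Sum>x\<in>seqs UNIV n. \<Sum>z\<in>seqs UNIV n. Pm m a b c * (Jn n q x z y * of_bool (B a b c q x z y)))"
        apply (rule trans[OF sum.swap], rule sum.cong[OF refl])
        apply (rule trans[OF sum.swap], rule sum.cong[OF refl])
        apply (rule sum.swap)
        done
      also have "\<dots> = S m n B"
        unfolding S_def
        apply (intro sum.cong refl)
        apply (rule trans[OF sum.swap], rule sum.cong[OF refl])
        apply (rule sum.swap)
        done
      finally show ?thesis .
    qed
    also have "S m n B \<le> S m n (bad m n t M1 D1) + S m n (bad m n t M2 D2) + S m n (bad m n t M3 D3)"
      unfolding S_def sum.distrib[symmetric] distrib_left[symmetric]
      by (intro sum_mono mult_left_mono nnp) (auto simp: B_def)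
    also have "\<dots> \<le> (K1 + K2 + K3) / real m"
      using K1[OF m n t_def] K2[OF m n t_def] K3[OF m n t_def] by (simp add: add_divide_distrib)
    finally have avg: "(\<Sum>q\<in>seqs {..<4} n. (\<Prod>j<n. pq (q ! j)) * G q) \<le> (K1 + K2 + K3) / real m" .
    \<comment> \<open>The time-sharing sequence is fixed before any codebook is drawn; given it, the
      letters of a codeword are independent with laws \<open>px1 (q ! j)\<close> or
      \<open>px2 (q ! j)\<close>.\<close>
    have "\<exists>q\<in>seqs {..<4} n. G q \<le> (K1 + K2 + K3) / real m"
      by (rule exists_le_average[OF _ _ _ avg])
         (auto simp: finite_seqs nnp sum_seqs_weight input_sum[OF W valid])
    then obtain q where q: "G q \<le> (K1 + K2 + K3) / real m" by blast
    have norm: "(\<Sum>a\<in>seqs UNIV m. \<Sum>b\<in>seqs UNIV m. \<Sum>c\<in>seqs UNIV m. Pm m a b c) = 1"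
    proof -
      have "(\<Sum>a\<in>seqs UNIV m. \<Sum>b\<in>seqs UNIV m. \<Sum>c\<in>seqs UNIV m. Pm m a b c)
          = (\<Sum>u\<in>seqs UNIV m. \<Prod>i<m. (\<lambda>(a, b, c). P a b c) (u ! i))"
        unfolding sum_source_seqs Pm_def by (intro sum.cong refl) (simp add: seqs_def case_prod_unfold)
      then show ?thesis using sum_seqs_weight[OF is_pmf_sum[OF P_pmf]] by simp
    qed
    have Wsum: "(\<Sum>y\<in>seqs UNIV n. Wn n x z y) = 1" for x z
      unfolding Wn_def by (subst sum_seqs_prod[of "\<lambda>j. W (x ! j) (z ! j)"]) (simp add: channel_sum[OF W])
    have psum: "(\<Sum>x\<in>seqs UNIV n. p1 q x) = 1" "(\<Sum>x\<in>seqs UNIV n. p2 q x) = 1"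
      unfolding p1_def p2_def sum_seqs_prod[of "\<lambda>j. px1 (q ! j)"] sum_seqs_prod[of "\<lambda>j. px2 (q ! j)"]
      by (simp_all add: input_sum[OF W valid])
    have B: "(\<not> (t * ((\<Sum>a'\<in>seqs UNIV m. Pm m a' b c) * (\<Sum>x'\<in>seqs UNIV n. p1 q x' * Wn n x' z y)) < Pm m a b c * Wn n x z y
       \<and> t * ((\<Sum>b'\<in>seqs UNIV m. Pm m a b' c) * (\<Sum>z'\<in>seqs UNIV n. p2 q z' * Wn n x z' y)) < Pm m a b c * Wn n x z y
       \<and> t * ((\<Sum>a'\<in>seqs UNIV m. \<Sum>b'\<in>seqs UNIV m. Pm m a' b' c)
            * (\<Sum>x'\<in>seqs UNIV n. \<Sum>z'\<in>seqs UNIV n. p1 q x' * (p2 q z' * Wn n x' z' y))) < Pm m a b c * Wn n x z y))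
      \<longleftrightarrow> B a b c q x z y" for a b c x z y
      unfolding M(1)[of b c a] M(2)[of a c b] M(3)[of c a b] D(1)[of q z y x] D(2)[of q x y z] D(3)[of q y x z]
        B_def bad_def by linarith
    have "\<exists>f1\<in>PiE (seqs UNIV m) (\<lambda>_. seqs UNIV n). \<exists>f2\<in>PiE (seqs UNIV m) (\<lambda>_. seqs UNIV n). \<exists>g.
      (\<Sum>a\<in>seqs UNIV m. \<Sum>b\<in>seqs UNIV m. \<Sum>c\<in>seqs UNIV m. \<Sum>y\<in>seqs UNIV n.
        Pm m a b c * (Wn n (f1 a) (f2 b) y * of_bool (g y c \<noteq> (a, b)))) \<le> G q + 3 / t"
      using one_shot_coding[where PS = "Pm m" and V = "Wn n" and ?p1.0 = "p1 q" and ?p2.0 = "p2 q" and t = t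
          and A = "seqs UNIV m" and B = "seqs UNIV m" and C = "seqs UNIV m" and X = "seqs UNIV n"
          and Z = "seqs UNIV n" and Y = "seqs UNIV n", OF _ _ _ _ _ _ nnp(1) norm nnp(2) Wsum nnp(3) psum(1) nnp(4) psum(2) t0]
      unfolding B G_def[symmetric] by (simp only: finite_seqs finite)
    then obtain f1 f2 g where f: "f1 \<in> PiE (seqs UNIV m) (\<lambda>_. seqs UNIV n)" "f2 \<in> PiE (seqs UNIV m) (\<lambda>_. seqs UNIV n)"
      and e: "(\<Sum>a\<in>seqs UNIV m. \<Sum>b\<in>seqs UNIV m. \<Sum>c\<in>seqs UNIV m. \<Sum>y\<in>seqs UNIV n.
        Pm m a b c * (Wn n (f1 a) (f2 b) y * of_bool (g y c \<noteq> (a, b)))) \<le> G q + 3 / t" by blast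
    have "err_prob P W m n f1 f2 g \<le> G q + 3 / t"
      using e unfolding err_prob_def seqs_UNIV Pm_def Wn_def by (simp add: of_bool_def mult.assoc)
    also have "\<dots> \<le> (K1 + K2 + K3) / real m + 6 / (c * ln 2) / real m"
    proof (rule add_mono[OF q])
      have x0: "0 < real m * c / 2 * ln 2" using m c by simp
      have two: "(2::real) \<noteq> 0" by simp
      \<comment> \<open>The inequality 1 + x \<le> exp x gives t at least linear growth in m, which
        puts the exponentially small 3 / t under the rate 1 / m of the Chebyshev term.\<close>
      have "real m * c / 2 * ln 2 \<le> t"
        using exp_ge_add_one_self[of "real m * c / 2 * ln 2"] unfolding t_def powr_def if_not_P[OF two] by linarith
      then have "3 / t \<le> 3 / (real m * c / 2 * ln 2)" using x0 t0 by (intro divide_left_mono) auto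
      then show "3 / t \<le> 6 / (c * ln 2) / real m" by (simp add: mult_ac)
    qed
    finally have "err_prob P W m n f1 f2 g \<le> (K1 + K2 + K3 + 6 / (c * ln 2)) / real m"
      by (simp add: add_divide_distrib)
    moreover have "\<forall>s. length s = m \<longrightarrow> length (f1 s) = n" "\<forall>s. length s = m \<longrightarrow> length (f2 s) = n"
      using f by (auto simp: seqs_def PiE_def Pi_def)
    ultimately show ?thesis by blast
  qed
  then show ?thesis by blast
qed

text \<open>\<open>achievable\<close> demands n / m = \<beta> exactly. Writing the rational \<beta>
  as k / l allows this for arbitrarily long blocks, with m and n the same multiple of l and
  k.\<close>

lemma achievable_if_strict:
  assumes \<beta>: "\<beta> \<in> \<rat>" and strict: "rate_conditions (<) P W \<beta> pq px1 px2"
  shows "achievable P W \<beta>"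
proof -
  define c where "c = Min {\<beta> * (\<Sum>q<4. pq q * I1 W (px1 q) (px2 q)) - H1 P,
    \<beta> * (\<Sum>q<4. pq q * I2 W (px1 q) (px2 q)) - H2 P, \<beta> * (\<Sum>q<4. pq q * I3 W (px1 q) (px2 q)) - H3 P}"
  have c: "0 < c" using strict unfolding rate_conditions_iff[OF W valid P_pmf] by (simp add: c_def)
  have gap: "H1 P + c \<le> \<beta> * (\<Sum>q<4. pq q * I1 W (px1 q) (px2 q))"
      "H2 P + c \<le> \<beta> * (\<Sum>q<4. pq q * I2 W (px1 q) (px2 q))"
      "H3 P + c \<le> \<beta> * (\<Sum>q<4. pq q * I3 W (px1 q) (px2 q))"
    by (auto simp: c_def min_def)
  have pos: "0 < \<beta>"
  proof (rule ccontr)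
    assume "\<not> 0 < \<beta>"
    moreover have "0 \<le> (\<Sum>q<4. pq q * I1 W (px1 q) (px2 q))"
      using valid by (intro sum_nonneg mult_nonneg_nonneg input_nonneg[OF W valid] I1_nonneg[OF W])
        (auto simp: valid_input_dist_def)
    ultimately have "\<beta> * (\<Sum>q<4. pq q * I1 W (px1 q) (px2 q)) \<le> 0"
      by (simp add: mult_nonpos_nonneg)
    then show False using gap(1) c H1_nonneg[OF P_pmf] by linarith
  qed
  obtain k l :: nat where kl: "0 < k" "0 < l" "\<beta> = real k / real l"
  proof -
    obtain k l :: nat where "l \<noteq> 0" "\<bar>\<beta>\<bar> = real k / real l"
      using Rats_abs_nat_div_natE[OF \<beta>] by metis
    then show ?thesis using pos by (intro that[of k l]) (auto simp: zero_less_divide_iff)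
  qed
  obtain C where C: "\<And>m n. 0 < m \<Longrightarrow> real n = \<beta> * real m \<Longrightarrow>
     (\<exists>f1 f2 g. (\<forall>s. length s = m \<longrightarrow> length (f1 s) = n) \<and> (\<forall>s. length s = m \<longrightarrow> length (f2 s) = n) \<and>
        err_prob P W m n f1 f2 g \<le> C / real m)"
    using block_code[OF c gap] by blast
  show ?thesis
    unfolding achievable_def
  proof (intro allI impI)
    fix \<epsilon> :: real assume \<epsilon>: "0 < \<epsilon>"
    obtain N :: nat where N: "C / \<epsilon> < real N" using reals_Archimedean2 by blast
    define m where "m = l * Suc N"
    define n where "n = k * Suc N"
    have m: "0 < m" "0 < n" "real n = \<beta> * real m" using kl by (simp_all add: m_def n_def del: of_nat_Suc mult_Suc_right)
    have "real N \<le> real m" using kl(2) unfolding m_def by (cases l) auto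
    with N have "C / \<epsilon> < real m" by linarith
    then have "C / real m < \<epsilon>" using \<epsilon> m by (simp add: field_simps)
    moreover obtain f1 f2 g where f: "\<forall>s. length s = m \<longrightarrow> length (f1 s) = n" "\<forall>s. length s = m \<longrightarrow> length (f2 s) = n"
        and "err_prob P W m n f1 f2 g \<le> C / real m"
      using C[OF m(1,3)] by blast
    ultimately have e: "err_prob P W m n f1 f2 g < \<epsilon>" by linarith
    have "real n / real m = \<beta>" using m by simp
    then show "\<exists>m n. 0 < m \<and> 0 < n \<and> real n / real m = \<beta> \<and>
        (\<exists>f1 f2 g. (\<forall>s. length s = m \<longrightarrow> length (f1 s) = n) \<and> (\<forall>s. length s = m \<longrightarrow> length (f2 s) = n) \<and>
           err_prob P W m n f1 f2 g < \<epsilon>)"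
      using m(1,2) f e by blast
  qed
qed

end

subsection \<open>Converse\<close>

text \<open>\<open>R\<close> may have mass below 1: the decoder may answer with sequences of a wrong
  length, and that part of the guess is lost.\<close>

lemma gibbs_inequality:
  fixes T R :: "'a \<Rightarrow> real"
  assumes T0: "\<And>a. a \<in> A \<Longrightarrow> 0 \<le> T a" and R0: "\<And>a. a \<in> A \<Longrightarrow> 0 \<le> R a"
    and T1: "(\<Sum>a\<in>A. T a) = 1" and R1: "(\<Sum>a\<in>A. R a) \<le> 1"
    and pos: "\<And>a. a \<in> A \<Longrightarrow> 0 < T a \<Longrightarrow> 0 < R a"
  shows "0 \<le> (\<Sum>a\<in>A. T a * log 2 (T a / R a))"
proof -
  have "0 \<le> (\<Sum>a\<in>A. (T a - R a) / ln 2)"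
    using T1 R1 by (simp add: sum_divide_distrib[symmetric] sum_subtractf)
  also have "\<dots> \<le> (\<Sum>a\<in>A. T a * log 2 (T a / R a))"
    by (intro sum_mono log_ratio_ge T0 R0 pos)
  finally show ?thesis .
qed

lemma card_seqs: "card (seqs (UNIV :: 'a::finite set) k) = CARD('a) ^ k"
  unfolding seqs_def by (rule card_lists_length_eq) simp

text \<open>\<open>G\<close> singles out at most one point, which receives at most 1 - \<epsilon>;
  the uniform part adds at most \<epsilon> because \<open>N\<close> bounds the number of
  points.\<close>

lemma mixed_guess_sum:
  fixes G :: "'a \<Rightarrow> bool"
  assumes "finite A" "real (card A) \<le> N" "0 < N" "0 < \<epsilon>" "\<epsilon> < 1" and uniq: "\<And>a b. G a \<Longrightarrow> G b \<Longrightarrow> a = b"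
  shows "(\<Sum>a\<in>A. (1 - \<epsilon>) * of_bool (G a) + \<epsilon> / N) \<le> 1"
proof -
  have "(\<Sum>a\<in>A. of_bool (G a) :: real) = real (card {a \<in> A. G a})"
    using assms(1) by (simp add: of_bool_def sum.inter_filter[symmetric])
  also have "\<dots> \<le> 1"
  proof -
    have "card {a \<in> A. G a} \<le> Suc 0" using uniq by (subst card_le_Suc0_iff_eq) (auto simp: assms(1))
    then show ?thesis by simp
  qed
  finally have "(1 - \<epsilon>) * (\<Sum>a\<in>A. of_bool (G a)) \<le> (1 - \<epsilon>) * 1"
    using assms by (intro mult_left_mono) auto
  moreover have "real (card A) * (\<epsilon> / N) \<le> \<epsilon>"
    using assms by (simp add: field_simps mult_right_mono)
  ultimately show ?thesis by (simp add: sum.distrib sum_distrib_left[symmetric])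
qed

lemma CARD_ge_1: "1 \<le> real CARD('a::finite)"
proof -
  have "1 \<le> CARD('a)" by (simp add: Suc_leI)
  then show ?thesis by simp
qed

text \<open>A correct joint guess makes each component correct, and one user has fewer sequences
  than there are pairs. Hence the guess of a single source dominates the guess of the pair, and
  \<open>converse_core\<close> can ask for one lower bound in all three cases.\<close>

lemma guess_le:
  assumes "0 < \<epsilon>" "\<epsilon> < 1" "0 < N" "N \<le> N'" "G \<Longrightarrow> G'"
  shows "(1 - \<epsilon>) * of_bool G + \<epsilon> / N' \<le> (1 - \<epsilon>) * of_bool G' + \<epsilon> / (N :: real)"
  using assms by (intro add_mono mult_left_mono divide_left_mono) auto

section \<open>Block laws of a fixed code and the input laws of each channel use\<close>

context
  fixes P :: "'s1::finite \<Rightarrow> 's2::finite \<Rightarrow> 'w::finite \<Rightarrow> real"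
    and W :: "'x1::finite \<Rightarrow> 'x2::finite \<Rightarrow> 'y::finite \<Rightarrow> real"
    and m n :: nat
    and f1 :: "'s1 list \<Rightarrow> 'x1 list" and f2 :: "'s2 list \<Rightarrow> 'x2 list"
    and g :: "'y list \<Rightarrow> 'w list \<Rightarrow> 's1 list \<times> 's2 list"
  assumes P_pmf: "is_pmf (\<lambda>(s1, s2, w). P s1 s2 w)"
    and W: "is_channel W"
    and indep: "\<forall>s1 s2. (\<Sum>w\<in>UNIV. P s1 s2 w) =
                   (\<Sum>s2'\<in>UNIV. \<Sum>w\<in>UNIV. P s1 s2' w) * (\<Sum>s1'\<in>UNIV. \<Sum>w\<in>UNIV. P s1' s2 w)"
begin

definition src :: "'s1 list \<Rightarrow> 's2 list \<Rightarrow> 'w list \<Rightarrow> real" where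
  "src a b c = (\<Prod>i<m. P (a ! i) (b ! i) (c ! i))"

definition chan :: "'x1 list \<Rightarrow> 'x2 list \<Rightarrow> 'y list \<Rightarrow> real" where
  "chan x z y = (\<Prod>j<n. W (x ! j) (z ! j) (y ! j))"

definition src1 :: "'s1 list \<Rightarrow> real" where
  "src1 a = (\<Prod>i<m. \<Sum>s2\<in>UNIV. \<Sum>w\<in>UNIV. P (a ! i) s2 w)"

definition src2 :: "'s2 list \<Rightarrow> real" where
  "src2 b = (\<Prod>i<m. \<Sum>s1\<in>UNIV. \<Sum>w\<in>UNIV. P s1 (b ! i) w)"

text \<open>Laws of the inputs that the two encoders feed into the j-th channel use.\<close>

definition letter1 :: "nat \<Rightarrow> 'x1 \<Rightarrow> real" where
  "letter1 j x = (\<Sum>a\<in>seqs UNIV m. src1 a * of_bool (f1 a ! j = x))"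

definition letter2 :: "nat \<Rightarrow> 'x2 \<Rightarrow> real" where
  "letter2 j x = (\<Sum>b\<in>seqs UNIV m. src2 b * of_bool (f2 b ! j = x))"

lemma src_nonneg: "0 \<le> src a b c" "0 \<le> src1 a" "0 \<le> src2 b"
  by (auto simp: src_def src1_def src2_def source_nonneg[OF P_pmf] intro!: prod_nonneg sum_nonneg)

lemma chan_nonneg: "0 \<le> chan x z y"
  by (auto simp: chan_def channel_nonneg[OF W] intro!: prod_nonneg)

lemma src_sum: "(\<Sum>a\<in>seqs UNIV m. \<Sum>b\<in>seqs UNIV m. \<Sum>c\<in>seqs UNIV m. src a b c) = 1"
proof -
  have "(\<Sum>a\<in>seqs UNIV m. \<Sum>b\<in>seqs UNIV m. \<Sum>c\<in>seqs UNIV m. src a b c)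
      = (\<Sum>u\<in>seqs UNIV m. \<Prod>i<m. (\<lambda>(a, b, c). P a b c) (u ! i))"
    unfolding sum_source_seqs src_def by (intro sum.cong refl) (simp add: seqs_def case_prod_unfold)
  then show ?thesis using sum_seqs_weight[OF is_pmf_sum[OF P_pmf]] by simp
qed

lemma chan_sum: "(\<Sum>y\<in>seqs UNIV n. chan x z y) = 1"
  unfolding chan_def by (subst sum_seqs_prod[of "\<lambda>j. W (x ! j) (z ! j)"]) (simp add: channel_sum[OF W])

text \<open>Independence of the sources enters here; it passes through the separate encoders to
  their input letters.\<close>

lemma src_factor: "(\<Sum>c\<in>seqs UNIV m. src a b c) = src1 a * src2 b"
  unfolding src_def src1_def src2_def prod.distrib[symmetric]
  by (subst sum_seqs_prod[of "\<lambda>i c. P (a ! i) (b ! i) c"]) (intro prod.cong refl indep[rule_format])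

lemma src12_sum: "(\<Sum>a\<in>seqs UNIV m. src1 a) = 1" "(\<Sum>b\<in>seqs UNIV m. src2 b) = 1"
proof -
  have "(\<Sum>s1\<in>UNIV. \<Sum>s2\<in>UNIV. \<Sum>w\<in>UNIV. P s1 s2 w) = 1"
    by (rule source_sum[OF P_pmf])
  moreover from this have "(\<Sum>s2\<in>UNIV. \<Sum>s1\<in>UNIV. \<Sum>w\<in>UNIV. P s1 s2 w) = 1"
    by (subst sum.swap)
  ultimately show "(\<Sum>a\<in>seqs UNIV m. src1 a) = 1" "(\<Sum>b\<in>seqs UNIV m. src2 b) = 1"
    unfolding src1_def src2_def
    by (simp_all add: sum_seqs_prod[of "\<lambda>i a. \<Sum>s2\<in>UNIV. \<Sum>w\<in>UNIV. P a s2 w"]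
        sum_seqs_prod[of "\<lambda>i b. \<Sum>s1\<in>UNIV. \<Sum>w\<in>UNIV. P s1 b w"])
qed

lemma letter_pmf: "is_pmf (letter1 j)" "is_pmf (letter2 j)"
proof -
  have "(\<Sum>x\<in>UNIV. letter1 j x) = 1"
    unfolding letter1_def by (subst sum.swap) (simp add: sum_distrib_left[symmetric] of_bool_def src12_sum)
  moreover have "(\<Sum>x\<in>UNIV. letter2 j x) = 1"
    unfolding letter2_def by (subst sum.swap) (simp add: sum_distrib_left[symmetric] of_bool_def src12_sum)
  ultimately show "is_pmf (letter1 j)" "is_pmf (letter2 j)"
    by (auto simp: is_pmf_def letter1_def letter2_def src_nonneg intro!: sum_nonneg)
qed

text \<open>A source block of positive probability gives mass to its own input letters. Gibbs'
  inequality needs this to see that the reference law is positive on the support of the true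
  law.\<close>

lemma letter_pos:
  assumes abc: "a \<in> seqs UNIV m" "b \<in> seqs UNIV m" "c \<in> seqs UNIV m" and pos: "0 < src a b c"
  shows "0 < letter1 j (f1 a ! j)" "0 < letter2 j (f2 b ! j)"
proof -
  have "src a b c \<le> (\<Sum>c\<in>seqs UNIV m. src a b c)"
    using abc by (intro member_le_sum) (auto simp: finite_seqs src_nonneg)
  then have "0 < src1 a * src2 b" using pos by (simp add: src_factor)
  then have p: "0 < src1 a" "0 < src2 b"
    using src_nonneg(2)[of a] src_nonneg(3)[of b] by (auto simp: zero_less_mult_iff)
  show "0 < letter1 j (f1 a ! j)" unfolding letter1_def
    using abc p by (intro sum_pos2[of _ a]) (auto simp: finite_seqs src_nonneg)
  show "0 < letter2 j (f2 b ! j)" unfolding letter2_def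
    using abc p by (intro sum_pos2[of _ b]) (auto simp: finite_seqs src_nonneg)
qed

lemma source_expect_sum:
  fixes \<phi> :: "'s1 \<Rightarrow> 's2 \<Rightarrow> 'w \<Rightarrow> real"
  shows "(\<Sum>a\<in>seqs UNIV m. \<Sum>b\<in>seqs UNIV m. \<Sum>c\<in>seqs UNIV m. src a b c * (\<Sum>i<m. \<phi> (a ! i) (b ! i) (c ! i)))
       = real m * (\<Sum>s1\<in>UNIV. \<Sum>s2\<in>UNIV. \<Sum>w\<in>UNIV. P s1 s2 w * \<phi> s1 s2 w)"
proof -
  let ?P = "\<lambda>(a, b, c). P a b c" and ?\<phi> = "\<lambda>(a, b, c). \<phi> a b c"
  have "(\<Sum>a\<in>seqs UNIV m. \<Sum>b\<in>seqs UNIV m. \<Sum>c\<in>seqs UNIV m. src a b c * (\<Sum>i<m. \<phi> (a ! i) (b ! i) (c ! i)))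
      = (\<Sum>u\<in>seqs UNIV m. (\<Prod>i<m. ?P (u ! i)) * (\<Sum>i<m. ?\<phi> (u ! i)))"
    unfolding sum_source_seqs src_def by (intro sum.cong refl) (simp add: seqs_def case_prod_unfold)
  also have "\<dots> = (\<Sum>i<m. \<Sum>u\<in>seqs UNIV m. (\<Prod>i<m. ?P (u ! i)) * ?\<phi> (u ! i))"
    unfolding sum_distrib_left by (rule sum.swap)
  also have "\<dots> = (\<Sum>i<m. \<Sum>u\<in>UNIV. ?P u * ?\<phi> u)"
    by (intro sum.cong refl seqs_expect_nth[where v = "\<lambda>_. ?P"]) (auto simp: is_pmf_sum[OF P_pmf])
  finally show ?thesis by (simp add: sum_UNIV_Times)
qed

text \<open>Single-letterization as an equality. By memorylessness the j-th term depends only on the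
  j-th inputs, and these follow the product of \<open>letter1 j\<close> and
  \<open>letter2 j\<close>, since the encoders act on independent sources.\<close>

lemma channel_expect_sum:
  fixes D :: "nat \<Rightarrow> 'x1 \<Rightarrow> 'x2 \<Rightarrow> 'y \<Rightarrow> real"
  shows "(\<Sum>a\<in>seqs UNIV m. \<Sum>b\<in>seqs UNIV m. \<Sum>c\<in>seqs UNIV m. \<Sum>y\<in>seqs UNIV n.
          src a b c * (chan (f1 a) (f2 b) y *
            (\<Sum>j<n. log 2 (W (f1 a ! j) (f2 b ! j) (y ! j) / D j (f1 a ! j) (f2 b ! j) (y ! j)))))
       = (\<Sum>j<n. info_sum W (letter1 j) (letter2 j) (D j))"
proof -
  define F where "F j x z = (\<Sum>y\<in>UNIV. W x z y * log 2 (W x z y / D j x z y))" for j x z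
  have y: "(\<Sum>y\<in>seqs UNIV n. chan x z y * (\<Sum>j<n. log 2 (W (x ! j) (z ! j) (y ! j) / D j (x ! j) (z ! j) (y ! j))))
      = (\<Sum>j<n. F j (x ! j) (z ! j))" for x z
  proof -
    have "(\<Sum>y\<in>seqs UNIV n. chan x z y * (\<Sum>j<n. log 2 (W (x ! j) (z ! j) (y ! j) / D j (x ! j) (z ! j) (y ! j))))
        = (\<Sum>j<n. \<Sum>y\<in>seqs UNIV n. chan x z y * log 2 (W (x ! j) (z ! j) (y ! j) / D j (x ! j) (z ! j) (y ! j)))"
      unfolding sum_distrib_left by (rule sum.swap)
    also have "\<dots> = (\<Sum>j<n. F j (x ! j) (z ! j))"
      unfolding F_def chan_def
      by (intro sum.cong refl seqs_expect_nth[where v = "\<lambda>j. W (x ! j) (z ! j)"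
            and \<phi> = "\<lambda>y. log 2 (W (x ! _) (z ! _) y / D _ (x ! _) (z ! _) y)"])
         (auto simp: channel_sum[OF W])
    finally show ?thesis .
  qed
  have letter: "(\<Sum>a\<in>seqs UNIV m. \<Sum>b\<in>seqs UNIV m. src1 a * (src2 b * H (f1 a ! j) (f2 b ! j)))
      = (\<Sum>x\<in>UNIV. \<Sum>z\<in>UNIV. letter1 j x * (letter2 j z * H x z))" for H :: "'x1 \<Rightarrow> 'x2 \<Rightarrow> real" and j
  proof -
    have l2: "(\<Sum>b\<in>seqs UNIV m. src2 b * h (f2 b ! j)) = (\<Sum>z\<in>UNIV. letter2 j z * h z)" for h
      unfolding letter2_def sum_distrib_right
      by (subst sum.swap) (simp add: of_bool_def if_distrib[of "\<lambda>x. _ * x"] if_distrib[of "\<lambda>x. x * _"] cong: if_cong)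
    have l1: "(\<Sum>a\<in>seqs UNIV m. src1 a * h (f1 a ! j)) = (\<Sum>z\<in>UNIV. letter1 j z * h z)" for h
      unfolding letter1_def sum_distrib_right
      by (subst sum.swap) (simp add: of_bool_def if_distrib[of "\<lambda>x. _ * x"] if_distrib[of "\<lambda>x. x * _"] cong: if_cong)
    show ?thesis unfolding sum_distrib_left[symmetric] l2 l1[of "\<lambda>x. \<Sum>z\<in>UNIV. letter2 j z * H x z"] ..
  qed
  have "(\<Sum>a\<in>seqs UNIV m. \<Sum>b\<in>seqs UNIV m. \<Sum>c\<in>seqs UNIV m. \<Sum>y\<in>seqs UNIV n.
          src a b c * (chan (f1 a) (f2 b) y *
            (\<Sum>j<n. log 2 (W (f1 a ! j) (f2 b ! j) (y ! j) / D j (f1 a ! j) (f2 b ! j) (y ! j)))))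
      = (\<Sum>a\<in>seqs UNIV m. \<Sum>b\<in>seqs UNIV m. \<Sum>j<n. src1 a * (src2 b * F j (f1 a ! j) (f2 b ! j)))"
    unfolding sum_distrib_left[of "src _ _ _", symmetric] y sum_distrib_right[symmetric] src_factor
    by (simp add: sum_distrib_left mult.assoc)
  also have "\<dots> = (\<Sum>j<n. \<Sum>a\<in>seqs UNIV m. \<Sum>b\<in>seqs UNIV m. src1 a * (src2 b * F j (f1 a ! j) (f2 b ! j)))"
    by (rule trans[OF sum.cong[OF refl sum.swap] sum.swap])
  also have "\<dots> = (\<Sum>j<n. \<Sum>x\<in>UNIV. \<Sum>z\<in>UNIV. letter1 j x * (letter2 j z * F j x z))"
    by (intro sum.cong refl letter)
  also have "\<dots> = (\<Sum>j<n. info_sum W (letter1 j) (letter2 j) (D j))"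
    unfolding info_sum_def F_def by (simp add: sum_distrib_left)
  finally show ?thesis .
qed

text \<open>The expected log ratio of the true law to the reference law splits into minus m source
  entropies, the sum of n letter informations, and the expectation of -log r. Its nonnegativity is
  the claim once -log r is bounded by a Fano term.\<close>

lemma converse_core:
  fixes M :: "'s1 \<Rightarrow> 's2 \<Rightarrow> 'w \<Rightarrow> real" and D :: "nat \<Rightarrow> 'x1 \<Rightarrow> 'x2 \<Rightarrow> 'y \<Rightarrow> real" and r
  assumes M0: "\<And>a b c. 0 \<le> M a b c" and Mpos: "\<And>a b c. 0 < P a b c \<Longrightarrow> 0 < M a b c"
    and D0: "\<And>j x z y. 0 \<le> D j x z y"
    and Dpos: "\<And>j x z y. 0 < letter1 j x \<Longrightarrow> 0 < letter2 j z \<Longrightarrow> 0 < W x z y \<Longrightarrow> 0 < D j x z y"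
    and \<epsilon>: "0 < \<epsilon>" "\<epsilon> < 1"
    and r: "\<And>a b c y. a \<in> seqs UNIV m \<Longrightarrow> b \<in> seqs UNIV m \<Longrightarrow>
        (1 - \<epsilon>) * of_bool (g y c = (a, b)) + \<epsilon> / real (CARD('s1) * CARD('s2)) ^ m \<le> r a b c y"
    and R: "(\<Sum>a\<in>seqs UNIV m. \<Sum>b\<in>seqs UNIV m. \<Sum>c\<in>seqs UNIV m. \<Sum>y\<in>seqs UNIV n.
        (\<Prod>i<m. M (a ! i) (b ! i) (c ! i)) * ((\<Prod>j<n. D j (f1 a ! j) (f2 b ! j) (y ! j)) * r a b c y)) \<le> 1"
  shows "real m * (\<Sum>a\<in>UNIV. \<Sum>b\<in>UNIV. \<Sum>c\<in>UNIV. P a b c * log 2 (M a b c / P a b c))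
    \<le> (\<Sum>j<n. info_sum W (letter1 j) (letter2 j) (D j)) - log 2 (1 - \<epsilon>)
      + (real m * log 2 (real (CARD('s1) * CARD('s2))) - log 2 \<epsilon>) * err_prob P W m n f1 f2 g"
proof -
  define N where "N = real (CARD('s1) * CARD('s2)) ^ m"
  have CC: "1 \<le> real (CARD('s1) * CARD('s2))"
    by (metis One_nat_def Suc_leI nat_0_less_mult_iff of_nat_1 of_nat_le_iff zero_less_card_finite)
  have N: "1 \<le> N" unfolding N_def using CC by (rule one_le_power)
  have logN: "log 2 N = real m * log 2 (real (CARD('s1) * CARD('s2)))"
    unfolding N_def using CC by (subst log_nat_power) auto
  \<comment> \<open>\<open>L0\<close> is the price of a correct decision, \<open>L1\<close> the
    additional price of an error, where only the uniform part of the guess is left.\<close>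
  define L0 where "L0 = - log 2 (1 - \<epsilon>)"
  define L1 where "L1 = log 2 N - log 2 \<epsilon>"
  have L0: "0 \<le> L0" unfolding L0_def using \<epsilon> by simp
  have rpos: "0 < r a b c y" if "a \<in> seqs UNIV m" "b \<in> seqs UNIV m" for a b c y
  proof -
    have "0 < \<epsilon> / N" using \<epsilon> N by simp
    also have "\<dots> \<le> (1 - \<epsilon>) * of_bool (g y c = (a, b)) + \<epsilon> / N" using \<epsilon> by simp
    finally show ?thesis using r[OF that, of y c] by (simp add: N_def)
  qed
  have logr: "- log 2 (r a b c y) \<le> L0 + L1 * of_bool (g y c \<noteq> (a, b))"
    if ab: "a \<in> seqs UNIV m" "b \<in> seqs UNIV m" for a b c y
  proof (cases "g y c = (a, b)")
    case True
    have "1 - \<epsilon> \<le> 1 - \<epsilon> + \<epsilon> / N" using \<epsilon> N by simp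
    also have "\<dots> \<le> r a b c y" using r[OF ab, of y c] True by (simp add: N_def)
    finally have "log 2 (1 - \<epsilon>) \<le> log 2 (r a b c y)" using \<epsilon> by simp
    then show ?thesis using True by (simp add: L0_def)
  next
    case False
    have "\<epsilon> / N \<le> r a b c y" using r[OF ab, of y c] False by (simp add: N_def)
    then have "log 2 (\<epsilon> / N) \<le> log 2 (r a b c y)" using \<epsilon> N rpos[OF ab] by simp
    moreover have "log 2 (\<epsilon> / N) = - L1" using \<epsilon> N by (simp add: L1_def log_divide)
    ultimately show ?thesis using False L0 by simp
  qed
  let ?S = "seqs UNIV m" and ?Y = "seqs UNIV n"
  define \<Omega> where "\<Omega> = (?S :: 's1 list set) \<times> (?S :: 's2 list set) \<times> (?S :: 'w list set) \<times> (?Y :: 'y list set)"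
  have \<Omega>: "(\<Sum>\<omega>\<in>\<Omega>. case \<omega> of (a, b, c, y) \<Rightarrow> F a b c y) = (\<Sum>a\<in>?S. \<Sum>b\<in>?S. \<Sum>c\<in>?S. \<Sum>y\<in>?Y. F a b c y)" for F :: "_ \<Rightarrow> _ \<Rightarrow> _ \<Rightarrow> _ \<Rightarrow> real"
    by (simp add: \<Omega>_def sum.cartesian_product case_prod_unfold)
  define T where "T a b c y = src a b c * chan (f1 a) (f2 b) y" for a b c y
  define Q where "Q a b c y = (\<Prod>i<m. M (a ! i) (b ! i) (c ! i)) * ((\<Prod>j<n. D j (f1 a ! j) (f2 b ! j) (y ! j)) * r a b c y)" for a b c y
  have T0: "0 \<le> T a b c y" for a b c y by (simp add: T_def src_nonneg chan_nonneg)
  have Q0: "0 \<le> Q a b c y" if "a \<in> ?S" "b \<in> ?S" for a b c y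
    using rpos[OF that, of c y] by (auto simp: Q_def intro!: mult_nonneg_nonneg prod_nonneg M0 D0)
  have T1: "(\<Sum>a\<in>?S. \<Sum>b\<in>?S. \<Sum>c\<in>?S. \<Sum>y\<in>?Y. T a b c y) = 1"
    by (simp add: T_def sum_distrib_left[symmetric] chan_sum src_sum)
  \<comment> \<open>Positivity of \<open>T\<close> forces every single factor to be positive, so all
    logarithms of products may be split.\<close>
  have split: "0 < Q a b c y \<and> log 2 (T a b c y / Q a b c y)
      = - (\<Sum>i<m. log 2 (M (a ! i) (b ! i) (c ! i) / P (a ! i) (b ! i) (c ! i)))
        + (\<Sum>j<n. log 2 (W (f1 a ! j) (f2 b ! j) (y ! j) / D j (f1 a ! j) (f2 b ! j) (y ! j))) - log 2 (r a b c y)"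
    if abc: "a \<in> ?S" "b \<in> ?S" "c \<in> ?S" and T: "0 < T a b c y" for a b c y
  proof -
    have s: "0 < src a b c" "0 < chan (f1 a) (f2 b) y"
      using T src_nonneg(1)[of a b c] chan_nonneg[of "f1 a" "f2 b" y]
      by (auto simp: T_def zero_less_mult_iff)
    have p: "0 < P (a ! i) (b ! i) (c ! i)" if "i < m" for i
      using s(1) that source_nonneg[OF P_pmf, of "a ! i" "b ! i" "c ! i"] by (force simp: src_def less_le)
    have w: "0 < W (f1 a ! j) (f2 b ! j) (y ! j)" if "j < n" for j
      using s(2) that channel_nonneg[OF W, of "f1 a ! j" "f2 b ! j" "y ! j"] by (force simp: chan_def less_le)
    have d: "0 < D j (f1 a ! j) (f2 b ! j) (y ! j)" if "j < n" for j
      by (intro Dpos letter_pos[OF abc s(1)] w that)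
    note mp = Mpos[OF p]
    have pr: "0 < (\<Prod>i<m. M (a ! i) (b ! i) (c ! i))" "0 < (\<Prod>j<n. D j (f1 a ! j) (f2 b ! j) (y ! j))"
      using mp d by (auto intro!: prod_pos)
    have q: "0 < Q a b c y" using pr rpos[OF abc(1,2)] by (simp add: Q_def)
    have "log 2 (T a b c y / Q a b c y) = log 2 (src a b c) + log 2 (chan (f1 a) (f2 b) y)
        - (log 2 (\<Prod>i<m. M (a ! i) (b ! i) (c ! i)) + (log 2 (\<Prod>j<n. D j (f1 a ! j) (f2 b ! j) (y ! j)) + log 2 (r a b c y)))"
      unfolding log_divide_pos[OF T q] using s pr rpos[OF abc(1,2)] by (simp add: T_def Q_def log_mult_pos)
    also have "\<dots> = - (\<Sum>i<m. log 2 (M (a ! i) (b ! i) (c ! i) / P (a ! i) (b ! i) (c ! i)))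
        + (\<Sum>j<n. log 2 (W (f1 a ! j) (f2 b ! j) (y ! j) / D j (f1 a ! j) (f2 b ! j) (y ! j))) - log 2 (r a b c y)"
    proof -
      have "(\<Sum>i<m. log 2 (M (a ! i) (b ! i) (c ! i) / P (a ! i) (b ! i) (c ! i)))
          = log 2 (\<Prod>i<m. M (a ! i) (b ! i) (c ! i)) - log 2 (src a b c)"
        using p mp unfolding src_def by (simp add: sum_log_eq_log_prod[symmetric] log_divide_pos sum_subtractf)
      moreover have "(\<Sum>j<n. log 2 (W (f1 a ! j) (f2 b ! j) (y ! j) / D j (f1 a ! j) (f2 b ! j) (y ! j)))
          = log 2 (chan (f1 a) (f2 b) y) - log 2 (\<Prod>j<n. D j (f1 a ! j) (f2 b ! j) (y ! j))"
        using w d unfolding chan_def by (simp add: sum_log_eq_log_prod[symmetric] log_divide_pos sum_subtractf)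
      ultimately show ?thesis by simp
    qed
    finally show ?thesis using q by simp
  qed
  have "0 \<le> (\<Sum>\<omega>\<in>\<Omega>. (case \<omega> of (a, b, c, y) \<Rightarrow> T a b c y) *
      log 2 ((case \<omega> of (a, b, c, y) \<Rightarrow> T a b c y) / (case \<omega> of (a, b, c, y) \<Rightarrow> Q a b c y)))"
  proof (rule gibbs_inequality)
    show "(\<Sum>\<omega>\<in>\<Omega>. case \<omega> of (a, b, c, y) \<Rightarrow> T a b c y) = 1" unfolding \<Omega> by (rule T1)
    show "(\<Sum>\<omega>\<in>\<Omega>. case \<omega> of (a, b, c, y) \<Rightarrow> Q a b c y) \<le> 1" unfolding \<Omega> Q_def by (rule R)
    fix \<omega> assume "\<omega> \<in> \<Omega>"
    then obtain a b c y where \<omega>: "\<omega> = (a, b, c, y)" and abc: "a \<in> ?S" "b \<in> ?S" "c \<in> ?S"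
      unfolding \<Omega>_def by blast
    show "0 \<le> (case \<omega> of (a, b, c, y) \<Rightarrow> T a b c y)" unfolding \<omega> prod.case by (rule T0)
    show "0 \<le> (case \<omega> of (a, b, c, y) \<Rightarrow> Q a b c y)" unfolding \<omega> prod.case by (rule Q0[OF abc(1,2)])
    show "0 < (case \<omega> of (a, b, c, y) \<Rightarrow> Q a b c y)" if "0 < (case \<omega> of (a, b, c, y) \<Rightarrow> T a b c y)"
      using split[OF abc, of y] that unfolding \<omega> prod.case by blast
  qed
  also have "\<dots> = (\<Sum>\<omega>\<in>\<Omega>. case \<omega> of (a, b, c, y) \<Rightarrow> T a b c y * log 2 (T a b c y / Q a b c y))"
    by (intro sum.cong refl) (simp only: split_beta)
  also have "\<dots> = (\<Sum>a\<in>?S. \<Sum>b\<in>?S. \<Sum>c\<in>?S. \<Sum>y\<in>?Y. T a b c y * log 2 (T a b c y / Q a b c y))"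
    by (rule \<Omega>)
  also have "\<dots> \<le> (\<Sum>a\<in>?S. \<Sum>b\<in>?S. \<Sum>c\<in>?S. \<Sum>y\<in>?Y. T a b c y *
      (- (\<Sum>i<m. log 2 (M (a ! i) (b ! i) (c ! i) / P (a ! i) (b ! i) (c ! i)))
        + (\<Sum>j<n. log 2 (W (f1 a ! j) (f2 b ! j) (y ! j) / D j (f1 a ! j) (f2 b ! j) (y ! j)))
        + (L0 + L1 * of_bool (g y c \<noteq> (a, b)))))"
  proof (intro sum_mono)
    fix a :: "'s1 list" and b :: "'s2 list" and c :: "'w list" and y assume abc: "a \<in> ?S" "b \<in> ?S" "c \<in> ?S"
    show "T a b c y * log 2 (T a b c y / Q a b c y) \<le> T a b c y *
      (- (\<Sum>i<m. log 2 (M (a ! i) (b ! i) (c ! i) / P (a ! i) (b ! i) (c ! i)))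
        + (\<Sum>j<n. log 2 (W (f1 a ! j) (f2 b ! j) (y ! j) / D j (f1 a ! j) (f2 b ! j) (y ! j)))
        + (L0 + L1 * of_bool (g y c \<noteq> (a, b))))"
    proof (cases "T a b c y = 0")
      case False
      then have "0 < T a b c y" using T0[of a b c y] by simp
      from split[OF abc this] show ?thesis
        using logr[OF abc(1,2), of c y] T0 by (intro mult_left_mono) auto
    qed simp
  qed
  also have "\<dots> = - (\<Sum>a\<in>?S. \<Sum>b\<in>?S. \<Sum>c\<in>?S. src a b c * (\<Sum>i<m. log 2 (M (a ! i) (b ! i) (c ! i) / P (a ! i) (b ! i) (c ! i))))
      + (\<Sum>a\<in>?S. \<Sum>b\<in>?S. \<Sum>c\<in>?S. \<Sum>y\<in>?Y. src a b c * (chan (f1 a) (f2 b) y *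
            (\<Sum>j<n. log 2 (W (f1 a ! j) (f2 b ! j) (y ! j) / D j (f1 a ! j) (f2 b ! j) (y ! j)))))
      + (L0 + L1 * err_prob P W m n f1 f2 g)"
  proof -
    have t1: "(\<Sum>a\<in>?S. \<Sum>b\<in>?S. \<Sum>c\<in>?S. \<Sum>y\<in>?Y. T a b c y * - K a b c)
        = - (\<Sum>a\<in>?S. \<Sum>b\<in>?S. \<Sum>c\<in>?S. src a b c * K a b c)" for K
    proof -
      have "(\<Sum>y\<in>?Y. T a b c y * - K a b c) = - (src a b c * K a b c)" for a b c
        unfolding T_def sum_distrib_right[symmetric] sum_distrib_left[symmetric] chan_sum by simp
      then show ?thesis by (simp add: sum_negf)
    qed
    have t2: "(\<Sum>a\<in>?S. \<Sum>b\<in>?S. \<Sum>c\<in>?S. \<Sum>y\<in>?Y. T a b c y * L0) = L0"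
      unfolding sum_distrib_right[symmetric] T1 by simp
    have "err_prob P W m n f1 f2 g = (\<Sum>a\<in>?S. \<Sum>b\<in>?S. \<Sum>c\<in>?S. \<Sum>y\<in>?Y. T a b c y * of_bool (g y c \<noteq> (a, b)))"
      unfolding err_prob_def seqs_UNIV T_def src_def chan_def by (simp add: of_bool_def)
    then have t3: "(\<Sum>a\<in>?S. \<Sum>b\<in>?S. \<Sum>c\<in>?S. \<Sum>y\<in>?Y. T a b c y * (L1 * of_bool (g y c \<noteq> (a, b))))
        = L1 * err_prob P W m n f1 f2 g"
      by (simp add: sum_distrib_left mult_ac)
    show ?thesis
      unfolding distrib_left sum.distrib t1 t2 t3 by (simp add: T_def mult.assoc)
  qed
  also have "\<dots> = - (real m * (\<Sum>a\<in>UNIV. \<Sum>b\<in>UNIV. \<Sum>c\<in>UNIV. P a b c * log 2 (M a b c / P a b c)))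
      + (\<Sum>j<n. info_sum W (letter1 j) (letter2 j) (D j)) + (L0 + L1 * err_prob P W m n f1 f2 g)"
    unfolding channel_expect_sum source_expect_sum[of "\<lambda>a b c. log 2 (M a b c / P a b c)"] ..
  finally show ?thesis by (simp add: L0_def L1_def logN)
qed

context
  fixes \<epsilon> :: real
  assumes \<epsilon>: "0 < \<epsilon>" "\<epsilon> < 1"
begin

text \<open>The Fano term of a whole block. For error probability at most \<epsilon> it is at most m
  times \<open>fano_slack\<close>, which does not depend on the block lengths.\<close>

definition slack :: real where
  "slack = (real m * log 2 (real (CARD('s1) * CARD('s2))) - log 2 \<epsilon>) * err_prob P W m n f1 f2 g - log 2 (1 - \<epsilon>)"

text \<open>The reference law keeps the true law \<open>A\<close> of the conditioning pair, uses the
  output law \<open>B\<close> that a memoryless input of laws \<open>letter1 j\<close> would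
  produce, and guesses the first source by \<open>r\<close>. Its mass is checked by summing over the
  first source, then the output, then the pair.\<close>

lemma converse_H1: "real m * H1 P \<le> (\<Sum>j<n. I1 W (letter1 j) (letter2 j)) + slack"
proof -
  let ?S = "seqs UNIV m" and ?Y = "seqs UNIV n"
  define r where "r a c y = (1 - \<epsilon>) * of_bool (fst (g y c) = a) + \<epsilon> / real CARD('s1) ^ m" for a c y
  define A where "A b c = (\<Prod>i<m. \<Sum>a'\<in>UNIV. P a' (b ! i) (c ! i))" for b c
  define B where "B b y = (\<Prod>j<n. out1 W (letter1 j) (f2 b ! j) (y ! j))" for b y
  note nn = out_nonneg[OF W letter_pmf(1) letter_pmf(2)]
  have A0: "0 \<le> A b c" and B0: "0 \<le> B b y" for b c y
    by (auto simp: A_def B_def source_nonneg[OF P_pmf] nn intro!: prod_nonneg sum_nonneg)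
  have A: "(\<Sum>a\<in>?S. src a b c) = A b c" for b c
    unfolding A_def src_def by (rule sum_seqs_prod)
  have A1: "(\<Sum>b\<in>?S. \<Sum>c\<in>?S. A b c) = 1"
    unfolding A[symmetric] src_sum[symmetric]
    by (rule trans[OF sum.cong[OF refl sum.swap] sum.swap])
  have B1: "(\<Sum>y\<in>?Y. B b y) = 1" for b
    unfolding B_def by (subst sum_seqs_prod[of "\<lambda>j. out1 W (letter1 j) (f2 b ! j)"])
      (simp add: out_sum[OF W letter_pmf(1) letter_pmf(2)])
  have r1: "(\<Sum>a\<in>?S. r a c y) \<le> 1" for c y
    unfolding r_def using \<epsilon> by (intro mixed_guess_sum) (auto simp: finite_seqs card_seqs)
  have "(\<Sum>a\<in>?S. \<Sum>b\<in>?S. \<Sum>c\<in>?S. \<Sum>y\<in>?Y. A b c * (B b y * r a c y))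
      = (\<Sum>b\<in>?S. \<Sum>c\<in>?S. \<Sum>y\<in>?Y. \<Sum>a\<in>?S. A b c * (B b y * r a c y))"
    apply (rule trans[OF sum.swap], rule sum.cong[OF refl])
    apply (rule trans[OF sum.swap], rule sum.cong[OF refl])
    apply (rule sum.swap)
    done
  also have "\<dots> \<le> (\<Sum>b\<in>?S. \<Sum>c\<in>?S. \<Sum>y\<in>?Y. A b c * (B b y * 1))"
    unfolding sum_distrib_left[symmetric] by (intro sum_mono mult_left_mono A0 B0 r1)
  also have "\<dots> = 1" by (simp add: sum_distrib_left[symmetric] A1 B1)
  finally have R: "(\<Sum>a\<in>?S. \<Sum>b\<in>?S. \<Sum>c\<in>?S. \<Sum>y\<in>?Y. A b c * (B b y * r a c y)) \<le> 1" .
  have "real m * (\<Sum>a\<in>UNIV. \<Sum>b\<in>UNIV. \<Sum>c\<in>UNIV. P a b c * log 2 ((\<Sum>a'\<in>UNIV. P a' b c) / P a b c))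
    \<le> (\<Sum>j<n. info_sum W (letter1 j) (letter2 j) (\<lambda>x z y. out1 W (letter1 j) z y)) - log 2 (1 - \<epsilon>)
      + (real m * log 2 (real (CARD('s1) * CARD('s2))) - log 2 \<epsilon>) * err_prob P W m n f1 f2 g"
  proof (rule converse_core[where r = "\<lambda>a b c y. r a c y"])
    show "(1 - \<epsilon>) * of_bool (g y c = (a, b)) + \<epsilon> / real (CARD('s1) * CARD('s2)) ^ m \<le> r a c y" for a b c y
      unfolding r_def of_nat_mult
      by (rule guess_le) (use \<epsilon> CARD_ge_1[where 'a = 's2] in \<open>auto intro!: power_mono\<close>)
    show "(\<Sum>a\<in>?S. \<Sum>b\<in>?S. \<Sum>c\<in>?S. \<Sum>y\<in>?Y. (\<Prod>i<m. \<Sum>a'\<in>UNIV. P a' (b ! i) (c ! i)) *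
        ((\<Prod>j<n. out1 W (letter1 j) (f2 b ! j) (y ! j)) * r a c y)) \<le> 1"
      using R unfolding A_def B_def .
    show "0 < out1 W (letter1 j) z y" if "0 < letter1 j x" "0 < letter2 j z" "0 < W x z y" for j x z y
      using out_pos(1)[OF W, of "letter1 j" "letter2 j" x z y] that is_pmf_nonneg letter_pmf by metis
  qed (use \<epsilon> source_marg_pos[OF P_pmf] nn source_nonneg[OF P_pmf] in \<open>auto intro!: sum_nonneg\<close>)
  then show ?thesis by (simp add: H1_def I1_def slack_def)
qed

lemma converse_H2: "real m * H2 P \<le> (\<Sum>j<n. I2 W (letter1 j) (letter2 j)) + slack"
proof -
  let ?S = "seqs UNIV m" and ?Y = "seqs UNIV n"
  define r where "r b c y = (1 - \<epsilon>) * of_bool (snd (g y c) = b) + \<epsilon> / real CARD('s2) ^ m" for b c y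
  define A where "A a c = (\<Prod>i<m. \<Sum>b'\<in>UNIV. P (a ! i) b' (c ! i))" for a c
  define B where "B a y = (\<Prod>j<n. out2 W (letter2 j) (f1 a ! j) (y ! j))" for a y
  note nn = out_nonneg[OF W letter_pmf(1) letter_pmf(2)]
  have A0: "0 \<le> A a c" and B0: "0 \<le> B a y" for a c y
    by (auto simp: A_def B_def source_nonneg[OF P_pmf] nn intro!: prod_nonneg sum_nonneg)
  have A: "(\<Sum>b\<in>?S. src a b c) = A a c" for a c
    unfolding A_def src_def by (rule sum_seqs_prod)
  have A1: "(\<Sum>a\<in>?S. \<Sum>c\<in>?S. A a c) = 1"
    unfolding A[symmetric] src_sum[symmetric] by (intro sum.cong refl sum.swap)
  have B1: "(\<Sum>y\<in>?Y. B a y) = 1" for a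
    unfolding B_def by (subst sum_seqs_prod[of "\<lambda>j. out2 W (letter2 j) (f1 a ! j)"])
      (simp add: out_sum[OF W letter_pmf(1) letter_pmf(2)])
  have r1: "(\<Sum>b\<in>?S. r b c y) \<le> 1" for c y
    unfolding r_def using \<epsilon> by (intro mixed_guess_sum) (auto simp: finite_seqs card_seqs)
  have "(\<Sum>a\<in>?S. \<Sum>b\<in>?S. \<Sum>c\<in>?S. \<Sum>y\<in>?Y. A a c * (B a y * r b c y))
      = (\<Sum>a\<in>?S. \<Sum>c\<in>?S. \<Sum>y\<in>?Y. \<Sum>b\<in>?S. A a c * (B a y * r b c y))"
    apply (rule sum.cong[OF refl])
    apply (rule trans[OF sum.swap], rule sum.cong[OF refl])
    apply (rule sum.swap)
    done
  also have "\<dots> \<le> (\<Sum>a\<in>?S. \<Sum>c\<in>?S. \<Sum>y\<in>?Y. A a c * (B a y * 1))"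
    unfolding sum_distrib_left[symmetric] by (intro sum_mono mult_left_mono A0 B0 r1)
  also have "\<dots> = 1" by (simp add: sum_distrib_left[symmetric] A1 B1)
  finally have R: "(\<Sum>a\<in>?S. \<Sum>b\<in>?S. \<Sum>c\<in>?S. \<Sum>y\<in>?Y. A a c * (B a y * r b c y)) \<le> 1" .
  have "real m * (\<Sum>a\<in>UNIV. \<Sum>b\<in>UNIV. \<Sum>c\<in>UNIV. P a b c * log 2 ((\<Sum>b'\<in>UNIV. P a b' c) / P a b c))
    \<le> (\<Sum>j<n. info_sum W (letter1 j) (letter2 j) (\<lambda>x z y. out2 W (letter2 j) x y)) - log 2 (1 - \<epsilon>)
      + (real m * log 2 (real (CARD('s1) * CARD('s2))) - log 2 \<epsilon>) * err_prob P W m n f1 f2 g"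
  proof (rule converse_core[where r = "\<lambda>a b c y. r b c y"])
    show "(1 - \<epsilon>) * of_bool (g y c = (a, b)) + \<epsilon> / real (CARD('s1) * CARD('s2)) ^ m \<le> r b c y" for a b c y
      unfolding r_def of_nat_mult
      by (rule guess_le) (use \<epsilon> CARD_ge_1[where 'a = 's1] in \<open>auto intro!: power_mono\<close>)
    show "(\<Sum>a\<in>?S. \<Sum>b\<in>?S. \<Sum>c\<in>?S. \<Sum>y\<in>?Y. (\<Prod>i<m. \<Sum>b'\<in>UNIV. P (a ! i) b' (c ! i)) *
        ((\<Prod>j<n. out2 W (letter2 j) (f1 a ! j) (y ! j)) * r b c y)) \<le> 1"
      using R unfolding A_def B_def .
    show "0 < out2 W (letter2 j) x y" if "0 < letter1 j x" "0 < letter2 j z" "0 < W x z y" for j x z y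
      using out_pos(2)[OF W, of "letter1 j" "letter2 j" x z y] that is_pmf_nonneg letter_pmf by metis
  qed (use \<epsilon> source_marg_pos[OF P_pmf] nn source_nonneg[OF P_pmf] in \<open>auto intro!: sum_nonneg\<close>)
  then show ?thesis by (simp add: H2_def I2_def slack_def)
qed

text \<open>Only the side information is conditioned on and the guess concerns the pair itself, so
  \<open>r\<close> meets the bound of \<open>converse_core\<close> with equality, and its mass is
  counted over pairs of sequences.\<close>

lemma converse_H3: "real m * H3 P \<le> (\<Sum>j<n. I3 W (letter1 j) (letter2 j)) + slack"
proof -
  let ?S = "seqs UNIV m" and ?Y = "seqs UNIV n"
  define r where "r a b c y = (1 - \<epsilon>) * of_bool (g y c = (a, b)) + \<epsilon> / real (CARD('s1) * CARD('s2)) ^ m" for a b c y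
  define A where "A c = (\<Prod>i<m. \<Sum>a'\<in>UNIV. \<Sum>b'\<in>UNIV. P a' b' (c ! i))" for c
  define B where "B y = (\<Prod>j<n. out3 W (letter1 j) (letter2 j) (y ! j))" for y
  note nn = out_nonneg[OF W letter_pmf(1) letter_pmf(2)]
  have A0: "0 \<le> A c" and B0: "0 \<le> B y" for c y
    by (auto simp: A_def B_def source_nonneg[OF P_pmf] nn intro!: prod_nonneg sum_nonneg)
  have A: "(\<Sum>a\<in>?S. \<Sum>b\<in>?S. src a b c) = A c" for c
    unfolding A_def src_def sum_seqs_prod[of "\<lambda>i b. P (_ ! i) b (c ! i)"]
    by (rule sum_seqs_prod)
  have A1: "(\<Sum>c\<in>?S. A c) = 1"
    unfolding A[symmetric] src_sum[symmetric]
    by (rule trans[OF sum.swap], rule sum.cong[OF refl], rule sum.swap)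
  have B1: "(\<Sum>y\<in>?Y. B y) = 1"
    unfolding B_def by (subst sum_seqs_prod[of "\<lambda>j. out3 W (letter1 j) (letter2 j)"])
      (simp add: out_sum[OF W letter_pmf(1) letter_pmf(2)])
  have r1: "(\<Sum>a\<in>?S. \<Sum>b\<in>?S. r a b c y) \<le> 1" for c y
  proof -
    have "(\<Sum>z\<in>?S \<times> ?S. (1 - \<epsilon>) * of_bool (g y c = z) + \<epsilon> / real (CARD('s1) * CARD('s2)) ^ m) \<le> 1"
      using \<epsilon> by (intro mixed_guess_sum)
        (auto simp: finite_seqs card_seqs card_cartesian_product power_mult_distrib)
    then show ?thesis by (simp add: r_def sum.cartesian_product case_prod_unfold)
  qed
  have "(\<Sum>a\<in>?S. \<Sum>b\<in>?S. \<Sum>c\<in>?S. \<Sum>y\<in>?Y. A c * (B y * r a b c y))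
      = (\<Sum>a\<in>?S. \<Sum>c\<in>?S. \<Sum>y\<in>?Y. \<Sum>b\<in>?S. A c * (B y * r a b c y))"
    apply (rule sum.cong[OF refl])
    apply (rule trans[OF sum.swap], rule sum.cong[OF refl])
    apply (rule sum.swap)
    done
  also have "\<dots> = (\<Sum>c\<in>?S. \<Sum>y\<in>?Y. \<Sum>a\<in>?S. \<Sum>b\<in>?S. A c * (B y * r a b c y))"
    apply (rule trans[OF sum.swap], rule sum.cong[OF refl])
    apply (rule sum.swap)
    done
  also have "\<dots> \<le> (\<Sum>c\<in>?S. \<Sum>y\<in>?Y. A c * (B y * 1))"
    unfolding sum_distrib_left[symmetric] by (intro sum_mono mult_left_mono A0 B0 r1)
  also have "\<dots> = 1" by (simp add: sum_distrib_left[symmetric] A1 B1)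
  finally have R: "(\<Sum>a\<in>?S. \<Sum>b\<in>?S. \<Sum>c\<in>?S. \<Sum>y\<in>?Y. A c * (B y * r a b c y)) \<le> 1" .
  have "real m * (\<Sum>a\<in>UNIV. \<Sum>b\<in>UNIV. \<Sum>c\<in>UNIV. P a b c * log 2 ((\<Sum>a'\<in>UNIV. \<Sum>b'\<in>UNIV. P a' b' c) / P a b c))
    \<le> (\<Sum>j<n. info_sum W (letter1 j) (letter2 j) (\<lambda>x z y. out3 W (letter1 j) (letter2 j) y)) - log 2 (1 - \<epsilon>)
      + (real m * log 2 (real (CARD('s1) * CARD('s2))) - log 2 \<epsilon>) * err_prob P W m n f1 f2 g"
  proof (rule converse_core[where r = r])
    show "(1 - \<epsilon>) * of_bool (g y c = (a, b)) + \<epsilon> / real (CARD('s1) * CARD('s2)) ^ m \<le> r a b c y" for a b c y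
      unfolding r_def by (rule order_refl)
    show "(\<Sum>a\<in>?S. \<Sum>b\<in>?S. \<Sum>c\<in>?S. \<Sum>y\<in>?Y. (\<Prod>i<m. \<Sum>a'\<in>UNIV. \<Sum>b'\<in>UNIV. P a' b' (c ! i)) *
        ((\<Prod>j<n. out3 W (letter1 j) (letter2 j) (y ! j)) * r a b c y)) \<le> 1"
      using R unfolding A_def B_def .
    show "0 < out3 W (letter1 j) (letter2 j) y" if "0 < letter1 j x" "0 < letter2 j z" "0 < W x z y" for j x z y
      using out_pos(3)[OF W, of "letter1 j" "letter2 j" x z y] that is_pmf_nonneg letter_pmf by metis
  qed (use \<epsilon> source_marg_pos[OF P_pmf] nn source_nonneg[OF P_pmf] in \<open>auto intro!: sum_nonneg\<close>)
  then show ?thesis by (simp add: H3_def I3_def slack_def)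
qed

end

end

subsection \<open>The single-letter region and time sharing\<close>

text \<open>The triples attained with a constant time-sharing letter; averaging over the letter
  passes to the convex hull.\<close>

definition rate_region :: "('x1::finite \<Rightarrow> 'x2::finite \<Rightarrow> 'y::finite \<Rightarrow> real) \<Rightarrow> (real \<times> real \<times> real) set" where
  "rate_region W = {(I1 W p1 p2, I2 W p1 p2, I3 W p1 p2) | p1 p2. is_pmf p1 \<and> is_pmf p2}"

text \<open>The factor x tames the logarithm at 0, where the value 0 is the one-sided limit. This
  admits the boundary of the simplex, where output probabilities may vanish.\<close>

lemma continuous_on_mult_log: "continuous_on {0..} (\<lambda>x::real. x * log 2 x)"
proof -
  have "continuous (at x within {0..}) (\<lambda>x::real. x * log 2 x)" if "0 \<le> x" for x :: real
  proof (cases "x = 0")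
    case True
    have "((\<lambda>x::real. x * log 2 x) \<longlongrightarrow> 0) (at_right 0)"
      by real_asymp
    then have "((\<lambda>x::real. x * log 2 x) \<longlongrightarrow> 0) (at 0 within {0..})"
      by (simp add: at_within_Ici_at_right)
    then show ?thesis by (simp add: continuous_within True)
  next
    case False
    then show ?thesis using that by (intro continuous_intros) auto
  qed
  then show ?thesis by (simp add: continuous_on_eq_continuous_within)
qed

text \<open>Quotients by output laws are awkward where these vanish. Splitting the logarithm
  isolates a term polynomial in the input laws and confines \<open>D\<close> to the other
  one.\<close>

lemma info_sum_eq_entropy_diff:
  assumes W: "is_channel W" and p: "is_pmf p1" "is_pmf p2"
    and pos: "\<And>x1 x2 y. 0 < p1 x1 \<Longrightarrow> 0 < p2 x2 \<Longrightarrow> 0 < W x1 x2 y \<Longrightarrow> 0 < D x1 x2 y"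
  shows "info_sum W p1 p2 D =
      (\<Sum>x1\<in>UNIV. \<Sum>x2\<in>UNIV. \<Sum>y\<in>UNIV. p1 x1 * (p2 x2 * (W x1 x2 y * log 2 (W x1 x2 y))))
    - (\<Sum>x1\<in>UNIV. \<Sum>x2\<in>UNIV. \<Sum>y\<in>UNIV. p1 x1 * (p2 x2 * (W x1 x2 y * log 2 (D x1 x2 y))))"
  unfolding info_sum_def sum_subtractf[symmetric]
proof (intro sum.cong refl)
  fix x1 x2 y
  note nn = is_pmf_nonneg[OF p(1), of x1] is_pmf_nonneg[OF p(2), of x2] channel_nonneg[OF W, of x1 x2 y]
  show "p1 x1 * (p2 x2 * (W x1 x2 y * log 2 (W x1 x2 y / D x1 x2 y)))
      = p1 x1 * (p2 x2 * (W x1 x2 y * log 2 (W x1 x2 y))) - p1 x1 * (p2 x2 * (W x1 x2 y * log 2 (D x1 x2 y)))"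
  proof (cases "p1 x1 = 0 \<or> p2 x2 = 0 \<or> W x1 x2 y = 0")
    case False
    then have "0 < p1 x1" "0 < p2 x2" "0 < W x1 x2 y" using nn by auto
    then show ?thesis using pos[of x1 x2 y] by (simp add: log_divide_pos right_diff_distrib)
  qed auto
qed

text \<open>Averaging \<open>W\<close> over the inputs on which \<open>D\<close> does not depend
  recreates the output law in front of its own logarithm, so only terms x * log 2 x remain.\<close>

lemma I_eq_entropy_diff:
  assumes W: "is_channel W" and p: "is_pmf p1" "is_pmf p2"
  defines "E \<equiv> \<Sum>x1\<in>UNIV. \<Sum>x2\<in>UNIV. \<Sum>y\<in>UNIV. p1 x1 * (p2 x2 * (W x1 x2 y * log 2 (W x1 x2 y)))"
  shows "I1 W p1 p2 = E - (\<Sum>x2\<in>UNIV. \<Sum>y\<in>UNIV. p2 x2 * (out1 W p1 x2 y * log 2 (out1 W p1 x2 y)))"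
    and "I2 W p1 p2 = E - (\<Sum>x1\<in>UNIV. \<Sum>y\<in>UNIV. p1 x1 * (out2 W p2 x1 y * log 2 (out2 W p2 x1 y)))"
    and "I3 W p1 p2 = E - (\<Sum>y\<in>UNIV. out3 W p1 p2 y * log 2 (out3 W p1 p2 y))"
proof -
  note pos = out_pos[OF W is_pmf_nonneg[OF p(1)] is_pmf_nonneg[OF p(2)]]
  have "(\<Sum>x1\<in>UNIV. \<Sum>x2\<in>UNIV. \<Sum>y\<in>UNIV. p1 x1 * (p2 x2 * (W x1 x2 y * log 2 (out1 W p1 x2 y))))
      = (\<Sum>x2\<in>UNIV. \<Sum>y\<in>UNIV. \<Sum>x1\<in>UNIV. p1 x1 * (p2 x2 * (W x1 x2 y * log 2 (out1 W p1 x2 y))))"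
    by (rule trans[OF sum.swap], rule sum.cong[OF refl], rule sum.swap)
  also have "\<dots> = (\<Sum>x2\<in>UNIV. \<Sum>y\<in>UNIV. p2 x2 * (out1 W p1 x2 y * log 2 (out1 W p1 x2 y)))"
    by (subst (2) out1_def) (simp add: sum_distrib_left sum_distrib_right mult_ac)
  finally show "I1 W p1 p2 = E - (\<Sum>x2\<in>UNIV. \<Sum>y\<in>UNIV. p2 x2 * (out1 W p1 x2 y * log 2 (out1 W p1 x2 y)))"
    unfolding I1_def E_def by (subst info_sum_eq_entropy_diff[OF W p pos(1)]) simp_all
  have "(\<Sum>x1\<in>UNIV. \<Sum>x2\<in>UNIV. \<Sum>y\<in>UNIV. p1 x1 * (p2 x2 * (W x1 x2 y * log 2 (out2 W p2 x1 y))))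
      = (\<Sum>x1\<in>UNIV. \<Sum>y\<in>UNIV. \<Sum>x2\<in>UNIV. p1 x1 * (p2 x2 * (W x1 x2 y * log 2 (out2 W p2 x1 y))))"
    by (rule sum.cong[OF refl], rule sum.swap)
  also have "\<dots> = (\<Sum>x1\<in>UNIV. \<Sum>y\<in>UNIV. p1 x1 * (out2 W p2 x1 y * log 2 (out2 W p2 x1 y)))"
    by (subst (2) out2_def) (simp add: sum_distrib_left sum_distrib_right mult_ac)
  finally show "I2 W p1 p2 = E - (\<Sum>x1\<in>UNIV. \<Sum>y\<in>UNIV. p1 x1 * (out2 W p2 x1 y * log 2 (out2 W p2 x1 y)))"
    unfolding I2_def E_def by (subst info_sum_eq_entropy_diff[OF W p pos(2)]) simp_all
  have "(\<Sum>x1\<in>UNIV. \<Sum>x2\<in>UNIV. \<Sum>y\<in>UNIV. p1 x1 * (p2 x2 * (W x1 x2 y * log 2 (out3 W p1 p2 y))))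
      = (\<Sum>x1\<in>UNIV. \<Sum>y\<in>UNIV. \<Sum>x2\<in>UNIV. p1 x1 * (p2 x2 * (W x1 x2 y * log 2 (out3 W p1 p2 y))))"
    by (rule sum.cong[OF refl], rule sum.swap)
  also have "\<dots> = (\<Sum>y\<in>UNIV. \<Sum>x1\<in>UNIV. \<Sum>x2\<in>UNIV. p1 x1 * (p2 x2 * (W x1 x2 y * log 2 (out3 W p1 p2 y))))"
    by (rule sum.swap)
  also have "\<dots> = (\<Sum>y\<in>UNIV. out3 W p1 p2 y * log 2 (out3 W p1 p2 y))"
    by (subst (2) out3_def) (simp add: sum_distrib_left sum_distrib_right mult_ac)
  finally show "I3 W p1 p2 = E - (\<Sum>y\<in>UNIV. out3 W p1 p2 y * log 2 (out3 W p1 p2 y))"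
    unfolding I3_def E_def by (subst info_sum_eq_entropy_diff[OF W p pos(3)]) simp_all
qed

section \<open>Compactness of the region and reduction to four time-sharing letters\<close>

lemma compact_simplex: "compact {a :: real ^ 'n. is_pmf (($) a)}"
proof -
  have eq: "{a :: real ^ 'n. is_pmf (($) a)} = {a. \<forall>i. 0 \<le> a $ i} \<inter> {a. (\<Sum>i\<in>UNIV. a $ i) = 1}"
    by (auto simp: is_pmf_def)
  have "closed {a :: real ^ 'n. is_pmf (($) a)}"
    unfolding eq by (intro closed_Int closed_Collect_all closed_Collect_le closed_Collect_eq continuous_intros)
  moreover have "bounded {a :: real ^ 'n. is_pmf (($) a)}"
    unfolding bounded_iff
  proof (intro exI ballI)
    fix a :: "real ^ 'n" assume "a \<in> {a. is_pmf (($) a)}"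
    then have "(\<Sum>i\<in>UNIV. \<bar>a $ i\<bar>) = 1" by (simp add: is_pmf_def)
    then show "norm a \<le> 1" using norm_le_l1_cart[of a] by simp
  qed
  ultimately show ?thesis by (simp add: compact_eq_bounded_closed)
qed

lemma compact_rate_region:
  fixes W :: "'x1::finite \<Rightarrow> 'x2::finite \<Rightarrow> 'y::finite \<Rightarrow> real"
  assumes W: "is_channel W"
  shows "compact (rate_region W)"
proof -
  define K where "K = {a :: real ^ 'x1. is_pmf (($) a)} \<times> {a :: real ^ 'x2. is_pmf (($) a)}"
  define E where "E z = (\<Sum>x1\<in>UNIV. \<Sum>x2\<in>UNIV. \<Sum>y\<in>UNIV. fst z $ x1 * (snd z $ x2 * (W x1 x2 y * log 2 (W x1 x2 y))))"
    for z :: "(real ^ 'x1) \<times> (real ^ 'x2)"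
  define h1 where "h1 x2 y z = out1 W (($) (fst z)) x2 y" for x2 y and z :: "(real ^ 'x1) \<times> (real ^ 'x2)"
  define h2 where "h2 x1 y z = out2 W (($) (snd z)) x1 y" for x1 y and z :: "(real ^ 'x1) \<times> (real ^ 'x2)"
  define h3 where "h3 y z = out3 W (($) (fst z)) (($) (snd z)) y" for y and z :: "(real ^ 'x1) \<times> (real ^ 'x2)"
  define xlog where "xlog x = x * log 2 x" for x :: real
  define F where "F z = (E z - (\<Sum>x2\<in>UNIV. \<Sum>y\<in>UNIV. snd z $ x2 * xlog (h1 x2 y z)),
      E z - (\<Sum>x1\<in>UNIV. \<Sum>y\<in>UNIV. fst z $ x1 * xlog (h2 x1 y z)), E z - (\<Sum>y\<in>UNIV. xlog (h3 y z)))" for z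
  have xl: "continuous_on K (\<lambda>z. xlog (h z))"
    if "continuous_on K h" "\<And>z. z \<in> K \<Longrightarrow> 0 \<le> h z" for h
    unfolding xlog_def
    by (rule continuous_on_compose2[OF continuous_on_mult_log that(1)]) (use that(2) in force)
  have h1: "continuous_on K (\<lambda>z. xlog (h1 x2 y z))" for x2 y
    by (rule xl) (auto simp: h1_def K_def out_nonneg[OF W] out1_def is_pmf_nonneg channel_nonneg[OF W]
        intro!: continuous_intros sum_nonneg)
  have h2: "continuous_on K (\<lambda>z. xlog (h2 x1 y z))" for x1 y
    by (rule xl) (auto simp: h2_def K_def out_nonneg[OF W] out2_def is_pmf_nonneg channel_nonneg[OF W]
        intro!: continuous_intros sum_nonneg)
  have h3: "continuous_on K (\<lambda>z. xlog (h3 y z))" for y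
    by (rule xl) (auto simp: h3_def K_def out_nonneg[OF W] out3_def is_pmf_nonneg channel_nonneg[OF W]
        intro!: continuous_intros sum_nonneg)
  have "continuous_on K F"
    unfolding F_def E_def by (intro continuous_intros h1 h2 h3)
  moreover have "compact K" unfolding K_def by (intro compact_Times compact_simplex)
  ultimately have "compact (F ` K)" by (rule compact_continuous_image)
  moreover have "F ` K = rate_region W"
  proof -
    have F: "F (a, b) = (I1 W (($) a) (($) b), I2 W (($) a) (($) b), I3 W (($) a) (($) b))" if "(a, b) \<in> K" for a b
      using that by (simp add: F_def E_def h1_def h2_def h3_def xlog_def K_def I_eq_entropy_diff[OF W])
    show ?thesis
    proof (intro equalityI subsetI)
      fix v assume "v \<in> F ` K"
      then show "v \<in> rate_region W" using F by (fastforce simp: rate_region_def K_def)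
    next
      fix v assume "v \<in> rate_region W"
      then obtain p1 p2 where p: "is_pmf p1" "is_pmf p2" "v = (I1 W p1 p2, I2 W p1 p2, I3 W p1 p2)"
        by (auto simp: rate_region_def)
      have e: "($) (vec_lambda p1) = p1" "($) (vec_lambda p2) = p2" by auto
      have "(vec_lambda p1, vec_lambda p2) \<in> K" using p by (simp add: K_def e)
      then show "v \<in> F ` K" using F[of "vec_lambda p1" "vec_lambda p2"] p(3) unfolding e by (metis imageI)
    qed
  qed
  ultimately show ?thesis by simp
qed

text \<open>The weights of a convex combination become the law of the time-sharing letter, and the
  points become its input laws. The 4 is the dimension 3 of the triples plus 1, by
  Caratheodory.\<close>

lemma rate_region_time_sharing:
  fixes W :: "'x1::finite \<Rightarrow> 'x2::finite \<Rightarrow> 'y::finite \<Rightarrow> real"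
  assumes v: "(v1, v2, v3) \<in> convex hull (rate_region W)"
  shows "\<exists>pq px1 px2. valid_input_dist pq px1 px2 \<and>
      (\<Sum>q<4. pq q * I1 W (px1 q) (px2 q)) = v1 \<and>
      (\<Sum>q<4. pq q * I2 W (px1 q) (px2 q)) = v2 \<and>
      (\<Sum>q<4. pq q * I3 W (px1 q) (px2 q)) = v3"
proof -
  obtain S where S: "finite S" "S \<subseteq> rate_region W" "card S \<le> DIM(real \<times> real \<times> real) + 1"
    "(v1, v2, v3) \<in> convex hull S"
    using v unfolding caratheodory[of "rate_region W"] by blast
  have card4: "card S \<le> 4" using S(3) by simp
  obtain u where u: "\<And>x. x \<in> S \<Longrightarrow> 0 \<le> u x" "sum u S = 1" "(\<Sum>x\<in>S. u x *\<^sub>R x) = (v1, v2, v3)"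
    using S(4) unfolding convex_hull_finite[OF S(1)] by auto
  have "S \<noteq> {}" using u(2) by auto
  then obtain s0 where s0: "s0 \<in> S" by blast
  obtain h where h: "bij_betw h {..<card S} S"
    using ex_bij_betw_nat_finite[OF S(1)] by (auto simp: atLeast0LessThan)
  \<comment> \<open>Letters beyond \<open>card S\<close> get weight 0 but still need genuine input
    laws, since \<open>valid_input_dist\<close> asks for them at every natural number; any point of
    \<open>S\<close> serves.\<close>
  define k where "k q = (if q < card S then h q else s0)" for q
  have kS: "k q \<in> S" for q using h s0 by (auto simp: k_def bij_betw_def)
  have "\<forall>q. \<exists>p. is_pmf (fst p) \<and> is_pmf (snd p) \<and> k q = (I1 W (fst p) (snd p), I2 W (fst p) (snd p), I3 W (fst p) (snd p))"
    using kS S(2) by (fastforce simp: rate_region_def)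
  then obtain p where p: "\<And>q. is_pmf (fst (p q)) \<and> is_pmf (snd (p q)) \<and>
      k q = (I1 W (fst (p q)) (snd (p q)), I2 W (fst (p q)) (snd (p q)), I3 W (fst (p q)) (snd (p q)))"
    by metis
  define pq where "pq q = (if q < card S then u (h q) else 0)" for q
  have sumS: "(\<Sum>q<4. pq q * f (k q)) = (\<Sum>x\<in>S. u x * f x)" for f :: "_ \<Rightarrow> real"
  proof -
    have "(\<Sum>q<4. pq q * f (k q)) = (\<Sum>q<card S. u (h q) * f (h q))"
      using card4 by (intro sum.mono_neutral_cong_right) (auto simp: pq_def k_def)
    also have "\<dots> = (\<Sum>x\<in>S. u x * f x)"
      by (rule sum.reindex_bij_betw[OF h])
    finally show ?thesis .
  qed
  have "0 \<le> pq q" for q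
    using u(1)[of "h q"] h by (auto simp: pq_def bij_betw_def)
  then have "valid_input_dist pq (\<lambda>q. fst (p q)) (\<lambda>q. snd (p q))"
    unfolding valid_input_dist_def
    using sumS[of "\<lambda>_. 1"] u(2) p by simp
  moreover have "(\<Sum>x\<in>S. u x * fst x) = v1" "(\<Sum>x\<in>S. u x * fst (snd x)) = v2" "(\<Sum>x\<in>S. u x * snd (snd x)) = v3"
    using arg_cong[OF u(3), of fst] arg_cong[OF u(3), of "fst \<circ> snd"] arg_cong[OF u(3), of "snd \<circ> snd"]
    by (simp_all add: fst_sum snd_sum)
  then have "(\<Sum>q<4. pq q * I1 W (fst (p q)) (snd (p q))) = v1" "(\<Sum>q<4. pq q * I2 W (fst (p q)) (snd (p q))) = v2"
    "(\<Sum>q<4. pq q * I3 W (fst (p q)) (snd (p q))) = v3"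
    using sumS[of fst] sumS[of "\<lambda>x. fst (snd x)"] sumS[of "\<lambda>x. snd (snd x)"] p by simp_all
  ultimately show ?thesis by blast
qed

text \<open>The loss per source symbol in Fano's inequality, where \<open>k\<close> will be the
  number of source pairs.\<close>

definition fano_slack :: "real \<Rightarrow> real \<Rightarrow> real" where
  "fano_slack k \<epsilon> = \<epsilon> * log 2 k - \<epsilon> * log 2 \<epsilon> - log 2 (1 - \<epsilon>)"

lemma tendsto_fano_slack: "(fano_slack k \<longlongrightarrow> 0) (at_right 0)"
  unfolding fano_slack_def by real_asymp

lemma converse_point:
  fixes P :: "'s1::finite \<Rightarrow> 's2::finite \<Rightarrow> 'w::finite \<Rightarrow> real"
    and W :: "'x1::finite \<Rightarrow> 'x2::finite \<Rightarrow> 'y::finite \<Rightarrow> real"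
  assumes P_pmf: "is_pmf (\<lambda>(s1, s2, w). P s1 s2 w)" and W: "is_channel W"
    and indep: "\<forall>s1 s2. (\<Sum>w\<in>UNIV. P s1 s2 w) =
                   (\<Sum>s2'\<in>UNIV. \<Sum>w\<in>UNIV. P s1 s2' w) * (\<Sum>s1'\<in>UNIV. \<Sum>w\<in>UNIV. P s1' s2 w)"
    and mn: "0 < m" "0 < n" and \<epsilon>: "0 < \<epsilon>" "\<epsilon> < 1" and err: "err_prob P W m n f1 f2 g \<le> \<epsilon>"
  defines "\<beta> \<equiv> real n / real m" and "\<eta> \<equiv> fano_slack (real (CARD('s1) * CARD('s2))) \<epsilon>"
  shows "\<exists>v\<in>convex hull (rate_region W). H1 P \<le> \<beta> * fst v + \<eta> \<and> H2 P \<le> \<beta> * fst (snd v) + \<eta> \<and>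
      H3 P \<le> \<beta> * snd (snd v) + \<eta>"
proof -
  define k where "k = real (CARD('s1) * CARD('s2))"
  define u1 where "u1 = letter1 P m f1"
  define u2 where "u2 = letter2 P m f2"
  have u: "is_pmf (u1 j)" "is_pmf (u2 j)" for j
    unfolding u1_def u2_def by (rule letter_pmf[OF P_pmf W indep])+
  define x where "x j = (I1 W (u1 j) (u2 j), I2 W (u1 j) (u2 j), I3 W (u1 j) (u2 j))" for j
  \<comment> \<open>Time sharing uniformly over the n channel uses.\<close>
  define v where "v = (\<Sum>j<n. (1 / real n) *\<^sub>R x j)"
  have "x j \<in> convex hull (rate_region W)" for j
    using u by (intro hull_inc) (auto simp: x_def rate_region_def)
  then have v: "v \<in> convex hull (rate_region W)"
    unfolding v_def using mn by (intro convex_sum convex_convex_hull) auto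
  have k: "1 \<le> k"
    unfolding k_def using mult_mono[OF CARD_ge_1[where 'a = 's1] CARD_ge_1[where 'a = 's2]] by simp
  define s where "s = slack P W m n f1 f2 g \<epsilon>"
  have "s \<le> real m * \<eta>"
  proof -
    have l: "0 \<le> - log 2 \<epsilon>" "0 \<le> - log 2 (1 - \<epsilon>)" "0 \<le> log 2 k" using \<epsilon> k by auto
    have "(real m * log 2 k - log 2 \<epsilon>) * err_prob P W m n f1 f2 g \<le> (real m * log 2 k - log 2 \<epsilon>) * \<epsilon>"
    proof (rule mult_left_mono[OF err])
      have "0 \<le> real m * log 2 k" using l(3) by (intro mult_nonneg_nonneg) auto
      then show "0 \<le> real m * log 2 k - log 2 \<epsilon>" using l(1) by linarith
    qed
    \<comment> \<open>These terms could be divided by m. Using only 1 \<le> m instead keeps \<eta>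
      independent of the block lengths, over which \<open>achievable\<close> gives no control as
      \<epsilon> tends to 0.\<close>
    moreover have "- (\<epsilon> * log 2 \<epsilon>) - log 2 (1 - \<epsilon>) \<le> real m * (- (\<epsilon> * log 2 \<epsilon>) - log 2 (1 - \<epsilon>))"
    proof -
      have "0 \<le> \<epsilon> * (- log 2 \<epsilon>)"
        by (rule mult_nonneg_nonneg[OF less_imp_le[OF \<epsilon>(1)] l(1)])
      then have "0 \<le> - (\<epsilon> * log 2 \<epsilon>) - log 2 (1 - \<epsilon>)"
        using l(2) unfolding mult_minus_right by linarith
      moreover have "1 \<le> real m" using mn by linarith
      ultimately have "1 * (- (\<epsilon> * log 2 \<epsilon>) - log 2 (1 - \<epsilon>)) \<le> real m * (- (\<epsilon> * log 2 \<epsilon>) - log 2 (1 - \<epsilon>))"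
        by (intro mult_right_mono)
      then show ?thesis unfolding mult_1 .
    qed
    ultimately show ?thesis
      unfolding s_def slack_def[OF P_pmf W indep \<epsilon>] \<eta>_def k_def[symmetric] fano_slack_def by (simp add: algebra_simps)
  qed
  have fin: "h \<le> \<beta> * (\<Sum>j<n. (1 / real n) * J j) + \<eta>" if "real m * h \<le> (\<Sum>j<n. J j) + s" for h J
  proof -
    have "real m * h \<le> (\<Sum>j<n. J j) + real m * \<eta>" using that \<open>s \<le> real m * \<eta>\<close> by linarith
    then have "h \<le> (\<Sum>j<n. J j) / real m + \<eta>" using mn by (simp add: field_simps)
    also have "(\<Sum>j<n. J j) / real m = \<beta> * (\<Sum>j<n. (1 / real n) * J j)"
      using mn by (simp add: \<beta>_def sum_divide_distrib[symmetric])
    finally show ?thesis .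
  qed
  have "fst v = (\<Sum>j<n. (1 / real n) * I1 W (u1 j) (u2 j))" "fst (snd v) = (\<Sum>j<n. (1 / real n) * I2 W (u1 j) (u2 j))"
    "snd (snd v) = (\<Sum>j<n. (1 / real n) * I3 W (u1 j) (u2 j))"
    by (simp_all add: v_def x_def fst_sum snd_sum)
  moreover have "H1 P \<le> \<beta> * (\<Sum>j<n. (1 / real n) * I1 W (u1 j) (u2 j)) + \<eta>"
    unfolding u1_def u2_def by (rule fin[unfolded s_def]) (rule converse_H1[OF P_pmf W indep \<epsilon>])
  moreover have "H2 P \<le> \<beta> * (\<Sum>j<n. (1 / real n) * I2 W (u1 j) (u2 j)) + \<eta>"
    unfolding u1_def u2_def by (rule fin[unfolded s_def]) (rule converse_H2[OF P_pmf W indep \<epsilon>])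
  moreover have "H3 P \<le> \<beta> * (\<Sum>j<n. (1 / real n) * I3 W (u1 j) (u2 j)) + \<eta>"
    unfolding u1_def u2_def by (rule fin[unfolded s_def]) (rule converse_H3[OF P_pmf W indep \<epsilon>])
  ultimately have "H1 P \<le> \<beta> * fst v + \<eta>" "H2 P \<le> \<beta> * fst (snd v) + \<eta>" "H3 P \<le> \<beta> * snd (snd v) + \<eta>"
    by simp_all
  then show ?thesis using v by blast
qed

text \<open>\<open>gap\<close> measures the worst violation of the three inequalities. Minimizing it
  over the compact hull before \<epsilon> is chosen replaces the extraction of a convergent
  subsequence: the fixed minimum lies below every slack, hence below their limit 0.\<close>

lemma rates_if_achievable:
  fixes P :: "'s1::finite \<Rightarrow> 's2::finite \<Rightarrow> 'w::finite \<Rightarrow> real"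
    and W :: "'x1::finite \<Rightarrow> 'x2::finite \<Rightarrow> 'y::finite \<Rightarrow> real"
  assumes P_pmf: "is_pmf (\<lambda>(s1, s2, w). P s1 s2 w)" and W: "is_channel W"
    and indep: "\<forall>s1 s2. (\<Sum>w\<in>UNIV. P s1 s2 w) =
                   (\<Sum>s2'\<in>UNIV. \<Sum>w\<in>UNIV. P s1 s2' w) * (\<Sum>s1'\<in>UNIV. \<Sum>w\<in>UNIV. P s1' s2 w)"
    and ach: "achievable P W b"
  shows "\<exists>pq px1 px2. valid_input_dist pq px1 px2 \<and> rate_conditions (\<le>) P W b pq px1 px2"
proof -
  define C where "C = convex hull (rate_region W)"
  define gap where "gap v = max (H1 P - b * fst v) (max (H2 P - b * fst (snd v)) (H3 P - b * snd (snd v)))"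
    for v :: "real \<times> real \<times> real"
  let ?\<eta> = "fano_slack (real (CARD('s1) * CARD('s2)))"
  have pt: "\<exists>v\<in>C. gap v \<le> ?\<eta> \<epsilon>" if \<epsilon>: "0 < \<epsilon>" "\<epsilon> < 1" for \<epsilon>
  proof -
    obtain m n f1 f2 g where mn: "0 < m" "0 < n" "real n / real m = b" and err: "err_prob P W m n f1 f2 g < \<epsilon>"
      using ach[unfolded achievable_def, rule_format, OF \<epsilon>(1)] by blast
    obtain v where "v \<in> C" and le: "H1 P \<le> b * fst v + ?\<eta> \<epsilon>" "H2 P \<le> b * fst (snd v) + ?\<eta> \<epsilon>"
        "H3 P \<le> b * snd (snd v) + ?\<eta> \<epsilon>"
      using converse_point[OF P_pmf W indep mn(1,2) \<epsilon> less_imp_le[OF err]] unfolding mn(3) C_def by blast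
    have "gap v \<le> ?\<eta> \<epsilon>"
      unfolding gap_def max.bounded_iff using le by (intro conjI) linarith+
    with \<open>v \<in> C\<close> show ?thesis by blast
  qed
  have "compact C" unfolding C_def by (intro compact_convex_hull compact_rate_region W)
  moreover have "C \<noteq> {}" using pt[of "1/2"] by auto
  moreover have "continuous_on C gap" unfolding gap_def by (intro continuous_intros)
  ultimately obtain v where v: "v \<in> C" "\<And>u. u \<in> C \<Longrightarrow> gap v \<le> gap u"
    using continuous_attains_inf[of C gap] by blast
  have "eventually (\<lambda>\<epsilon>. gap v \<le> ?\<eta> \<epsilon>) (at_right 0)"
    unfolding eventually_at_right_field
  proof (intro exI[of _ 1] conjI allI impI)
    fix \<epsilon> :: real assume "0 < \<epsilon>" "\<epsilon> < 1"
    from pt[OF this] obtain u where "u \<in> C" "gap u \<le> ?\<eta> \<epsilon>" by blast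
    with v(2)[of u] show "gap v \<le> ?\<eta> \<epsilon>" by linarith
  qed simp
  then have "gap v \<le> 0"
    by (rule tendsto_lowerbound[OF tendsto_fano_slack]) simp
  moreover obtain v1 v2 v3 where vv: "v = (v1, v2, v3)" by (cases v)
  ultimately have "H1 P \<le> b * v1" "H2 P \<le> b * v2" "H3 P \<le> b * v3"
    by (simp_all add: gap_def)
  moreover obtain pq px1 px2 where valid: "valid_input_dist pq px1 px2"
      and "(\<Sum>q<4. pq q * I1 W (px1 q) (px2 q)) = v1" "(\<Sum>q<4. pq q * I2 W (px1 q) (px2 q)) = v2"
        "(\<Sum>q<4. pq q * I3 W (px1 q) (px2 q)) = v3"
    using rate_region_time_sharing[OF v(1)[unfolded C_def vv]] by blast
  ultimately have "rate_conditions (\<le>) P W b pq px1 px2"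
    unfolding rate_conditions_iff[OF W valid P_pmf] by simp
  with valid show ?thesis by blast
qed

theorem theorem3:
  fixes P :: "'s1::finite \<Rightarrow> 's2::finite \<Rightarrow> 'w::finite \<Rightarrow> real"
    and W :: "'x1::finite \<Rightarrow> 'x2::finite \<Rightarrow> 'y::finite \<Rightarrow> real"
    and b :: real
  assumes P_pmf: "is_pmf (\<lambda>(s1, s2, w). P s1 s2 w)"
    and indep: "\<forall>s1 s2. (\<Sum>w\<in>UNIV. P s1 s2 w) =
                   (\<Sum>s2'\<in>UNIV. \<Sum>w\<in>UNIV. P s1 s2' w) * (\<Sum>s1'\<in>UNIV. \<Sum>w\<in>UNIV. P s1' s2 w)"
    and W_channel: "is_channel W"
    and b_rat: "b \<in> \<rat>"
  shows "((\<exists>pq px1 px2. valid_input_dist pq px1 px2 \<and> rate_conditions (<) P W b pq px1 px2)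
            \<longrightarrow> achievable P W b)
       \<and> (achievable P W b
            \<longrightarrow> (\<exists>pq px1 px2. valid_input_dist pq px1 px2 \<and> rate_conditions (\<le>) P W b pq px1 px2))"
  using achievable_if_strict[OF P_pmf W_channel _ b_rat] rates_if_achievable[OF P_pmf W_channel indep] by blast

end
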